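(* Let $n\ge 3$, let $M$ be equipped with a real analytic structure, and let $L$ be a proper pseudo-Finsler metric on $A$ with indefinite $g$ which is analytic on $\overline{A}$. Then there exists at most one symmetric proper solution $\mathrm{N}$ of the affine equation of $L$ that is analytic on $\overline{A}$.
   Context: $M$ is a connected manifold of dimension $n$, $\pi:TM\to M$ the projection. Charts $(x^i)$ of $M$ induce charts $(x^i,y^i)$ of $TM$; $\partial_i=\partial/\partial x^i$, $\dot\partial_i=\partial/\partial y^i$; repeated indices are summed over $1,\dots,n$. $A\subseteq TM\setminus\mathbf{0}$ is open and conic ($\lambda v\in A$ for $v\in A$, $\lambda>0$) with $\pi(A)=M$; $A_p=A\cap T_pM$; $\overline A$ is the closure of $A$ in $TM\setminus\mathbf 0$ and $\partial A=\overline A\setminus A$. An anisotropic tensor of type $(r,s)$ is a smooth section of the pullback to $A$ of $\bigotimes^rTM\otimes\bigotimes^sT^*M$, with components $T^{i_1\dots i_r}_{j_1\dots j_s}(x,y)$; the space of those whose components are positively $\alpha$-homogeneous in $y$ is $\mathrm{h}^\alpha\mathcal{T}^r_s(M_A)$. A subscript $\cdot i$ denotes $\dot\partial_i$. A homogeneous nonlinear connection $\mathrm{N}$ on $A$ is given in each chart by smooth functions $\mathrm{N}_i^k(x,y)$, positively $1$-homogeneous in $y$, transforming by $\bar{\mathrm{N}}_i^k=\frac{\partial\bar x^k}{\partial x^c}\frac{\partial^2x^c}{\partial\bar x^i\partial\bar x^b}\bar y^b+\frac{\partial\bar x^k}{\partial x^c}\frac{\partial x^a}{\partial\bar x^i}\mathrm{N}_a^c$.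 Differences of two such are elements of $\mathrm{h}^1\mathcal{T}^1_1(M_A)$. $\mathrm{N}$ is symmetric if $\mathrm{N}^k_{i\cdot j}-\mathrm{N}^k_{j\cdot i}=0$. A pseudo-Finsler metric on $A$ is a smooth positively $2$-homogeneous $L:A\to\mathbb{R}$ with $g_{ij}=\frac12L_{\cdot i\cdot j}$ non-degenerate everywhere. It is proper if (i) each $A_p$ is connected and $L>0$ on $A$, and (ii) $L$ extends smoothly to $\overline A$ with $L=0$ and $g$ non-degenerate on $\partial A$ (then $g$ has constant signature). Indices are moved with $g$; $y_i=g_{ia}y^a$. Metric spray: $(\mathrm{G}^L)^i=\frac14g^{ia}(2\partial_cg_{ab}-\partial_ag_{bc})y^by^c$; metric nonlinear connection: $(\mathrm{N}^L)_i^k=\dot\partial_i(\mathrm{G}^L)^k$. $\mathrm{C}_{ijk}=\frac12g_{ij\cdot k}$, $\mathrm{C}_i=g^{ab}\mathrm{C}_{abi}$. $\mathrm{Lan}_{ijk}=\frac12\nabla^L_kg_{ij}$ with $\nabla^L_kg_{ij}=(\partial_k-(\mathrm{N}^L)_k^a\dot\partial_a)g_{ij}-(\mathrm{N}^L)^a_{k\cdot i}g_{aj}-(\mathrm{N}^L)^a_{k\cdot j}g_{ia}$, $\mathrm{Lan}_i=g^{ab}\mathrm{Lan}_{abi}$. A homogeneous nonlinear connection $\mathrm{N}=\mathrm{N}^L+\mathcal{J}$, $\mathcal{J}\in\mathrm{h}^1\mathcal{T}^1_1(M_A)$, is a solution of the affine equation of $L$ if on $A$ $$\Big\{2\mathrm{Lan}_b+(n+2)\tfrac{y_a}{L}\mathcal{J}^a_b-2\mathrm{C}_a\mathcal{J}^a_b-(\mathcal{J}^a_{b\cdot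 a}+\mathcal{J}^a_{a\cdot b})\Big\}(\delta^b_iy^j-y^b\delta^j_i)-(\mathcal{J}^j_{i\cdot a}-\mathcal{J}^j_{a\cdot i})y^a=0 .$$ It is a proper solution if moreover it extends smoothly to $\overline A$. "Analytic on $\overline A$" means real analytic on $A$ and up to the boundary (locally the restriction of a real analytic object defined on an open set of $TM\setminus\mathbf 0$), in analytic charts. *)

theory Defs
  imports "HOL-Analysis.Analysis"
begin

section \<open>Smooth and real analytic maps between Euclidean spaces\<close>

fun Ck_on :: "nat \<Rightarrow> 'a::euclidean_space set \<Rightarrow> ('a \<Rightarrow> 'b::real_normed_vector) \<Rightarrow> bool" where
  "Ck_on 0 S f \<longleftrightarrow> continuous_on S f"
| "Ck_on (Suc k) S f \<longleftrightarrow>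
     (\<forall>x\<in>S. f differentiable (at x)) \<and>
     (\<forall>v. Ck_on k S (\<lambda>x. frechet_derivative f (at x) v))"

text \<open>The set \<open>S\<close> is meant to be open here and in \<open>real_analytic_on\<close> below.\<close>

definition smooth_on :: "'a::euclidean_space set \<Rightarrow> ('a \<Rightarrow> 'b::real_normed_vector) \<Rightarrow> bool" where
  "smooth_on S f \<longleftrightarrow> (\<forall>k. Ck_on k S f)"

text \<open>Multi-indices are extensional functions from \<open>Basis\<close> to \<open>nat\<close>; \<open>f\<close> is the sum of a
  power series in several variables on a cube centred at \<open>x\<close>.\<close>

definition real_analytic_at :: "('a::euclidean_space \<Rightarrow> 'b::real_normed_vector) \<Rightarrow> 'a \<Rightarrow> bool" where
  "real_analytic_at f x \<longleftrightarrow>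
     (\<exists>r>0. \<exists>a :: ('a \<Rightarrow> nat) \<Rightarrow> 'b.
        \<forall>h. (\<forall>e\<in>Basis. \<bar>h \<bullet> e\<bar> < r) \<longrightarrow>
          ((\<lambda>m. (\<Prod>e\<in>Basis. (h \<bullet> e) ^ m e) *\<^sub>R a m) has_sum f (x + h)) (Basis \<rightarrow>\<^sub>E UNIV))"

definition real_analytic_on :: "'a::euclidean_space set \<Rightarrow> ('a \<Rightarrow> 'b::real_normed_vector) \<Rightarrow> bool" where
  "real_analytic_on S f \<longleftrightarrow> (\<forall>x\<in>S. real_analytic_at f x)"

text \<open>\<open>F\<close> is of class \<open>R\<close> on a neighbourhood of \<open>z\<close> and extends \<open>f\<close>, which is given on \<open>S\<close>.
  If \<open>S\<close> is open and \<open>z\<close> lies in its closure, \<open>F\<close> and its derivatives at \<open>z\<close> are determined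
  by \<open>f\<close>.\<close>

definition extends_near ::
  "('a::euclidean_space set \<Rightarrow> ('a \<Rightarrow> 'b::real_normed_vector) \<Rightarrow> bool) \<Rightarrow>
     'a set \<Rightarrow> ('a \<Rightarrow> 'b) \<Rightarrow> 'a \<Rightarrow> ('a \<Rightarrow> 'b) \<Rightarrow> bool" where
  "extends_near R S f z F \<longleftrightarrow> (\<exists>W. open W \<and> z \<in> W \<and> R W F \<and> (\<forall>u\<in>W \<inter> S. F u = f u))"

section \<open>Analytic manifolds and their tangent bundles\<close>

text \<open>A chart is a pair of its domain and its coordinate map.\<close>

type_synonym ('a, 'n) chart = "'a set \<times> ('a \<Rightarrow> real ^ 'n)"

definition transition :: "('a, 'n::finite) chart \<Rightarrow> ('a, 'n) chart \<Rightarrow> real ^ 'n \<Rightarrow> real ^ 'n" where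
  "transition \<phi> \<psi> = snd \<psi> \<circ> inv_into (fst \<phi>) (snd \<phi>)"

definition analytic_manifold :: "'a topology \<Rightarrow> ('a, 'n::finite) chart set \<Rightarrow> bool" where
  "analytic_manifold M \<A> \<longleftrightarrow>
     Hausdorff_space M \<and> second_countable M \<and>
     (\<Union>\<phi>\<in>\<A>. fst \<phi>) = topspace M \<and>
     (\<forall>\<phi>\<in>\<A>. openin M (fst \<phi>) \<and> open (snd \<phi> ` fst \<phi>) \<and>
        homeomorphic_map (subtopology M (fst \<phi>)) (top_of_set (snd \<phi> ` fst \<phi>)) (snd \<phi>)) \<and>
     (\<forall>\<phi>\<in>\<A>. \<forall>\<psi>\<in>\<A>. real_analytic_on (snd \<phi> ` (fst \<phi> \<inter> fst \<psi>)) (transition \<phi> \<psi>))"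

text \<open>A tangent vector at \<open>p\<close> is a pair \<open>(p, w)\<close>, where \<open>w \<phi>\<close> is the tuple of components with
  respect to the chart \<open>\<phi>\<close> around \<open>p\<close>; different charts are related by the Jacobian of
  the change of coordinates. For all other arguments \<open>w\<close> is set to \<open>0\<close>.\<close>

type_synonym ('a, 'n) tvec = "'a \<times> (('a, 'n) chart \<Rightarrow> real ^ 'n)"

type_synonym 'n tcoord = "(real ^ 'n) \<times> (real ^ 'n)"

definition TM :: "('a, 'n::finite) chart set \<Rightarrow> ('a, 'n) tvec set" where
  "TM \<A> = {(p, w). p \<in> (\<Union>\<phi>\<in>\<A>. fst \<phi>) \<and>
     (\<forall>\<phi>. \<not> (\<phi> \<in> \<A> \<and> p \<in> fst \<phi>) \<longrightarrow> w \<phi> = 0) \<and>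
     (\<forall>\<phi>\<in>\<A>. \<forall>\<psi>\<in>\<A>. p \<in> fst \<phi> \<inter> fst \<psi> \<longrightarrow>
        w \<psi> = frechet_derivative (transition \<phi> \<psi>) (at (snd \<phi> p)) (w \<phi>))}"

definition slit_TM :: "('a, 'n::finite) chart set \<Rightarrow> ('a, 'n) tvec set" where
  "slit_TM \<A> = {v \<in> TM \<A>. snd v \<noteq> (\<lambda>_. 0)}"

definition tscale :: "real \<Rightarrow> ('a, 'n::finite) tvec \<Rightarrow> ('a, 'n) tvec" where
  "tscale t v = (fst v, \<lambda>\<phi>. t *\<^sub>R snd v \<phi>)"

definition tchart_dom :: "('a, 'n::finite) chart set \<Rightarrow> ('a, 'n) chart \<Rightarrow> ('a, 'n) tvec set" where
  "tchart_dom \<A> \<phi> = {v \<in> TM \<A>. fst v \<in> fst \<phi>}"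

definition tchart :: "('a, 'n::finite) chart \<Rightarrow> ('a, 'n) tvec \<Rightarrow> 'n tcoord" where
  "tchart \<phi> v = (snd \<phi> (fst v), snd v \<phi>)"

definition TM_top :: "('a, 'n::finite) chart set \<Rightarrow> ('a, 'n) tvec topology" where
  "TM_top \<A> = topology_generated_by
     {{v \<in> tchart_dom \<A> \<phi>. tchart \<phi> v \<in> V} | \<phi> V. \<phi> \<in> \<A> \<and> open V}"

text \<open>Coordinate images of subsets of \<open>TM\<close> and coordinate expressions of functions on \<open>TM\<close>.\<close>

definition cset ::
  "('a, 'n::finite) chart set \<Rightarrow> ('a, 'n) chart \<Rightarrow> ('a, 'n) tvec set \<Rightarrow> 'n tcoord set" where
  "cset \<A> \<phi> S = tchart \<phi> ` (S \<inter> tchart_dom \<A> \<phi>)"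

definition cfun ::
  "('a, 'n::finite) chart set \<Rightarrow> ('a, 'n) chart \<Rightarrow> (('a, 'n) tvec \<Rightarrow> real) \<Rightarrow> 'n tcoord \<Rightarrow> real" where
  "cfun \<A> \<phi> f = f \<circ> inv_into (tchart_dom \<A> \<phi>) (tchart \<phi>)"

definition conic_domain :: "('a, 'n::finite) chart set \<Rightarrow> ('a, 'n) tvec set \<Rightarrow> bool" where
  "conic_domain \<A> A \<longleftrightarrow>
     A \<subseteq> slit_TM \<A> \<and> openin (TM_top \<A>) A \<and>
     (\<forall>v\<in>A. \<forall>t>0. tscale t v \<in> A) \<and> fst ` A = (\<Union>\<phi>\<in>\<A>. fst \<phi>)"

definition slit_closure :: "('a, 'n::finite) chart set \<Rightarrow> ('a, 'n) tvec set \<Rightarrow> ('a, 'n) tvec set" where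
  "slit_closure \<A> A = subtopology (TM_top \<A>) (slit_TM \<A>) closure_of A"

definition slit_boundary :: "('a, 'n::finite) chart set \<Rightarrow> ('a, 'n) tvec set \<Rightarrow> ('a, 'n) tvec set" where
  "slit_boundary \<A> A = slit_closure \<A> A - A"

section \<open>Partial derivatives\<close>

text \<open>\<open>pd i\<close> is the \<open>i\<close>-th partial derivative on \<open>real ^ 'n\<close>; \<open>xd i\<close> and \<open>yd i\<close> are
  the derivatives with respect to \<open>x\<^sup>i\<close> and \<open>y\<^sup>i\<close> in coordinates \<open>(x, y)\<close>.\<close>

definition pd :: "'n::finite \<Rightarrow> (real ^ 'n \<Rightarrow> real) \<Rightarrow> real ^ 'n \<Rightarrow> real" where
  "pd i f x = frechet_derivative f (at x) (axis i 1)"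

definition xd :: "'n::finite \<Rightarrow> ('n tcoord \<Rightarrow> real) \<Rightarrow> 'n tcoord \<Rightarrow> real" where
  "xd i f z = frechet_derivative f (at z) (axis i 1, 0)"

definition yd :: "'n::finite \<Rightarrow> ('n tcoord \<Rightarrow> real) \<Rightarrow> 'n tcoord \<Rightarrow> real" where
  "yd i f z = frechet_derivative f (at z) (0, axis i 1)"

section \<open>Nonlinear connections and anisotropic tensors\<close>

text \<open>Both are families of matrix-valued functions indexed by the charts of the atlas; the upper
  index is the row, the lower index the column: \<open>N \<phi> z $ k $ i\<close> stands for
  \<open>N\<^sub>i\<^sup>k\<close> at the point with coordinates \<open>z\<close> in the chart \<open>\<phi>\<close>. Only the values on the coordinate
  image of \<open>A\<close> are relevant.\<close>

type_synonym ('a, 'n) chart_field = "('a, 'n) chart \<Rightarrow> 'n tcoord \<Rightarrow> real ^ 'n ^ 'n"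

definition nonlinear_connection ::
  "('a, 'n::finite) chart set \<Rightarrow> ('a, 'n) tvec set \<Rightarrow> ('a, 'n) chart_field \<Rightarrow> bool" where
  "nonlinear_connection \<A> A N \<longleftrightarrow>
     (\<forall>\<phi>\<in>\<A>. smooth_on (cset \<A> \<phi> A) (N \<phi>) \<and>
        (\<forall>(x, y)\<in>cset \<A> \<phi> A. \<forall>t>0. N \<phi> (x, t *\<^sub>R y) = t *\<^sub>R N \<phi> (x, y))) \<and>
     (\<forall>\<phi>\<in>\<A>. \<forall>\<psi>\<in>\<A>. \<forall>v\<in>A. fst v \<in> fst \<phi> \<inter> fst \<psi> \<longrightarrow>
        (let z = tchart \<phi> v; z' = tchart \<psi> v;
             dx' = (\<lambda>k c. pd c (\<lambda>x. transition \<phi> \<psi> x $ k) (fst z));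
             dx = (\<lambda>a i. pd i (\<lambda>x. transition \<psi> \<phi> x $ a) (fst z'));
             ddx = (\<lambda>c i b. pd i (pd b (\<lambda>x. transition \<psi> \<phi> x $ c)) (fst z'))
         in \<forall>i k. N \<psi> z' $ k $ i =
              (\<Sum>c\<in>UNIV. \<Sum>b\<in>UNIV. dx' k c * ddx c i b * snd z' $ b) +
              (\<Sum>c\<in>UNIV. \<Sum>a\<in>UNIV. dx' k c * dx a i * N \<phi> z $ c $ a)))"

text \<open>Anisotropic tensors of type \<open>(1, 1)\<close>, positively homogeneous of degree \<open>\<alpha>\<close>.\<close>

definition anisotropic_tensor11 ::
  "real \<Rightarrow> ('a, 'n::finite) chart set \<Rightarrow> ('a, 'n) tvec set \<Rightarrow> ('a, 'n) chart_field \<Rightarrow> bool" where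
  "anisotropic_tensor11 \<alpha> \<A> A T \<longleftrightarrow>
     (\<forall>\<phi>\<in>\<A>. smooth_on (cset \<A> \<phi> A) (T \<phi>) \<and>
        (\<forall>(x, y)\<in>cset \<A> \<phi> A. \<forall>t>0. T \<phi> (x, t *\<^sub>R y) = (t powr \<alpha>) *\<^sub>R T \<phi> (x, y))) \<and>
     (\<forall>\<phi>\<in>\<A>. \<forall>\<psi>\<in>\<A>. \<forall>v\<in>A. fst v \<in> fst \<phi> \<inter> fst \<psi> \<longrightarrow>
        (let z = tchart \<phi> v; z' = tchart \<psi> v;
             dx' = (\<lambda>k c. pd c (\<lambda>x. transition \<phi> \<psi> x $ k) (fst z));
             dx = (\<lambda>a i. pd i (\<lambda>x. transition \<psi> \<phi> x $ a) (fst z'))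
         in \<forall>i k. T \<psi> z' $ k $ i = (\<Sum>c\<in>UNIV. \<Sum>a\<in>UNIV. dx' k c * dx a i * T \<phi> z $ c $ a)))"

definition symmetric_connection ::
  "('a, 'n::finite) chart set \<Rightarrow> ('a, 'n) tvec set \<Rightarrow> ('a, 'n) chart_field \<Rightarrow> bool" where
  "symmetric_connection \<A> A N \<longleftrightarrow>
     (\<forall>\<phi>\<in>\<A>. \<forall>z\<in>cset \<A> \<phi> A. \<forall>i j k.
        yd j (\<lambda>u. N \<phi> u $ k $ i) z - yd i (\<lambda>u. N \<phi> u $ k $ j) z = 0)"

section \<open>Pseudo-Finsler geometry in coordinates\<close>

text \<open>Here \<open>l\<close> is the expression of \<open>L\<close> in the coordinates \<open>(x, y)\<close> of an induced chart.\<close>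

definition gmat :: "('n::finite tcoord \<Rightarrow> real) \<Rightarrow> 'n tcoord \<Rightarrow> real ^ 'n ^ 'n" where
  "gmat l z = (\<chi> i j. 1/2 * yd j (yd i l) z)"

definition ginv :: "('n::finite tcoord \<Rightarrow> real) \<Rightarrow> 'n tcoord \<Rightarrow> real ^ 'n ^ 'n" where
  "ginv l z = matrix_inv (gmat l z)"

definition ylow :: "('n::finite tcoord \<Rightarrow> real) \<Rightarrow> 'n tcoord \<Rightarrow> 'n \<Rightarrow> real" where
  "ylow l z i = (\<Sum>a\<in>UNIV. gmat l z $ i $ a * snd z $ a)"

definition metric_spray :: "('n::finite tcoord \<Rightarrow> real) \<Rightarrow> 'n tcoord \<Rightarrow> 'n \<Rightarrow> real" where
  "metric_spray l z i =
     1/4 * (\<Sum>a\<in>UNIV. \<Sum>b\<in>UNIV. \<Sum>c\<in>UNIV.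
       ginv l z $ i $ a *
       (2 * xd c (\<lambda>u. gmat l u $ a $ b) z - xd a (\<lambda>u. gmat l u $ b $ c) z) *
       snd z $ b * snd z $ c)"

definition metric_connection :: "('n::finite tcoord \<Rightarrow> real) \<Rightarrow> 'n tcoord \<Rightarrow> real ^ 'n ^ 'n" where
  "metric_connection l z = (\<chi> k i. yd i (\<lambda>u. metric_spray l u k) z)"

definition cartan :: "('n::finite tcoord \<Rightarrow> real) \<Rightarrow> 'n tcoord \<Rightarrow> 'n \<Rightarrow> 'n \<Rightarrow> 'n \<Rightarrow> real" where
  "cartan l z i j k = 1/2 * yd k (\<lambda>u. gmat l u $ i $ j) z"

definition mean_cartan :: "('n::finite tcoord \<Rightarrow> real) \<Rightarrow> 'n tcoord \<Rightarrow> 'n \<Rightarrow> real" where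
  "mean_cartan l z i = (\<Sum>a\<in>UNIV. \<Sum>b\<in>UNIV. ginv l z $ a $ b * cartan l z a b i)"

definition nabla_g :: "('n::finite tcoord \<Rightarrow> real) \<Rightarrow> 'n tcoord \<Rightarrow> 'n \<Rightarrow> 'n \<Rightarrow> 'n \<Rightarrow> real" where
  "nabla_g l z k i j =
     xd k (\<lambda>u. gmat l u $ i $ j) z
     - (\<Sum>a\<in>UNIV. metric_connection l z $ a $ k * yd a (\<lambda>u. gmat l u $ i $ j) z)
     - (\<Sum>a\<in>UNIV. yd i (\<lambda>u. metric_connection l u $ a $ k) z * gmat l z $ a $ j)
     - (\<Sum>a\<in>UNIV. yd j (\<lambda>u. metric_connection l u $ a $ k) z * gmat l z $ i $ a)"

definition landsberg :: "('n::finite tcoord \<Rightarrow> real) \<Rightarrow> 'n tcoord \<Rightarrow> 'n \<Rightarrow> 'n \<Rightarrow> 'n \<Rightarrow> real" where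
  "landsberg l z i j k = 1/2 * nabla_g l z k i j"

definition mean_landsberg :: "('n::finite tcoord \<Rightarrow> real) \<Rightarrow> 'n tcoord \<Rightarrow> 'n \<Rightarrow> real" where
  "mean_landsberg l z i = (\<Sum>a\<in>UNIV. \<Sum>b\<in>UNIV. ginv l z $ a $ b * landsberg l z a b i)"

section \<open>Proper pseudo-Finsler metrics\<close>

definition pseudo_finsler ::
  "('a, 'n::finite) chart set \<Rightarrow> ('a, 'n) tvec set \<Rightarrow> (('a, 'n) tvec \<Rightarrow> real) \<Rightarrow> bool" where
  "pseudo_finsler \<A> A L \<longleftrightarrow>
     (\<forall>v\<in>A. \<forall>t>0. L (tscale t v) = t\<^sup>2 * L v) \<and>
     (\<forall>\<phi>\<in>\<A>. smooth_on (cset \<A> \<phi> A) (cfun \<A> \<phi> L) \<and>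
        (\<forall>z\<in>cset \<A> \<phi> A. invertible (gmat (cfun \<A> \<phi> L) z)))"

definition proper_pseudo_finsler ::
  "('a, 'n::finite) chart set \<Rightarrow> ('a, 'n) tvec set \<Rightarrow> (('a, 'n) tvec \<Rightarrow> real) \<Rightarrow> bool" where
  "proper_pseudo_finsler \<A> A L \<longleftrightarrow>
     pseudo_finsler \<A> A L \<and>
     (\<forall>p\<in>(\<Union>\<phi>\<in>\<A>. fst \<phi>). connectedin (TM_top \<A>) {v \<in> A. fst v = p}) \<and>
     (\<forall>v\<in>A. L v > 0) \<and>
     (\<forall>\<phi>\<in>\<A>. \<forall>z\<in>cset \<A> \<phi> (slit_closure \<A> A).
        \<exists>F. extends_near smooth_on (cset \<A> \<phi> A) (cfun \<A> \<phi> L) z F \<and>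
          (z \<in> cset \<A> \<phi> (slit_boundary \<A> A) \<longrightarrow> F z = 0 \<and> invertible (gmat F z)))"

definition indefinite_metric ::
  "('a, 'n::finite) chart set \<Rightarrow> ('a, 'n) tvec set \<Rightarrow> (('a, 'n) tvec \<Rightarrow> real) \<Rightarrow> bool" where
  "indefinite_metric \<A> A L \<longleftrightarrow>
     (\<forall>\<phi>\<in>\<A>. \<forall>z\<in>cset \<A> \<phi> A.
        (\<exists>u. u \<bullet> (gmat (cfun \<A> \<phi> L) z *v u) > 0) \<and>
        (\<exists>u. u \<bullet> (gmat (cfun \<A> \<phi> L) z *v u) < 0))"

definition metric_analytic_closure ::
  "('a, 'n::finite) chart set \<Rightarrow> ('a, 'n) tvec set \<Rightarrow> (('a, 'n) tvec \<Rightarrow> real) \<Rightarrow> bool" where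
  "metric_analytic_closure \<A> A L \<longleftrightarrow>
     (\<forall>\<phi>\<in>\<A>. \<forall>z\<in>cset \<A> \<phi> (slit_closure \<A> A).
        \<exists>F. extends_near real_analytic_on (cset \<A> \<phi> A) (cfun \<A> \<phi> L) z F)"

section \<open>The affine equation\<close>

definition affine_equation_at ::
  "('n::finite tcoord \<Rightarrow> real) \<Rightarrow> ('n tcoord \<Rightarrow> real ^ 'n ^ 'n) \<Rightarrow> 'n tcoord \<Rightarrow> bool" where
  "affine_equation_at l J z \<longleftrightarrow>
     (let n = real CARD('n); y = (\<lambda>i. snd z $ i);
          dJ = (\<lambda>k i j. yd j (\<lambda>u. J u $ k $ i) z);
          \<delta> = (\<lambda>b i. if b = i then 1 else 0);
          E = (\<lambda>b. 2 * mean_landsberg l z b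
                 + (n + 2) * (\<Sum>a\<in>UNIV. ylow l z a / l z * J z $ a $ b)
                 - 2 * (\<Sum>a\<in>UNIV. mean_cartan l z a * J z $ a $ b)
                 - (\<Sum>a\<in>UNIV. dJ a b a + dJ a a b))
      in \<forall>i j. (\<Sum>b\<in>UNIV. E b * (\<delta> b i * y j - y b * \<delta> j i))
               - (\<Sum>a\<in>UNIV. (dJ j i a - dJ j a i) * y a) = 0)"

definition affine_solution ::
  "('a, 'n::finite) chart set \<Rightarrow> ('a, 'n) tvec set \<Rightarrow> (('a, 'n) tvec \<Rightarrow> real) \<Rightarrow>
     ('a, 'n) chart_field \<Rightarrow> bool" where
  "affine_solution \<A> A L N \<longleftrightarrow>
     nonlinear_connection \<A> A N \<and>
     (\<exists>J. anisotropic_tensor11 1 \<A> A J \<and>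
        (\<forall>\<phi>\<in>\<A>. \<forall>z\<in>cset \<A> \<phi> A.
           N \<phi> z = metric_connection (cfun \<A> \<phi> L) z + J \<phi> z \<and>
           affine_equation_at (cfun \<A> \<phi> L) (J \<phi>) z))"

definition proper_affine_solution ::
  "('a, 'n::finite) chart set \<Rightarrow> ('a, 'n) tvec set \<Rightarrow> (('a, 'n) tvec \<Rightarrow> real) \<Rightarrow>
     ('a, 'n) chart_field \<Rightarrow> bool" where
  "proper_affine_solution \<A> A L N \<longleftrightarrow>
     affine_solution \<A> A L N \<and>
     (\<forall>\<phi>\<in>\<A>. \<forall>z\<in>cset \<A> \<phi> (slit_closure \<A> A).
        \<exists>F. extends_near smooth_on (cset \<A> \<phi> A) (N \<phi>) z F)"

definition connection_analytic_closure ::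
  "('a, 'n::finite) chart set \<Rightarrow> ('a, 'n) tvec set \<Rightarrow> ('a, 'n) chart_field \<Rightarrow> bool" where
  "connection_analytic_closure \<A> A N \<longleftrightarrow>
     (\<forall>\<phi>\<in>\<A>. \<forall>z\<in>cset \<A> \<phi> (slit_closure \<A> A).
        \<exists>F. extends_near real_analytic_on (cset \<A> \<phi> A) (N \<phi>) z F)"

text \<open>Equality of connections on \<open>A\<close>; off the coordinate images of \<open>A\<close> a \<open>chart_field\<close> carries
  no information.\<close>

definition same_connection ::
  "('a, 'n::finite) chart set \<Rightarrow> ('a, 'n) tvec set \<Rightarrow> ('a, 'n) chart_field \<Rightarrow>
     ('a, 'n) chart_field \<Rightarrow> bool" where
  "same_connection \<A> A N N' \<longleftrightarrow> (\<forall>\<phi>\<in>\<A>. \<forall>z\<in>cset \<A> \<phi> A. N \<phi> z = N' \<phi> z)"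

end

theory Submission
  imports Defs
begin

text \<open>The difference \<open>D = N - N'\<close> of two symmetric solutions solves an equation in which only derivatives
  along the fibres of \<open>TM\<close> occur, so one can fix a point \<open>p\<close> and work in the cone
  \<open>S = A\<^sub>p\<close> of the vector space \<open>T\<^sub>pM\<close>.
  Symmetry and homogeneity give \<open>D\<^sup>k\<^sub>i = \<partial>\<^sub>iP\<^sup>k\<close> with \<open>P\<^sup>k = 1/2 D\<^sup>k\<^sub>iy\<^sup>i\<close>, and the algebraic
  form of the affine equation forces its bracket to vanish (\<open>affine_equation_difference\<close>):
  \<open>(n + 2)/L y\<^sub>a \<partial>\<^sub>bP\<^sup>a - 2 C\<^sub>a \<partial>\<^sub>bP\<^sup>a - 2 \<partial>\<^sub>b(\<partial>\<^sub>aP\<^sup>a) = 0\<close>. Contraction with \<open>y\<^sup>b\<close> expresses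
  the divergence \<open>\<partial>\<^sub>aP\<^sup>a\<close> by \<open>P\<close> itself, and differentiating that expression turns the
  equation into one of first order in \<open>P\<close>.

  The first order equation is singular where \<open>L = 0\<close>, and this singularity forces \<open>P\<close> to vanish
  there. Near a boundary point of \<open>S\<close> write \<open>P = L\<^sup>k B\<close> with \<open>B\<close> smooth up to the boundary.
  The two equations successively give \<open>y\<^sub>aB\<^sup>a = L t\<close>, then
  \<open>B\<^sup>a = (2 - 2k) t y\<^sup>a + L Z\<^sup>a\<close>, and finally \<open>(4k\<^sup>2 - 2 - n(2k - 1)) t = O(L)\<close> with \<open>t\<close> and \<open>Z\<close>
  smooth up to the boundary. For \<open>n \<ge> 3\<close> the numerical factor is never zero, so \<open>B\<close> is divisible
  by \<open>L\<close> (\<open>extension_divisible_by_l\<close>). By induction \<open>P\<close>, and with it \<open>D\<close>, is divisible by every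
  power of \<open>L\<close>; being analytic at the boundary point, \<open>D\<close> vanishes on an open part of \<open>S\<close>
  (\<open>difference_zero_near_touching_ball\<close>) and hence on the connected set \<open>S\<close>
  (\<open>smooth_identity_theorem\<close>).

  A boundary point exists because \<open>g\<close> is indefinite (\<open>cone_has_boundary\<close>): otherwise \<open>S\<close> would be
  \<open>T\<^sub>pM\<close> without the origin, and where \<open>L/\<bar>y\<bar>\<^sup>2\<close> attains its minimum on the unit sphere the
  Hessian of \<open>L\<close> would be positive definite.\<close>

section \<open>Calculus of smooth functions\<close>

text \<open>This holds at points of non-differentiability as well: \<open>f\<close> and \<open>g\<close> have the same, possibly empty, set
  of derivatives at \<open>x\<close>, from which both sides are chosen by the same rule.\<close>
lemma frechet_derivative_cong_open:
  assumes "open S" "x \<in> S" "\<And>u. u \<in> S \<Longrightarrow> f u = g u"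
  shows "frechet_derivative f (at x) = frechet_derivative g (at x)"
proof -
  have "(f has_derivative d) (at x) \<longleftrightarrow> (g has_derivative d) (at x)" for d
    using has_derivative_transform_within_open[of f d x UNIV S g]
      has_derivative_transform_within_open[of g d x UNIV S f] assms by fastforce
  then show ?thesis by (simp add: frechet_derivative_def)
qed

lemma differentiable_cong_open:
  assumes "open S" "x \<in> S" "\<And>u. u \<in> S \<Longrightarrow> f u = g u" "f differentiable (at x)"
  shows "g differentiable (at x)"
  using assms has_derivative_transform_within_open[of f _ x UNIV S g]
  unfolding differentiable_def by fastforce

lemma Ck_on_cong:
  assumes "open S" "\<And>x. x \<in> S \<Longrightarrow> f x = g x" "Ck_on k S f"
  shows "Ck_on k S g"
  using assms(2,3)
proof (induction k arbitrary: f g)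
  case 0
  then show ?case by (simp cong: continuous_on_cong)
next
  case (Suc k)
  have "g differentiable (at x)" if "x \<in> S" for x
    using Suc.prems that differentiable_cong_open[OF assms(1) that, of f g] by simp
  moreover have "Ck_on k S (\<lambda>x. frechet_derivative g (at x) v)" for v
  proof (rule Suc.IH)
    show "Ck_on k S (\<lambda>x. frechet_derivative f (at x) v)" using Suc.prems by simp
    show "frechet_derivative f (at x) v = frechet_derivative g (at x) v" if "x \<in> S" for x
      using frechet_derivative_cong_open[OF assms(1) that, of f g] Suc.prems(1) by simp
  qed
  ultimately show ?case by simp
qed

lemma Ck_on_subset: "Ck_on k S f \<Longrightarrow> T \<subseteq> S \<Longrightarrow> Ck_on k T f"
  by (induction k arbitrary: f) (auto intro: continuous_on_subset)

lemma Ck_on_Suc_imp: "Ck_on (Suc k) S f \<Longrightarrow> Ck_on k S f"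
proof (induction k arbitrary: f)
  case 0
  then show ?case
    by (auto intro!: continuous_at_imp_continuous_on differentiable_imp_continuous_within)
next
  case (Suc k)
  then show ?case using Ck_on.simps(2) by blast
qed

lemma Ck_on_has_derivative:
  "Ck_on (Suc k) S f \<Longrightarrow> x \<in> S \<Longrightarrow> (f has_derivative frechet_derivative f (at x)) (at x)"
  using frechet_derivative_works Ck_on.simps(2) by blast

lemma Ck_on_const: "Ck_on k S (\<lambda>_. c)"
  by (induction k arbitrary: c) auto

lemma Ck_on_bounded_linear:
  assumes "bounded_linear h" shows "Ck_on k S h"
proof (cases k)
  case 0
  then show ?thesis using assms by (simp add: linear_continuous_on)
next
  case (Suc j)
  have "frechet_derivative h (at x) = h" for x
    using bounded_linear_imp_has_derivative[OF assms] frechet_derivative_at by metis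
  then show ?thesis using Suc assms
    by (auto simp: Ck_on_const bounded_linear_imp_differentiable)
qed

lemma Ck_on_compose_bounded_linear:
  assumes "open S" "bounded_linear h" "Ck_on k S f"
  shows "Ck_on k S (\<lambda>x. h (f x))"
  using assms(3)
proof (induction k arbitrary: f)
  case 0
  then show ?case using assms by (simp add: bounded_linear.continuous_on)
next
  case (Suc k)
  have D: "((\<lambda>x. h (f x)) has_derivative (\<lambda>v. h (frechet_derivative f (at x) v))) (at x)"
    if "x \<in> S" for x
    by (rule bounded_linear.has_derivative[OF assms(2) Ck_on_has_derivative[OF Suc.prems that]])
  have "Ck_on k S (\<lambda>x. frechet_derivative (\<lambda>x. h (f x)) (at x) v)" for v
    using Suc.prems by (intro Ck_on_cong[OF assms(1) _ Suc.IH[of "\<lambda>x. frechet_derivative f (at x) v"]])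
      (simp_all add: frechet_derivative_at[OF D, symmetric])
  then show ?case using D by (auto simp: differentiable_def)
qed

lemma Ck_on_add:
  assumes "open S" "Ck_on k S f" "Ck_on k S g"
  shows "Ck_on k S (\<lambda>x. f x + g x)"
  using assms(2,3)
proof (induction k arbitrary: f g)
  case 0
  then show ?case by (simp add: continuous_on_add)
next
  case (Suc k)
  have D: "((\<lambda>x. f x + g x) has_derivative
      (\<lambda>v. frechet_derivative f (at x) v + frechet_derivative g (at x) v)) (at x)" if "x \<in> S" for x
    using has_derivative_add[OF Ck_on_has_derivative[OF Suc.prems(1) that]
        Ck_on_has_derivative[OF Suc.prems(2) that]] .
  have d: "Ck_on k S (\<lambda>x. frechet_derivative f (at x) v + frechet_derivative g (at x) v)" for v
    using Suc.prems by (intro Suc.IH) simp_all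
  have "Ck_on k S (\<lambda>x. frechet_derivative (\<lambda>x. f x + g x) (at x) v)" for v
    by (rule Ck_on_cong[OF assms(1) _ d[of v]]) (simp add: frechet_derivative_at[OF D, symmetric])
  then show ?case using D by (auto simp: differentiable_def)
qed

lemma Ck_on_mult:
  fixes f g :: "'a::euclidean_space \<Rightarrow> real"
  assumes "open S" "Ck_on k S f" "Ck_on k S g"
  shows "Ck_on k S (\<lambda>x. f x * g x)"
  using assms(2,3)
proof (induction k arbitrary: f g)
  case 0
  then show ?case by (simp add: continuous_on_mult)
next
  case (Suc k)
  have D: "((\<lambda>x. f x * g x) has_derivative
      (\<lambda>v. f x * frechet_derivative g (at x) v + frechet_derivative f (at x) v * g x)) (at x)"
    if "x \<in> S" for x
    using has_derivative_mult[OF Ck_on_has_derivative[OF Suc.prems(1) that]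
        Ck_on_has_derivative[OF Suc.prems(2) that]] .
  have fg: "Ck_on k S f" "Ck_on k S g" using Suc.prems Ck_on_Suc_imp by blast+
  have d: "Ck_on k S (\<lambda>x. f x * frechet_derivative g (at x) v + frechet_derivative f (at x) v * g x)"
    for v using Suc.prems fg by (intro Ck_on_add assms(1) Suc.IH) auto
  have "Ck_on k S (\<lambda>x. frechet_derivative (\<lambda>x. f x * g x) (at x) v)" for v
    by (rule Ck_on_cong[OF assms(1) _ d[of v]]) (simp add: frechet_derivative_at[OF D, symmetric])
  then show ?case using D by (auto simp: differentiable_def)
qed

lemma Ck_on_inverse:
  fixes f :: "'a::euclidean_space \<Rightarrow> real"
  assumes "open S" "Ck_on k S f" "\<And>x. x \<in> S \<Longrightarrow> f x \<noteq> 0"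
  shows "Ck_on k S (\<lambda>x. inverse (f x))"
  using assms(2)
proof (induction k)
  case 0
  then show ?case using assms by (auto intro: continuous_on_inverse)
next
  case (Suc k)
  have D: "((\<lambda>x. inverse (f x)) has_derivative
      (\<lambda>v. -1 * (inverse (f x) * frechet_derivative f (at x) v * inverse (f x)))) (at x)"
    if "x \<in> S" for x
    using Deriv.has_derivative_inverse[OF assms(3)[OF that] Ck_on_has_derivative[OF Suc.prems that]]
    by simp
  have fk: "Ck_on k S f" using Suc.prems Ck_on_Suc_imp by blast
  have d: "Ck_on k S (\<lambda>x. -1 * (inverse (f x) * frechet_derivative f (at x) v * inverse (f x)))" for v
    using Suc.prems by (intro Ck_on_mult assms(1) Suc.IH fk Ck_on_const) auto
  have "Ck_on k S (\<lambda>x. frechet_derivative (\<lambda>x. inverse (f x)) (at x) v)" for v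
    by (rule Ck_on_cong[OF assms(1) _ d[of v]]) (simp add: frechet_derivative_at[OF D, symmetric])
  then show ?case using D by (auto simp: differentiable_def)
qed

lemma smooth_on_differentiable: "smooth_on S f \<Longrightarrow> x \<in> S \<Longrightarrow> f differentiable (at x)"
  unfolding smooth_on_def using Ck_on.simps(2) by blast

lemma smooth_on_continuous: "smooth_on S f \<Longrightarrow> continuous_on S f"
  unfolding smooth_on_def using Ck_on.simps(1) by blast

lemma smooth_on_derivative: "smooth_on S f \<Longrightarrow> smooth_on S (\<lambda>x. frechet_derivative f (at x) v)"
  unfolding smooth_on_def using Ck_on.simps(2) by blast

lemma smooth_on_pd: "smooth_on S f \<Longrightarrow> smooth_on S (pd i f)"
  unfolding pd_def[abs_def] by (rule smooth_on_derivative)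

lemma smooth_on_subset: "smooth_on S f \<Longrightarrow> T \<subseteq> S \<Longrightarrow> smooth_on T f"
  unfolding smooth_on_def using Ck_on_subset by blast

lemma smooth_on_cong:
  "open S \<Longrightarrow> smooth_on S f \<Longrightarrow> (\<And>x. x \<in> S \<Longrightarrow> f x = g x) \<Longrightarrow> smooth_on S g"
  unfolding smooth_on_def using Ck_on_cong by blast

lemma smooth_on_const: "smooth_on S (\<lambda>_. c)"
  unfolding smooth_on_def by (simp add: Ck_on_const)

lemma smooth_on_compose_bounded_linear:
  "open S \<Longrightarrow> bounded_linear h \<Longrightarrow> smooth_on S f \<Longrightarrow> smooth_on S (\<lambda>x. h (f x))"
  unfolding smooth_on_def using Ck_on_compose_bounded_linear by blast

lemma smooth_on_component: "smooth_on S (\<lambda>x :: real ^ 'n::finite. x $ i)"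
  unfolding smooth_on_def by (auto intro!: Ck_on_bounded_linear bounded_linear_vec_nth)

lemma smooth_on_add:
  "open S \<Longrightarrow> smooth_on S f \<Longrightarrow> smooth_on S g \<Longrightarrow> smooth_on S (\<lambda>x. f x + g x)"
  unfolding smooth_on_def using Ck_on_add by blast

lemma smooth_on_mult:
  fixes f g :: "'a::euclidean_space \<Rightarrow> real"
  shows "open S \<Longrightarrow> smooth_on S f \<Longrightarrow> smooth_on S g \<Longrightarrow> smooth_on S (\<lambda>x. f x * g x)"
  unfolding smooth_on_def using Ck_on_mult by blast

lemma smooth_on_power:
  fixes f :: "'a::euclidean_space \<Rightarrow> real"
  assumes "open S" "smooth_on S f"
  shows "smooth_on S (\<lambda>x. f x ^ k)"
  by (induction k) (auto intro: smooth_on_const smooth_on_mult[OF assms])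

lemma smooth_on_diff:
  fixes f g :: "'a::euclidean_space \<Rightarrow> real"
  assumes "open S" "smooth_on S f" "smooth_on S g"
  shows "smooth_on S (\<lambda>x. f x - g x)"
  using smooth_on_add[OF assms(1,2) smooth_on_mult[OF assms(1) smooth_on_const[of _ "-1"] assms(3)]]
  by simp

lemma smooth_on_inverse:
  fixes f :: "'a::euclidean_space \<Rightarrow> real"
  shows "open S \<Longrightarrow> smooth_on S f \<Longrightarrow> (\<And>x. x \<in> S \<Longrightarrow> f x \<noteq> 0) \<Longrightarrow> smooth_on S (\<lambda>x. inverse (f x))"
  unfolding smooth_on_def using Ck_on_inverse by blast

lemma smooth_on_sum:
  assumes "open S" "\<And>i. i \<in> I \<Longrightarrow> smooth_on S (f i)"
  shows "smooth_on S (\<lambda>x. \<Sum>i\<in>I. f i x)"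
proof (cases "finite I")
  case True
  then show ?thesis using assms(2)
    by (induction I) (auto intro!: smooth_on_const smooth_on_add[OF assms(1)])
qed (simp add: smooth_on_const)

subsection \<open>Partial derivatives\<close>

lemma pd_cong_open:
  "open S \<Longrightarrow> x \<in> S \<Longrightarrow> (\<And>u. u \<in> S \<Longrightarrow> f u = g u) \<Longrightarrow> pd i f x = pd i g x"
  unfolding pd_def using frechet_derivative_cong_open by metis

lemma pd_eq: "(f has_derivative f') (at x) \<Longrightarrow> pd i f x = f' (axis i 1)"
  unfolding pd_def using frechet_derivative_at by metis

lemma pd_const: "pd i (\<lambda>_. c) x = 0"
  by (rule pd_eq[THEN trans]) (auto intro: has_derivative_const)

lemma pd_component: "pd i (\<lambda>x. x $ j) x = (if j = i then 1 else 0)"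
  by (subst pd_eq[OF bounded_linear_imp_has_derivative[OF bounded_linear_vec_nth]])
    (simp add: axis_def)

lemma pd_add:
  "f differentiable (at x) \<Longrightarrow> g differentiable (at x) \<Longrightarrow>
    pd i (\<lambda>u. f u + g u) x = pd i f x + pd i g x"
  unfolding frechet_derivative_works by (subst pd_eq[OF has_derivative_add]) (auto simp: pd_def)

lemma pd_diff:
  "f differentiable (at x) \<Longrightarrow> g differentiable (at x) \<Longrightarrow>
    pd i (\<lambda>u. f u - g u) x = pd i f x - pd i g x"
  unfolding frechet_derivative_works by (subst pd_eq[OF has_derivative_diff]) (auto simp: pd_def)

lemma pd_mult:
  "f differentiable (at x) \<Longrightarrow> g differentiable (at x) \<Longrightarrow>
    pd i (\<lambda>u. f u * g u) x = f x * pd i g x + pd i f x * g x"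
  unfolding frechet_derivative_works by (subst pd_eq[OF has_derivative_mult]) (auto simp: pd_def)

lemma pd_cmult:
  "f differentiable (at x) \<Longrightarrow> pd i (\<lambda>u. c * f u) x = c * pd i f x"
  by (simp add: pd_mult pd_const)

lemma pd_sum:
  "(\<And>j. j \<in> I \<Longrightarrow> f j differentiable (at x)) \<Longrightarrow>
    pd i (\<lambda>u. \<Sum>j\<in>I. f j u) x = (\<Sum>j\<in>I. pd i (f j) x)"
  unfolding frechet_derivative_works by (subst pd_eq[OF has_derivative_sum]) (auto simp: pd_def)

lemma frechet_derivative_eq_sum_pd:
  fixes f :: "real ^ 'n::finite \<Rightarrow> real"
  assumes "f differentiable (at x)"
  shows "frechet_derivative f (at x) v = (\<Sum>i\<in>UNIV. v $ i * pd i f x)"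
proof -
  have lin: "linear (frechet_derivative f (at x))"
    using assms linear_frechet_derivative by blast
  have "v = (\<Sum>i\<in>UNIV. v $ i *\<^sub>R axis i 1)"
    by (simp add: vec_eq_iff axis_def if_distrib[of "(*) _"] cong: if_cong)
  then have "frechet_derivative f (at x) v = (\<Sum>i\<in>UNIV. frechet_derivative f (at x) (v $ i *\<^sub>R axis i 1))"
    using linear_sum[OF lin] by metis
  then show ?thesis by (simp add: pd_def linear_cmul[OF lin])
qed

lemma DERIV_along_line:
  fixes f :: "'a::real_normed_vector \<Rightarrow> real"
  assumes "f differentiable (at (z + t *\<^sub>R h))"
  shows "((\<lambda>t. f (z + t *\<^sub>R h)) has_real_derivative frechet_derivative f (at (z + t *\<^sub>R h)) h) (at t)"
proof -
  have F: "(f has_derivative frechet_derivative f (at (z + t *\<^sub>R h))) (at (z + t *\<^sub>R h))"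
    using assms frechet_derivative_works by blast
  have "((\<lambda>t. f (z + t *\<^sub>R h)) has_derivative (\<lambda>s. frechet_derivative f (at (z + t *\<^sub>R h)) (s *\<^sub>R h))) (at t)"
    by (rule has_derivative_compose[where f = "\<lambda>t. z + t *\<^sub>R h" and f' = "\<lambda>s. s *\<^sub>R h", OF _ F])
      (auto intro!: derivative_eq_intros)
  then show ?thesis
    using linear_cmul[OF linear_frechet_derivative[OF assms]]
    by (simp add: has_field_derivative_def mult_commute_abs)
qed

subsection \<open>Homogeneous functions\<close>

text \<open>The exponent is written \<open>Suc m\<close> so that the degree \<open>m\<close> of the derivative is a natural number.\<close>
lemma pd_homogeneous:
  fixes f :: "real ^ 'n::finite \<Rightarrow> real"
  assumes "open S" "\<And>y t. y \<in> S \<Longrightarrow> t > 0 \<Longrightarrow> t *\<^sub>R y \<in> S"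
    and "\<And>y. y \<in> S \<Longrightarrow> f differentiable (at y)"
    and hom: "\<And>y t. y \<in> S \<Longrightarrow> t > 0 \<Longrightarrow> f (t *\<^sub>R y) = t ^ Suc m * f y"
    and y: "y \<in> S" and t: "t > 0"
  shows "pd i f (t *\<^sub>R y) = t ^ m * pd i f y"
proof -
  have "((\<lambda>u. f (t *\<^sub>R u)) has_derivative (\<lambda>v. frechet_derivative f (at (t *\<^sub>R y)) (t *\<^sub>R v))) (at y)"
    by (rule has_derivative_compose[of "\<lambda>u. t *\<^sub>R u" "\<lambda>v. t *\<^sub>R v"])
      (use assms in \<open>auto intro!: derivative_eq_intros simp: frechet_derivative_works[symmetric]\<close>)
  then have "pd i (\<lambda>u. f (t *\<^sub>R u)) y = frechet_derivative f (at (t *\<^sub>R y)) (t *\<^sub>R axis i 1)"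
    by (rule pd_eq)
  also have "\<dots> = t * pd i f (t *\<^sub>R y)"
    using linear_cmul[OF linear_frechet_derivative, of f] assms by (simp add: pd_def)
  finally have 1: "pd i (\<lambda>u. f (t *\<^sub>R u)) y = t * pd i f (t *\<^sub>R y)" .
  have "pd i (\<lambda>u. f (t *\<^sub>R u)) y = pd i (\<lambda>u. t ^ Suc m * f u) y"
    by (rule pd_cong_open[OF assms(1) y]) (use hom t in auto)
  also have "\<dots> = t ^ Suc m * pd i f y" using assms by (intro pd_cmult) auto
  finally show ?thesis using 1 t by simp
qed

lemma Euler_homogeneous:
  fixes f :: "real ^ 'n::finite \<Rightarrow> real"
  assumes "f differentiable (at y)"
    and hom: "\<And>t. t > 0 \<Longrightarrow> f (t *\<^sub>R y) = t ^ m * f y"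
  shows "(\<Sum>i\<in>UNIV. y $ i * pd i f y) = real m * f y"
proof -
  have "((\<lambda>t. f (t *\<^sub>R y)) has_derivative (\<lambda>s. frechet_derivative f (at (1 *\<^sub>R y)) (s *\<^sub>R y))) (at (1::real))"
    by (rule has_derivative_compose[of "\<lambda>t. t *\<^sub>R y" "\<lambda>s. s *\<^sub>R y"])
      (use assms in \<open>auto intro!: derivative_eq_intros simp: frechet_derivative_works[symmetric]\<close>)
  then have "((\<lambda>t. t ^ m * f y) has_derivative (\<lambda>s. frechet_derivative f (at y) (s *\<^sub>R y))) (at (1::real))"
    unfolding scaleR_one
    by (rule has_derivative_transform_within_open[of _ _ _ _ "{0<..}"]) (auto simp: hom)
  moreover have "((\<lambda>t. t ^ m * f y) has_derivative (\<lambda>s. s * (real m * f y))) (at (1::real))"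
    by (auto intro!: derivative_eq_intros)
  ultimately have "(\<lambda>s. frechet_derivative f (at y) (s *\<^sub>R y)) = (\<lambda>s. s * (real m * f y))"
    by (rule has_derivative_unique)
  from fun_cong[OF this, of 1] show ?thesis
    by (simp add: frechet_derivative_eq_sum_pd[OF assms(1)])
qed

section \<open>Flat analytic functions\<close>

text \<open>This is the consequence of real analyticity at \<open>y\<close> on which the uniqueness argument rests: the
  restrictions to all segments issuing from \<open>y\<close> are one-variable power series, on a length that is
  uniform in the direction, so that these segments fill a ball.\<close>
definition analytic_along_lines :: "('a::real_normed_vector \<Rightarrow> real) \<Rightarrow> 'a \<Rightarrow> bool" where
  "analytic_along_lines f y \<longleftrightarrow>
     (\<exists>r>0. \<forall>h. norm h < r \<longrightarrow> (\<exists>c. \<forall>t. \<bar>t\<bar> \<le> 1 \<longrightarrow> (\<lambda>m. c m * t ^ m) sums f (y + t *\<^sub>R h)))"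

lemma finite_multiindices_of_degree:
  "finite {m \<in> (Basis :: 'a::euclidean_space set) \<rightarrow>\<^sub>E (UNIV :: nat set). sum m Basis = j}"
proof (rule finite_subset)
  show "{m \<in> (Basis :: 'a set) \<rightarrow>\<^sub>E UNIV. sum m Basis = j} \<subseteq> Basis \<rightarrow>\<^sub>E {..j}"
    by (auto simp: PiE_iff extensional_def intro: member_le_sum[of _ Basis])
qed (simp add: finite_PiE)

lemma real_analytic_at_bounded_linear:
  assumes "bounded_linear h" "real_analytic_at f x"
  shows "real_analytic_at (\<lambda>u. h (f u)) x"
proof -
  interpret bounded_linear h by fact
  obtain r a where r: "r > 0" and
    a: "\<And>u. \<forall>e\<in>Basis. \<bar>u \<bullet> e\<bar> < r \<Longrightarrow>
      ((\<lambda>m. (\<Prod>e\<in>Basis. (u \<bullet> e) ^ m e) *\<^sub>R a m) has_sum f (x + u)) (Basis \<rightarrow>\<^sub>E UNIV)"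
    using assms(2) unfolding real_analytic_at_def by blast
  have "((\<lambda>m. (\<Prod>e\<in>Basis. (u \<bullet> e) ^ m e) *\<^sub>R h (a m)) has_sum h (f (x + u))) (Basis \<rightarrow>\<^sub>E UNIV)"
    if "\<forall>e\<in>Basis. \<bar>u \<bullet> e\<bar> < r" for u
    using has_sum_bounded_linear[OF assms(1) a[OF that]] by (simp add: scaleR)
  then show ?thesis unfolding real_analytic_at_def using r
    by (intro exI[of _ r] conjI exI[of _ "\<lambda>m. h (a m)"]) auto
qed

text \<open>Collecting the monomials of equal total degree turns the multiple power series along
  \<open>x + t h\<close> into a power series in \<open>t\<close>; unconditional summability justifies the regrouping.\<close>
lemma real_analytic_at_line:
  fixes f :: "'a::euclidean_space \<Rightarrow> real"
  assumes "real_analytic_at f x"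
  obtains r where "r > 0"
    "\<And>h. norm h < r \<Longrightarrow> \<exists>c. \<forall>t. \<bar>t\<bar> \<le> 1 \<longrightarrow> (\<lambda>m. c m * t ^ m) sums f (x + t *\<^sub>R h)"
proof -
  obtain r a where r: "r > 0" and
    a: "\<And>u. \<forall>e\<in>Basis. \<bar>u \<bullet> e\<bar> < r \<Longrightarrow>
      ((\<lambda>m. (\<Prod>e\<in>Basis. (u \<bullet> e) ^ m e) *\<^sub>R a m) has_sum f (x + u)) (Basis \<rightarrow>\<^sub>E UNIV)"
    using assms unfolding real_analytic_at_def by metis
  let ?I = "Basis \<rightarrow>\<^sub>E UNIV :: ('a \<Rightarrow> nat) set"
  let ?I' = "\<lambda>j. {m \<in> ?I. sum m Basis = j}"
  have "\<exists>c. \<forall>t. \<bar>t\<bar> \<le> 1 \<longrightarrow> (\<lambda>m. c m * t ^ m) sums f (x + t *\<^sub>R h)" if h: "norm h < r" for h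
  proof -
    define c where "c j = (\<Sum>m\<in>?I' j. (\<Prod>e\<in>Basis. (h \<bullet> e) ^ m e) * a m)" for j
    have "(\<lambda>m. c m * t ^ m) sums f (x + t *\<^sub>R h)" if t: "\<bar>t\<bar> \<le> 1" for t
    proof -
    have "\<bar>(t *\<^sub>R h) \<bullet> e\<bar> < r" if "e \<in> Basis" for e
    proof -
      have "\<bar>(t *\<^sub>R h) \<bullet> e\<bar> \<le> 1 * norm h"
        unfolding inner_scaleR_left abs_mult by (intro mult_mono t Basis_le_norm that) auto
      then show ?thesis using h by simp
    qed
    then have "((\<lambda>m. (\<Prod>e\<in>Basis. ((t *\<^sub>R h) \<bullet> e) ^ m e) *\<^sub>R a m) has_sum f (x + t *\<^sub>R h)) ?I"
      by (intro a) auto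
    moreover have "(\<Prod>e\<in>Basis. ((t *\<^sub>R h) \<bullet> e) ^ m e) = t ^ sum m Basis * (\<Prod>e\<in>Basis. (h \<bullet> e) ^ m e)"
      for m by (simp add: power_mult_distrib prod.distrib power_sum)
    ultimately have s: "((\<lambda>m. t ^ sum m Basis * ((\<Prod>e\<in>Basis. (h \<bullet> e) ^ m e) * a m))
        has_sum f (x + t *\<^sub>R h)) ?I"
      by (simp add: mult.assoc)
    have "((\<lambda>(j, m). t ^ j * ((\<Prod>e\<in>Basis. (h \<bullet> e) ^ m e) * a m)) has_sum f (x + t *\<^sub>R h))
        (Sigma UNIV ?I')"
      by (rule has_sum_reindex_bij_witness[where j = snd and i = "\<lambda>m. (sum m Basis, m)",
            THEN iffD2, OF _ _ _ _ _ refl s]) auto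
    then have "((\<lambda>j. c j * t ^ j) has_sum f (x + t *\<^sub>R h)) UNIV"
    proof (rule has_sum_SigmaD)
      fix j
      show "((\<lambda>m. case (j, m) of (j, m) \<Rightarrow> t ^ j * ((\<Prod>e\<in>Basis. (h \<bullet> e) ^ m e) * a m))
          has_sum c j * t ^ j) (?I' j)"
        using has_sum_finite[OF finite_multiindices_of_degree, of
            "\<lambda>m. t ^ j * ((\<Prod>e\<in>Basis. (h \<bullet> e) ^ m e) * a m)" j]
        by (simp add: c_def sum_distrib_left mult.commute)
    qed
      then show ?thesis by (rule has_sum_imp_sums)
    qed
    then show ?thesis by blast
  qed
  with r that show ?thesis by blast
qed

lemma analytic_along_lines_minus:
  assumes "analytic_along_lines f y" "analytic_along_lines g y"
  shows "analytic_along_lines (\<lambda>u. f u - g u) y"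
proof -
  obtain r where r: "r > 0" and f:
    "\<And>h. norm h < r \<Longrightarrow> \<exists>c. \<forall>t. \<bar>t\<bar> \<le> 1 \<longrightarrow> (\<lambda>m. c m * t ^ m) sums f (y + t *\<^sub>R h)"
    using assms(1) unfolding analytic_along_lines_def by blast
  obtain r' where r': "r' > 0" and g:
    "\<And>h. norm h < r' \<Longrightarrow> \<exists>c. \<forall>t. \<bar>t\<bar> \<le> 1 \<longrightarrow> (\<lambda>m. c m * t ^ m) sums g (y + t *\<^sub>R h)"
    using assms(2) unfolding analytic_along_lines_def by blast
  have "\<exists>c. \<forall>t. \<bar>t\<bar> \<le> 1 \<longrightarrow> (\<lambda>m. c m * t ^ m) sums (f (y + t *\<^sub>R h) - g (y + t *\<^sub>R h))"
    if "norm h < min r r'" for h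
  proof -
    have "norm h < r" "norm h < r'" using that by auto
    then obtain c c' where
      c: "\<forall>t. \<bar>t\<bar> \<le> 1 \<longrightarrow> (\<lambda>m. c m * t ^ m) sums f (y + t *\<^sub>R h)" and
      c': "\<forall>t. \<bar>t\<bar> \<le> 1 \<longrightarrow> (\<lambda>m. c' m * t ^ m) sums g (y + t *\<^sub>R h)"
      using f g by blast
    have "\<forall>t. \<bar>t\<bar> \<le> 1 \<longrightarrow>
        (\<lambda>m. (c m - c' m) * t ^ m) sums (f (y + t *\<^sub>R h) - g (y + t *\<^sub>R h))"
      using c c' by (auto simp: left_diff_distrib intro!: sums_diff)
    then show ?thesis by (rule exI[of _ "\<lambda>m. c m - c' m"])
  qed
  then show ?thesis unfolding analytic_along_lines_def using r r'
    by (intro exI[of _ "min r r'"]) auto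
qed

text \<open>The lowest nonzero coefficient \<open>c\<^sub>k\<close> would be the limit of \<open>\<phi> t / t\<^sup>k\<close>, which flatness of order
  \<open>k + 1\<close> makes zero. A bound for positive \<open>t\<close> suffices, so the lemma applies at boundary points.\<close>
lemma powser_flat_imp_zero:
  fixes c :: "nat \<Rightarrow> real"
  assumes sums: "\<And>t. \<bar>t\<bar> \<le> 1 \<Longrightarrow> (\<lambda>m. c m * t ^ m) sums \<phi> t"
    and flat: "\<And>k. \<exists>C. \<exists>\<delta>>0. \<forall>t. 0 < t \<and> t < \<delta> \<longrightarrow> \<bar>\<phi> t\<bar> \<le> C * t ^ k"
    and t: "\<bar>t\<bar> \<le> 1"
  shows "\<phi> t = 0"
proof -
  have "c k = 0" for k
  proof (induction k rule: less_induct)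
    case (less k)
    have s: "(\<lambda>m. c (m + k) * t ^ m) sums (\<phi> t / t ^ k)" if "t \<noteq> 0" "norm t < 1" for t
    proof -
      have "(\<lambda>m. c (m + k) * t ^ (m + k)) sums (\<phi> t - (\<Sum>i<k. c i * t ^ i))"
        using sums_split_initial_segment[OF sums[of t], of k] that by simp
      then have "(\<lambda>m. c (m + k) * t ^ (m + k)) sums \<phi> t" using less by simp
      then have "(\<lambda>m. c (m + k) * t ^ (m + k) / t ^ k) sums (\<phi> t / t ^ k)" by (rule sums_divide)
      then show ?thesis using that by (simp add: power_add)
    qed
    have "((\<lambda>t. \<phi> t / t ^ k) \<longlongrightarrow> c (0 + k)) (at 0)"
      by (rule powser_limit_0_strong[of 1]) (auto intro: s)
    then have lim: "((\<lambda>t. \<phi> t / t ^ k) \<longlongrightarrow> c k) (at_right 0)"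
      by (simp add: filterlim_at_split)
    obtain C \<delta> where \<delta>: "\<delta> > 0" and C: "\<And>t. 0 < t \<Longrightarrow> t < \<delta> \<Longrightarrow> \<bar>\<phi> t\<bar> \<le> C * t ^ Suc k"
      using flat[of "Suc k"] by blast
    have "((\<lambda>t. \<phi> t / t ^ k) \<longlongrightarrow> 0) (at_right 0)"
    proof (rule Lim_null_comparison)
      have "\<forall>\<^sub>F t in at_right 0. 0 < t \<and> t < \<delta>"
        using \<delta> by (auto simp: eventually_at_right_field)
      then show "\<forall>\<^sub>F t in at_right 0. norm (\<phi> t / t ^ k) \<le> C * t"
      proof eventually_elim
        case (elim t)
        then have "\<bar>\<phi> t\<bar> \<le> (C * t) * t ^ k" using C[of t] by (simp add: mult.assoc)
        moreover have "norm (\<phi> t / t ^ k) = \<bar>\<phi> t\<bar> / t ^ k" "t ^ k > 0"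
          using elim by (simp_all add: abs_divide)
        ultimately show ?case by (simp only: pos_divide_le_eq)
      qed
      show "((\<lambda>t. C * t) \<longlongrightarrow> 0) (at_right 0)" by (auto intro!: tendsto_eq_intros)
    qed
    with lim show "c k = 0" using tendsto_unique trivial_limit_at_right_real by blast
  qed
  then have "(\<lambda>m. 0) sums \<phi> t" using sums[OF t] by simp
  then show ?thesis using sums_unique2 sums_zero by blast
qed

text \<open>Taylor's estimate with vanishing Taylor polynomial, by induction on \<open>k\<close>: the derivative along \<open>h\<close>
  is flat of one order less, and the mean value theorem gains a factor \<open>t\<close>.\<close>
lemma flat_along_line:
  fixes f :: "'a::euclidean_space \<Rightarrow> real"
  assumes "open S" "smooth_on S f" "z \<in> S"
    and "\<And>j. j < k \<Longrightarrow> ((\<lambda>g x. frechet_derivative g (at x) h) ^^ j) f z = 0"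
  shows "\<exists>C. \<exists>\<delta>>0. \<forall>t. 0 < t \<and> t < \<delta> \<longrightarrow> \<bar>f (z + t *\<^sub>R h)\<bar> \<le> C * t ^ k"
  using assms(2,4)
proof (induction k arbitrary: f)
  case 0
  have c: "continuous (at z) f"
    using smooth_on_continuous[OF "0.prems"(1)] assms continuous_on_eq_continuous_at by blast
  have "((\<lambda>t. z + t *\<^sub>R h) \<longlongrightarrow> z + 0 *\<^sub>R h) (at_right 0)" by (intro tendsto_intros)
  then have "((\<lambda>t. z + t *\<^sub>R h) \<longlongrightarrow> z) (at_right 0)" by simp
  from isCont_tendsto_compose[OF c this]
  have "((\<lambda>t. f (z + t *\<^sub>R h)) \<longlongrightarrow> f z) (at_right 0)" .
  then have "\<forall>\<^sub>F t in at_right 0. dist (f (z + t *\<^sub>R h)) (f z) < 1" by (rule tendstoD) simp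
  then obtain \<delta> where "\<delta> > 0" and d: "\<And>t. 0 < t \<Longrightarrow> t < \<delta> \<Longrightarrow> dist (f (z + t *\<^sub>R h)) (f z) < 1"
    by (auto simp: eventually_at_right_field)
  moreover have "\<bar>f (z + t *\<^sub>R h)\<bar> \<le> (\<bar>f z\<bar> + 1) * t ^ 0" if "0 < t" "t < \<delta>" for t
    using d[OF that] by (simp add: dist_real_def)
  ultimately show ?case by blast
next
  case (Suc k)
  define g where "g x = frechet_derivative f (at x) h" for x
  have "((\<lambda>g x. frechet_derivative g (at x) h) ^^ j) g z = 0" if "j < k" for j
    using Suc.prems(2)[of "Suc j"] that by (simp add: g_def[abs_def] funpow_Suc_right del: funpow.simps)
  moreover have "smooth_on S g"
    unfolding g_def[abs_def] using Suc.prems(1) by (rule smooth_on_derivative)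
  ultimately obtain C \<delta> where \<delta>: "\<delta> > 0" and C: "\<And>t. 0 < t \<Longrightarrow> t < \<delta> \<Longrightarrow> \<bar>g (z + t *\<^sub>R h)\<bar> \<le> C * t ^ k"
    using Suc.IH[of g] by blast
  obtain \<epsilon> where \<epsilon>: "\<epsilon> > 0" "\<And>t. \<bar>t\<bar> < \<epsilon> \<Longrightarrow> z + t *\<^sub>R h \<in> S"
  proof -
    obtain e where e: "e > 0" "ball z e \<subseteq> S" using assms(1,3) open_contains_ball by blast
    have "z + t *\<^sub>R h \<in> S" if "\<bar>t\<bar> < e / (norm h + 1)" for t
    proof -
      have "\<bar>t\<bar> * norm h \<le> \<bar>t\<bar> * (norm h + 1)" by (simp add: mult_left_mono)
      also have "\<dots> < e" using that by (simp add: pos_less_divide_eq add_nonneg_pos)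
      finally show ?thesis using e(2) by (auto simp: dist_norm)
    qed
    moreover have "e / (norm h + 1) > 0" using e by (simp add: add_nonneg_pos)
    ultimately show ?thesis using that by blast
  qed
  have d: "((\<lambda>t. f (z + t *\<^sub>R h)) has_real_derivative g (z + t *\<^sub>R h)) (at t)" if "\<bar>t\<bar> < \<epsilon>" for t
    unfolding g_def by (rule DERIV_along_line) (rule smooth_on_differentiable[OF Suc.prems(1) \<epsilon>(2)[OF that]])
  have "\<bar>f (z + t *\<^sub>R h)\<bar> \<le> C * t ^ Suc k" if t: "0 < t" "t < min \<delta> \<epsilon>" for t
  proof -
    have "\<exists>s. 0 < s \<and> s < t \<and> f (z + t *\<^sub>R h) - f (z + 0 *\<^sub>R h) = (t - 0) * g (z + s *\<^sub>R h)"
      using t by (intro MVT2) (auto intro: d)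
    then obtain s where s: "0 < s" "s < t" "f (z + t *\<^sub>R h) - f z = t * g (z + s *\<^sub>R h)" by auto
    have "f z = 0" using Suc.prems(2)[of 0] by simp
    then have "\<bar>f (z + t *\<^sub>R h)\<bar> = t * \<bar>g (z + s *\<^sub>R h)\<bar>" using s t by (simp add: abs_mult)
    also have "\<dots> \<le> t * (C * s ^ k)" using s t by (intro mult_left_mono C) auto
    also have "\<dots> \<le> t * (C * t ^ k)"
    proof -
      have "0 \<le> C * s ^ k" using C[of s] s t by auto
      moreover have "s ^ k > 0" using s by simp
      ultimately have "C \<ge> 0" by (simp add: zero_le_mult_iff)
      then show ?thesis using s t by (intro mult_left_mono power_mono) auto
    qed
    finally show ?thesis by (simp add: mult_ac)
  qed
  then show ?case using \<delta> \<epsilon>(1) by (metis min_less_iff_conj)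
qed

text \<open>The interior \<open>Z\<close> of the zero set is closed in \<open>S\<close>: at a limit point of \<open>Z\<close> all derivatives of \<open>f\<close>
  vanish by continuity, so \<open>f\<close> is flat along each segment issuing from it, and the power series
  along these segments are zero.\<close>
lemma smooth_identity_theorem:
  fixes f :: "'a::euclidean_space \<Rightarrow> real"
  assumes "open S" "connected S" "smooth_on S f"
    and an: "\<And>z. z \<in> S \<Longrightarrow> analytic_along_lines f z"
    and U0: "open U" "U \<noteq> {}" "U \<subseteq> S" "\<And>u. u \<in> U \<Longrightarrow> f u = 0"
    and y: "y \<in> S"
  shows "f y = 0"
proof -
  define Z where "Z = interior {u \<in> S. f u = 0}"
  have Z: "open Z" "Z \<subseteq> S" "\<And>u. u \<in> Z \<Longrightarrow> f u = 0"
    using interior_subset unfolding Z_def by auto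
  have "z \<in> Z" if z: "z \<in> S" "z \<in> closure Z" for z
  proof -
    have "\<exists>C. \<exists>\<delta>>0. \<forall>t. 0 < t \<and> t < \<delta> \<longrightarrow> \<bar>f (z + t *\<^sub>R h)\<bar> \<le> C * t ^ k" for h k
    proof (rule flat_along_line[OF assms(1,3) z(1)])
      fix j
      let ?g = "((\<lambda>g x. frechet_derivative g (at x) h) ^^ j) f"
      have "smooth_on S ?g \<and> (\<forall>u\<in>Z. ?g u = 0)"
      proof (induction j)
        case 0
        then show ?case using assms Z by simp
      next
        case (Suc j)
        have "frechet_derivative (((\<lambda>g x. frechet_derivative g (at x) h) ^^ j) f) (at u) h = 0"
          if "u \<in> Z" for u
          using frechet_derivative_cong_open[OF Z(1) that,
              of "((\<lambda>g x. frechet_derivative g (at x) h) ^^ j) f" "\<lambda>_. 0"] Suc by simp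
        then show ?case using Suc by (simp add: smooth_on_derivative)
      qed
      then have g: "continuous_on S ?g" "\<forall>u\<in>Z. ?g u = 0" by (auto intro: smooth_on_continuous)
      have "closedin (top_of_set S) {x \<in> S. ?g x = 0}"
        by (rule continuous_closedin_preimage_constant[OF g(1)])
      then obtain C where C: "closed C" "{x \<in> S. ?g x = 0} = S \<inter> C"
        unfolding closedin_closed by blast
      have "Z \<subseteq> C" using g(2) C(2) Z(2) by blast
      then have "z \<in> C" using closure_minimal C(1) z by blast
      then show "?g z = 0" using C(2) z by blast
    qed
    note flat = this
    obtain r where r: "r > 0" and
      c: "\<And>h. norm h < r \<Longrightarrow> \<exists>c. \<forall>t. \<bar>t\<bar> \<le> 1 \<longrightarrow> (\<lambda>m. c m * t ^ m) sums f (z + t *\<^sub>R h)"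
      using an[OF z(1)] unfolding analytic_along_lines_def by blast
    have "f (z + h) = 0" if hr: "norm h < r" for h
    proof -
      obtain c where "\<And>t. \<bar>t\<bar> \<le> 1 \<Longrightarrow> (\<lambda>m. c m * t ^ m) sums f (z + t *\<^sub>R h)"
        using c[OF hr] by blast
      from powser_flat_imp_zero[OF this flat, of 1] show ?thesis by simp
    qed
    from this[of "u - z" for u] have "f u = 0" if "u \<in> ball z r" for u
      using that by (simp add: dist_norm norm_minus_commute)
    then have "ball z r \<inter> S \<subseteq> {u \<in> S. f u = 0}" by auto
    then have "ball z r \<inter> S \<subseteq> Z" unfolding Z_def by (rule interior_maximal) (use assms(1) in auto)
    then show ?thesis using z(1) r by auto
  qed
  then have "Z = S \<inter> closure Z" using Z(2) closure_subset[of Z] by blast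
  then have "closedin (top_of_set S) Z" unfolding closedin_closed using closed_closure by blast
  moreover have "openin (top_of_set S) Z" using Z by (simp add: openin_open_eq assms(1))
  moreover have "Z \<noteq> {}"
  proof -
    have "U \<subseteq> Z" unfolding Z_def by (rule interior_maximal) (use U0 in auto)
    then show ?thesis using U0 by auto
  qed
  ultimately have "Z = S" using assms(2)[unfolded connected_clopen, rule_format, of Z] by blast
  then show ?thesis using Z(3) y by blast
qed

section \<open>Functions that extend smoothly across a boundary point\<close>

text \<open>For open \<open>S\<close> these functions form a ring that is closed under partial derivatives. Membership in it is the
  meaning of \<open>smooth up to the boundary point z\<close>; since only values on \<open>S\<close> matter, one may
  divide by a function that is nonzero on \<open>S\<close> but vanishes at \<open>z\<close>, and ask whether the quotient
  is still in the ring.\<close>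
definition smooth_up_to ::
  "'a::euclidean_space set \<Rightarrow> 'a \<Rightarrow> ('a \<Rightarrow> real) \<Rightarrow> bool" where
  "smooth_up_to S z f \<longleftrightarrow> (\<exists>F. extends_near smooth_on S f z F)"

lemma smooth_up_toI:
  "open W \<Longrightarrow> z \<in> W \<Longrightarrow> smooth_on W F \<Longrightarrow> (\<And>u. u \<in> W \<Longrightarrow> u \<in> S \<Longrightarrow> F u = f u) \<Longrightarrow>
    smooth_up_to S z f"
  unfolding smooth_up_to_def extends_near_def by (intro exI[of _ F] exI[of _ W]) auto

lemma smooth_up_to_cong:
  assumes "smooth_up_to S z f" "\<And>u. u \<in> S \<Longrightarrow> f u = g u"
  shows "smooth_up_to S z g"
proof -
  obtain W F where W: "open W" "z \<in> W" "smooth_on W F" "\<And>u. u \<in> W \<Longrightarrow> u \<in> S \<Longrightarrow> F u = f u"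
    using assms(1) unfolding smooth_up_to_def extends_near_def by auto
  show ?thesis using W assms(2) by (intro smooth_up_toI[OF W(1-3)]) auto
qed

lemma smooth_up_to_smooth: "smooth_on UNIV f \<Longrightarrow> smooth_up_to S z f"
  by (rule smooth_up_toI[of UNIV _ f]) auto

lemma smooth_up_to_const: "smooth_up_to S z (\<lambda>_. c)"
  by (rule smooth_up_to_smooth[OF smooth_on_const])

lemma smooth_up_to_component: "smooth_up_to S z (\<lambda>u. u $ i)"
  by (rule smooth_up_to_smooth[OF smooth_on_component])

lemma smooth_up_to_add:
  assumes "smooth_up_to S z f" "smooth_up_to S z g"
  shows "smooth_up_to S z (\<lambda>u. f u + g u)"
proof -
  obtain W F where W: "open W" "z \<in> W" "smooth_on W F" "\<And>u. u \<in> W \<Longrightarrow> u \<in> S \<Longrightarrow> F u = f u"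
    using assms(1) unfolding smooth_up_to_def extends_near_def by auto
  obtain V G where V: "open V" "z \<in> V" "smooth_on V G" "\<And>u. u \<in> V \<Longrightarrow> u \<in> S \<Longrightarrow> G u = g u"
    using assms(2) unfolding smooth_up_to_def extends_near_def by auto
  show ?thesis
  proof (rule smooth_up_toI[of "W \<inter> V"])
    show "smooth_on (W \<inter> V) (\<lambda>u. F u + G u)"
      using W V by (intro smooth_on_add) (auto intro: smooth_on_subset)
  qed (use W V in auto)
qed

lemma smooth_up_to_mult:
  assumes "smooth_up_to S z f" "smooth_up_to S z g"
  shows "smooth_up_to S z (\<lambda>u. f u * g u)"
proof -
  obtain W F where W: "open W" "z \<in> W" "smooth_on W F" "\<And>u. u \<in> W \<Longrightarrow> u \<in> S \<Longrightarrow> F u = f u"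
    using assms(1) unfolding smooth_up_to_def extends_near_def by auto
  obtain V G where V: "open V" "z \<in> V" "smooth_on V G" "\<And>u. u \<in> V \<Longrightarrow> u \<in> S \<Longrightarrow> G u = g u"
    using assms(2) unfolding smooth_up_to_def extends_near_def by auto
  show ?thesis
  proof (rule smooth_up_toI[of "W \<inter> V"])
    show "smooth_on (W \<inter> V) (\<lambda>u. F u * G u)"
      using W V by (intro smooth_on_mult) (auto intro: smooth_on_subset)
  qed (use W V in auto)
qed

lemma smooth_up_to_cmult: "smooth_up_to S z f \<Longrightarrow> smooth_up_to S z (\<lambda>u. c * f u)"
  by (intro smooth_up_to_mult smooth_up_to_const)

lemma smooth_up_to_diff:
  assumes "smooth_up_to S z f" "smooth_up_to S z g"
  shows "smooth_up_to S z (\<lambda>u. f u - g u)"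
  using smooth_up_to_add[OF assms(1) smooth_up_to_cmult[OF assms(2), of "-1"]] by simp

lemma smooth_up_to_sum:
  assumes "\<And>i. i \<in> I \<Longrightarrow> smooth_up_to S z (f i)"
  shows "smooth_up_to S z (\<lambda>u. \<Sum>i\<in>I. f i u)"
proof (cases "finite I")
  case True
  then show ?thesis using assms
    by (induction I) (auto intro!: smooth_up_to_const smooth_up_to_add)
qed (simp add: smooth_up_to_const)

lemma smooth_up_to_pd:
  assumes "open S" "smooth_up_to S z f"
  shows "smooth_up_to S z (pd i f)"
proof -
  obtain W F where W: "open W" "z \<in> W" "smooth_on W F" "\<And>u. u \<in> W \<Longrightarrow> u \<in> S \<Longrightarrow> F u = f u"
    using assms(2) unfolding smooth_up_to_def extends_near_def by auto
  show ?thesis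
  proof (rule smooth_up_toI[OF W(1,2) smooth_on_pd[OF W(3)]])
    fix u assume "u \<in> W" "u \<in> S"
    then show "pd i F u = pd i f u"
      using W assms(1) by (intro pd_cong_open[of "W \<inter> S"]) auto
  qed
qed

text \<open>Here \<open>f\<close> may have zeros in \<open>S\<close> far from \<open>z\<close>; the equation \<open>f h = q\<close> replaces a division.\<close>
lemma smooth_up_to_quotient:
  assumes "extends_near smooth_on S f z F" "F z \<noteq> 0" "smooth_up_to S z q"
    and eq: "\<And>u. u \<in> S \<Longrightarrow> f u * h u = q u"
  shows "smooth_up_to S z h"
proof -
  obtain W where W: "open W" "z \<in> W" "smooth_on W F" "\<And>u. u \<in> W \<Longrightarrow> u \<in> S \<Longrightarrow> F u = f u"
    using assms(1) unfolding extends_near_def by auto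
  obtain V G where V: "open V" "z \<in> V" "smooth_on V G" "\<And>u. u \<in> V \<Longrightarrow> u \<in> S \<Longrightarrow> G u = q u"
    using assms(3) unfolding smooth_up_to_def extends_near_def by auto
  have "open {u \<in> W. F u \<noteq> 0}"
    using continuous_open_preimage[OF smooth_on_continuous[OF W(3)] W(1), of "- {0}"]
    by (simp add: vimage_def Int_def open_Compl)
  then have o: "open ({u \<in> W. F u \<noteq> 0} \<inter> V)" using V(1) by blast
  show ?thesis
  proof (rule smooth_up_toI[OF o])
    show "smooth_on ({u \<in> W. F u \<noteq> 0} \<inter> V) (\<lambda>u. G u * inverse (F u))"
      by (intro smooth_on_mult smooth_on_inverse o)
        (auto intro: smooth_on_subset[OF W(3)] smooth_on_subset[OF V(3)])
    fix u assume "u \<in> {u \<in> W. F u \<noteq> 0} \<inter> V" "u \<in> S"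
    then show "G u * inverse (F u) = h u"
      using W(4)[of u] V(4)[of u] eq[of u] by (auto simp: field_simps)
  qed (use W V assms(2) in auto)
qed

lemma smooth_up_to_bounded:
  assumes "smooth_up_to S z f"
  obtains C r where "r > 0" "\<And>u. u \<in> S \<Longrightarrow> dist z u < r \<Longrightarrow> \<bar>f u\<bar> \<le> C"
proof -
  obtain W F where W: "open W" "z \<in> W" "smooth_on W F" "\<And>u. u \<in> W \<Longrightarrow> u \<in> S \<Longrightarrow> F u = f u"
    using assms(1) unfolding smooth_up_to_def extends_near_def by auto
  have "isCont F z"
    using smooth_on_continuous[OF W(3)] W(1,2) continuous_on_eq_continuous_at by blast
  then obtain d where d: "d > 0" "\<And>u. dist u z < d \<Longrightarrow> dist (F u) (F z) < 1"
    unfolding continuous_at_eps_delta by (meson zero_less_one)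
  obtain e where e: "e > 0" "ball z e \<subseteq> W" using W(1,2) open_contains_ball by blast
  have "\<bar>f u\<bar> \<le> \<bar>F z\<bar> + 1" if "u \<in> S" "dist z u < min d e" for u
  proof -
    have "u \<in> W" using e(2) that by auto
    then have "F u = f u" using W(4) that by blast
    moreover have "dist (F u) (F z) < 1" using d(2) that by (simp add: dist_commute)
    ultimately show ?thesis by (simp add: dist_real_def)
  qed
  then show ?thesis using that[of "min d e"] d(1) e(1) by auto
qed

text \<open>With this bound a factor \<open>f\<^sup>k\<close> contributes decay of order \<open>k\<close> at \<open>z\<close>.\<close>
lemma smooth_vanishing_Lipschitz:
  assumes "extends_near smooth_on S f z F" "F z = 0"
  obtains K r where "r > 0" "\<And>u. u \<in> S \<Longrightarrow> dist z u < r \<Longrightarrow> \<bar>f u\<bar> \<le> K * dist z u"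
proof -
  obtain W where W: "open W" "z \<in> W" "smooth_on W F" "\<And>u. u \<in> W \<Longrightarrow> u \<in> S \<Longrightarrow> F u = f u"
    using assms(1) unfolding extends_near_def by auto
  let ?d = "frechet_derivative F (at z)"
  have D: "(F has_derivative ?d) (at z)"
    using smooth_on_differentiable[OF W(3,2)] frechet_derivative_works by blast
  then obtain d where d: "d > 0" "\<And>u. norm (u - z) < d \<Longrightarrow>
      norm (F u - F z - ?d (u - z)) \<le> 1 * norm (u - z)"
    unfolding has_derivative_at_alt by (meson zero_less_one)
  have "bounded_linear ?d" using D has_derivative_bounded_linear by blast
  then obtain K where K: "\<And>u. norm (?d u) \<le> norm u * K" using bounded_linear.bounded by blast
  obtain e where e: "e > 0" "ball z e \<subseteq> W" using W(1,2) open_contains_ball by blast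
  have "\<bar>f u\<bar> \<le> (K + 1) * dist z u" if "u \<in> S" "dist z u < min d e" for u
  proof -
    have "u \<in> W" using e(2) that by auto
    then have "F u = f u" using W(4) that by blast
    moreover have "norm (F u - F z - ?d (u - z)) \<le> 1 * norm (u - z)"
      using d(2) that by (simp add: dist_norm norm_minus_commute)
    ultimately show ?thesis using K[of "u - z"] assms(2)
      by (simp add: dist_norm norm_minus_commute algebra_simps)
  qed
  then show ?thesis using that[of "min d e"] d(1) e(1) by auto
qed

lemma smooth_on_prod:
  fixes f :: "'i \<Rightarrow> 'a::euclidean_space \<Rightarrow> real"
  assumes "open S" "\<And>i. i \<in> I \<Longrightarrow> smooth_on S (f i)"
  shows "smooth_on S (\<lambda>x. \<Prod>i\<in>I. f i x)"
proof (cases "finite I")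
  case True
  then show ?thesis using assms(2)
    by (induction I) (auto intro!: smooth_on_const smooth_on_mult[OF assms(1)])
qed (simp add: smooth_on_const)

lemma smooth_on_det:
  fixes A :: "'a::euclidean_space \<Rightarrow> real ^ 'n::finite ^ 'n"
  assumes "open W" "\<And>i j. smooth_on W (\<lambda>u. A u $ i $ j)"
  shows "smooth_on W (\<lambda>u. det (A u))"
  unfolding det_def
  by (intro smooth_on_sum smooth_on_mult smooth_on_const smooth_on_prod assms)

lemma matrix_inv_inverse:
  fixes A :: "real ^ 'n::finite ^ 'n"
  assumes "invertible A"
  shows "A ** matrix_inv A = mat 1" "matrix_inv A ** A = mat 1"
  using someI_ex[OF assms[unfolded invertible_def]] unfolding matrix_inv_def by auto

text \<open>Cramer's rule: the entries are quotients of polynomials in the entries of \<open>A\<close>.\<close>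
lemma smooth_on_matrix_inv:
  fixes A :: "'a::euclidean_space \<Rightarrow> real ^ 'n::finite ^ 'n"
  assumes "open W" "\<And>i j. smooth_on W (\<lambda>u. A u $ i $ j)" "\<And>u. u \<in> W \<Longrightarrow> det (A u) \<noteq> 0"
  shows "smooth_on W (\<lambda>u. matrix_inv (A u) $ i $ j)"
proof (rule smooth_on_cong[OF assms(1)])
  show "smooth_on W (\<lambda>u. det (\<chi> r c. if c = i then axis j 1 $ r else A u $ r $ c) * inverse (det (A u)))"
  proof (intro smooth_on_mult smooth_on_inverse smooth_on_det assms)
    fix r c show "smooth_on W (\<lambda>u. (\<chi> r c. if c = i then axis j 1 $ r else A u $ r $ c) $ r $ c)"
      by (cases "c = i") (simp_all add: smooth_on_const assms(2))
  qed
next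
  fix u assume u: "u \<in> W"
  then have "invertible (A u)" using assms(3) invertible_det_nz by blast
  then have "A u ** matrix_inv (A u) = mat 1" by (simp add: matrix_inv_inverse)
  then have "A u *v (matrix_inv (A u) *v axis j 1) = axis j 1"
    by (simp add: matrix_vector_mul_assoc)
  then have "matrix_inv (A u) *v axis j 1 =
      (\<chi> k. det (\<chi> r c. if c = k then axis j 1 $ r else A u $ r $ c) / det (A u))"
    using cramer[OF assms(3)[OF u]] by blast
  moreover have "(matrix_inv (A u) *v axis j 1) $ i = matrix_inv (A u) $ i $ j"
    by (simp add: matrix_vector_mul_component inner_vec_def axis_def if_distrib cong: if_cong)
  ultimately show "det (\<chi> r c. if c = i then axis j 1 $ r else A u $ r $ c) * inverse (det (A u)) =
      matrix_inv (A u) $ i $ j"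
    by (simp add: divide_inverse)
qed

text \<open>The metric \<open>g\<^sub>i\<^sub>j = 1/2 L\<^sub>\<cdot>\<^sub>i\<^sub>\<cdot>\<^sub>j\<close> computed from the restriction of \<open>L\<close> to one tangent space.\<close>
definition fiber_metric :: "(real ^ 'n::finite \<Rightarrow> real) \<Rightarrow> real ^ 'n \<Rightarrow> real ^ 'n ^ 'n" where
  "fiber_metric l y = (\<chi> i j. 1/2 * pd j (pd i l) y)"

lemma fiber_metric_cong_open:
  assumes "open S" "y \<in> S" "\<And>u. u \<in> S \<Longrightarrow> f u = g u"
  shows "fiber_metric f y = fiber_metric g y"
proof -
  have "pd i f u = pd i g u" if "u \<in> S" for i u
    using assms(3) by (intro pd_cong_open[OF assms(1) that])
  then have "pd j (pd i f) y = pd j (pd i g) y" for i j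
    by (intro pd_cong_open[OF assms(1,2)])
  then show ?thesis by (simp add: fiber_metric_def)
qed

lemma smooth_on_fiber_metric:
  "open W \<Longrightarrow> smooth_on W l \<Longrightarrow> smooth_on W (\<lambda>u. fiber_metric l u $ i $ j)"
  unfolding fiber_metric_def vec_lambda_beta by (intro smooth_on_mult smooth_on_const smooth_on_pd)

lemma smooth_up_to_inverse_metric:
  assumes "open S" "extends_near smooth_on S l z F" "invertible (fiber_metric F z)"
  shows "smooth_up_to S z (\<lambda>u. matrix_inv (fiber_metric l u) $ i $ j)"
proof -
  obtain W where W: "open W" "z \<in> W" "smooth_on W F" "\<And>u. u \<in> W \<Longrightarrow> u \<in> S \<Longrightarrow> F u = l u"
    using assms(2) unfolding extends_near_def by auto
  have d: "continuous_on W (\<lambda>u. det (fiber_metric F u))"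
    using W by (intro smooth_on_continuous smooth_on_det smooth_on_fiber_metric)
  have o: "open {u \<in> W. det (fiber_metric F u) \<noteq> 0}"
    using continuous_open_preimage[OF d W(1), of "- {0}"]
    by (simp add: vimage_def Int_def open_Compl)
  show ?thesis
  proof (rule smooth_up_toI[OF o])
    show "smooth_on {u \<in> W. det (fiber_metric F u) \<noteq> 0} (\<lambda>u. matrix_inv (fiber_metric F u) $ i $ j)"
      using W(3) by (intro smooth_on_matrix_inv o smooth_on_fiber_metric) (auto intro: smooth_on_subset)
    show "matrix_inv (fiber_metric F u) $ i $ j = matrix_inv (fiber_metric l u) $ i $ j"
      if "u \<in> {u \<in> W. det (fiber_metric F u) \<noteq> 0}" "u \<in> S" for u
    proof -
      have "fiber_metric F u = fiber_metric l u"
        by (rule fiber_metric_cong_open[of "W \<inter> S"]) (use that W assms(1) in auto)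
      then show ?thesis by simp
    qed
  qed (use W assms(3) invertible_det_nz in auto)
qed

section \<open>The difference of two solutions in one tangent space\<close>

text \<open>The situation in one tangent space: \<open>S\<close> is the cone \<open>A\<^sub>p\<close>, \<open>l\<close> the restriction of \<open>L\<close>, and
  \<open>D k i\<close> the component \<open>D\<^sup>k\<^sub>i\<close> of the difference of two symmetric solutions. The mean Landsberg
  term of the affine equation is common to both solutions and drops out of \<open>affine_difference\<close>.\<close>
locale fiber_solution_difference =
  fixes S :: "(real ^ 'n::finite) set"
    and l :: "real ^ 'n \<Rightarrow> real"
    and D :: "'n \<Rightarrow> 'n \<Rightarrow> real ^ 'n \<Rightarrow> real"
    and n :: real
  assumes S_open: "open S"
    and S_cone: "y \<in> S \<Longrightarrow> t > 0 \<Longrightarrow> t *\<^sub>R y \<in> S"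
    and l_smooth: "smooth_on S l"
    and l_pos: "y \<in> S \<Longrightarrow> l y > 0"
    and l_hom: "y \<in> S \<Longrightarrow> t > 0 \<Longrightarrow> l (t *\<^sub>R y) = t\<^sup>2 * l y"
    and metric_invertible: "y \<in> S \<Longrightarrow> invertible (fiber_metric l y)"
    and D_smooth: "smooth_on S (D k i)"
    and D_hom: "y \<in> S \<Longrightarrow> t > 0 \<Longrightarrow> D k i (t *\<^sub>R y) = t * D k i y"
    and D_sym: "y \<in> S \<Longrightarrow> pd j (D k i) y = pd i (D k j) y"
    and affine_difference: "y \<in> S \<Longrightarrow>
      (n + 2) * (\<Sum>a\<in>UNIV. (\<Sum>c\<in>UNIV. fiber_metric l y $ a $ c * y $ c) / l y * D a b y)
      - 2 * (\<Sum>a\<in>UNIV. (\<Sum>c\<in>UNIV. \<Sum>e\<in>UNIV. matrix_inv (fiber_metric l y) $ c $ e *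
          (1/2 * pd a (\<lambda>u. fiber_metric l u $ c $ e) y)) * D a b y)
      - (\<Sum>a\<in>UNIV. pd a (D a b) y + pd b (D a a) y) = 0"
    and dim: "n = real CARD('n)" "CARD('n) \<ge> 3"
begin

definition g :: "'n \<Rightarrow> 'n \<Rightarrow> real ^ 'n \<Rightarrow> real" where
  "g i j y = fiber_metric l y $ i $ j"

definition gi :: "'n \<Rightarrow> 'n \<Rightarrow> real ^ 'n \<Rightarrow> real" where
  "gi i j y = matrix_inv (fiber_metric l y) $ i $ j"

text \<open>The components \<open>y\<^sub>i\<close> of the lowered position vector.\<close>
definition yl :: "'n \<Rightarrow> real ^ 'n \<Rightarrow> real" where
  "yl i y = (\<Sum>a\<in>UNIV. g i a y * y $ a)"

text \<open>The mean Cartan tensor \<open>C\<^sub>i\<close>.\<close>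
definition C :: "'n \<Rightarrow> real ^ 'n \<Rightarrow> real" where
  "C i y = (\<Sum>a\<in>UNIV. \<Sum>b\<in>UNIV. gi a b y * (1/2 * pd i (g a b) y))"

text \<open>A potential of \<open>D\<close> with respect to the fibre derivative, see \<open>pd_P\<close>.\<close>
definition P :: "'n \<Rightarrow> real ^ 'n \<Rightarrow> real" where
  "P k y = 1/2 * (\<Sum>i\<in>UNIV. D k i y * y $ i)"

lemma differentiable_S: "smooth_on S f \<Longrightarrow> y \<in> S \<Longrightarrow> f differentiable (at y)"
  by (rule smooth_on_differentiable)

lemma smooth_g: "smooth_on S (g i j)"
  unfolding g_def[abs_def] by (rule smooth_on_fiber_metric[OF S_open l_smooth])

lemma smooth_gi: "smooth_on S (gi i j)"
  unfolding gi_def[abs_def]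
  by (intro smooth_on_matrix_inv S_open smooth_on_fiber_metric l_smooth)
    (use metric_invertible invertible_det_nz in blast)

lemma smooth_yl: "smooth_on S (yl i)"
  unfolding yl_def[abs_def]
  by (intro smooth_on_sum smooth_on_mult smooth_on_component smooth_g S_open)

lemma smooth_C: "smooth_on S (C i)"
  unfolding C_def[abs_def]
  by (intro smooth_on_sum smooth_on_mult smooth_on_const smooth_on_pd smooth_gi smooth_g S_open)

lemma smooth_P: "smooth_on S (P i)"
  unfolding P_def[abs_def]
  by (intro smooth_on_sum smooth_on_mult smooth_on_const smooth_on_component D_smooth S_open)

lemma pd_l_hom: "y \<in> S \<Longrightarrow> t > 0 \<Longrightarrow> pd i l (t *\<^sub>R y) = t * pd i l y"
  using pd_homogeneous[OF S_open S_cone differentiable_S[OF l_smooth], of 1 y t i] l_hom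
  by (simp add: power2_eq_square numeral_2_eq_2)

lemma g_hom: "y \<in> S \<Longrightarrow> t > 0 \<Longrightarrow> g i j (t *\<^sub>R y) = g i j y"
  using pd_homogeneous[OF S_open S_cone differentiable_S[OF smooth_on_pd[OF l_smooth]], of i 0 y t j]
    pd_l_hom by (simp add: g_def fiber_metric_def)

lemma yl_hom: "y \<in> S \<Longrightarrow> t > 0 \<Longrightarrow> yl i (t *\<^sub>R y) = t * yl i y"
  by (simp add: yl_def g_hom sum_distrib_left mult_ac)

lemma P_hom: "y \<in> S \<Longrightarrow> t > 0 \<Longrightarrow> P i (t *\<^sub>R y) = t\<^sup>2 * P i y"
  by (simp add: P_def D_hom sum_distrib_left power2_eq_square mult_ac)

lemma yl_eq_pd: "y \<in> S \<Longrightarrow> yl i y = 1/2 * pd i l y"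
  using Euler_homogeneous[OF differentiable_S[OF smooth_on_pd[OF l_smooth]], of y i 1] pd_l_hom
  by (simp add: yl_def g_def fiber_metric_def sum_divide_distrib[symmetric] mult.commute)

lemma pd_l: "y \<in> S \<Longrightarrow> pd i l y = 2 * yl i y"
  by (simp add: yl_eq_pd)

lemma Euler_l: "y \<in> S \<Longrightarrow> (\<Sum>i\<in>UNIV. yl i y * y $ i) = l y"
  using Euler_homogeneous[OF differentiable_S[OF l_smooth], of y 2] l_hom
  by (simp add: yl_eq_pd sum_divide_distrib[symmetric] mult.commute)

lemma pd_yl: "y \<in> S \<Longrightarrow> pd b (yl a) y = g a b y"
proof -
  assume y: "y \<in> S"
  have "pd b (yl a) y = pd b (\<lambda>u. 1/2 * pd a l u) y"
    by (rule pd_cong_open[OF S_open y]) (rule yl_eq_pd)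
  also have "\<dots> = g a b y"
    using pd_cmult[OF differentiable_S[OF smooth_on_pd[OF l_smooth] y], of b "1/2" a]
    by (simp add: g_def fiber_metric_def)
  finally show ?thesis .
qed

text \<open>The contraction is over the first index of \<open>g\<close>, in \<open>yl\<close> it is over the second. It is found by
  differentiating Euler's relation \<open>y\<^sub>iy\<^sup>i = l\<close>.\<close>
lemma g_y: "y \<in> S \<Longrightarrow> (\<Sum>a\<in>UNIV. g a b y * y $ a) = yl b y"
proof -
  assume y: "y \<in> S"
  have "pd b (\<lambda>u. \<Sum>i\<in>UNIV. yl i u * u $ i) y = pd b l y"
    by (rule pd_cong_open[OF S_open y]) (rule Euler_l)
  moreover have "pd b (\<lambda>u. \<Sum>i\<in>UNIV. yl i u * u $ i) y =
      (\<Sum>i\<in>UNIV. yl i y * (if i = b then 1 else 0) + g i b y * y $ i)"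
    using y by (simp add: pd_sum pd_mult differentiable_S[OF smooth_yl] pd_component pd_yl
        differentiable_S[OF smooth_on_component] differentiable_S[OF smooth_on_mult[OF S_open smooth_yl smooth_on_component]])
  ultimately show ?thesis using y by (simp add: sum.distrib pd_l if_distrib[of "(*) _"] cong: if_cong)
qed

text \<open>The components of the metric are homogeneous of degree zero.\<close>
lemma C_y: "y \<in> S \<Longrightarrow> (\<Sum>i\<in>UNIV. C i y * y $ i) = 0"
proof -
  assume y: "y \<in> S"
  have e: "(\<Sum>i\<in>UNIV. y $ i * pd i (g a b) y) = 0" for a b
    using Euler_homogeneous[OF differentiable_S[OF smooth_g y], of a b 0] g_hom[OF y] by simp
  have "(\<Sum>i\<in>UNIV. C i y * y $ i) =
      (\<Sum>i\<in>UNIV. \<Sum>a\<in>UNIV. \<Sum>b\<in>UNIV. 1/2 * gi a b y * (y $ i * pd i (g a b) y))"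
    by (simp add: C_def sum_distrib_left mult.commute[of _ "y $ _"] mult.left_commute[of _ "y $ _"])
  also have "\<dots> = (\<Sum>a\<in>UNIV. \<Sum>b\<in>UNIV. \<Sum>i\<in>UNIV. 1/2 * gi a b y * (y $ i * pd i (g a b) y))"
    by (subst sum.swap, rule sum.cong[OF refl], rule sum.swap)
  also have "\<dots> = 0" by (simp only: sum_distrib_left[symmetric] e) simp
  finally show ?thesis .
qed

lemma raise_lower: "y \<in> S \<Longrightarrow> (\<Sum>b\<in>UNIV. (\<Sum>c\<in>UNIV. g c b y * v c) * gi b a y) = v a"
proof -
  assume y: "y \<in> S"
  have "fiber_metric l y ** matrix_inv (fiber_metric l y) = mat 1"
    by (rule matrix_inv_inverse(1)[OF metric_invertible[OF y]])
  then have m: "(\<Sum>b\<in>UNIV. g c b y * gi b a y) = (if c = a then 1 else 0)" for c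
    by (auto simp: g_def gi_def matrix_matrix_mult_def mat_def vec_eq_iff)
  have "(\<Sum>b\<in>UNIV. (\<Sum>c\<in>UNIV. g c b y * v c) * gi b a y) =
      (\<Sum>b\<in>UNIV. \<Sum>c\<in>UNIV. v c * (g c b y * gi b a y))"
    by (simp add: sum_distrib_left mult_ac)
  also have "\<dots> = (\<Sum>c\<in>UNIV. v c * (\<Sum>b\<in>UNIV. g c b y * gi b a y))"
    by (subst sum.swap) (simp add: sum_distrib_left)
  also have "\<dots> = v a" by (simp add: m if_distrib cong: if_cong)
  finally show ?thesis .
qed

text \<open>Differentiating \<open>1/2 D\<^sup>k\<^sub>jy\<^sup>j\<close> gives \<open>1/2 (D\<^sup>k\<^sub>i + y\<^sup>j\<partial>\<^sub>iD\<^sup>k\<^sub>j)\<close>; by symmetry the last sum is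
  \<open>y\<^sup>j\<partial>\<^sub>jD\<^sup>k\<^sub>i\<close>, and this is \<open>D\<^sup>k\<^sub>i\<close> by Euler's relation.\<close>
lemma pd_P: "y \<in> S \<Longrightarrow> pd i (P k) y = D k i y"
proof -
  assume y: "y \<in> S"
  have "smooth_on S (\<lambda>u. \<Sum>j\<in>UNIV. D k j u * u $ j)"
    by (intro smooth_on_sum smooth_on_mult smooth_on_component D_smooth S_open)
  then have "pd i (P k) y = 1/2 * pd i (\<lambda>u. \<Sum>j\<in>UNIV. D k j u * u $ j) y"
    unfolding P_def[abs_def] by (intro pd_cmult differentiable_S y)
  also have "pd i (\<lambda>u. \<Sum>j\<in>UNIV. D k j u * u $ j) y =
      (\<Sum>j\<in>UNIV. D k j y * (if j = i then 1 else 0) + pd i (D k j) y * y $ j)"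
    using y by (simp add: pd_sum pd_mult differentiable_S[OF D_smooth] pd_component
        differentiable_S[OF smooth_on_component] differentiable_S[OF smooth_on_mult[OF S_open D_smooth smooth_on_component]])
  also have "\<dots> = D k i y + (\<Sum>j\<in>UNIV. y $ j * pd j (D k i) y)"
  proof -
    have "(\<Sum>j\<in>UNIV. D k j y * (if j = i then 1 else 0)) = D k i y"
      by (simp add: if_distrib[of "(*) _"] cong: if_cong)
    moreover have "pd i (D k j) y * y $ j = y $ j * pd j (D k i) y" for j
      by (subst D_sym[OF y]) (rule mult.commute)
    ultimately show ?thesis by (simp only: sum.distrib)
  qed
  also have "1/2 * \<dots> = D k i y"
  proof -
    have "(\<Sum>j\<in>UNIV. y $ j * pd j (D k i) y) = real 1 * D k i y"
      by (rule Euler_homogeneous[OF differentiable_S[OF D_smooth y]]) (simp add: D_hom[OF y])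
    then show ?thesis by simp
  qed
  finally show ?thesis .
qed

text \<open>By \<open>pd_P\<close> the trace of \<open>D\<close> is the divergence of \<open>P\<close>.\<close>
definition divP :: "real ^ 'n \<Rightarrow> real" where
  "divP y = (\<Sum>a\<in>UNIV. D a a y)"

lemma smooth_divP: "smooth_on S divP"
  unfolding divP_def[abs_def] by (intro smooth_on_sum S_open D_smooth)

text \<open>By symmetry both second derivatives of \<open>P\<close> in the affine equation are the gradient of its divergence.\<close>
lemma affine_divP:
  assumes y: "y \<in> S"
  shows "(n + 2) * (\<Sum>a\<in>UNIV. yl a y * D a b y) - 2 * l y * (\<Sum>a\<in>UNIV. C a y * D a b y)
    - 2 * l y * pd b divP y = 0"
proof -
  have 1: "(\<Sum>a\<in>UNIV. pd a (D a b) y + pd b (D a a) y) = 2 * pd b divP y"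
    unfolding divP_def[abs_def] using y
    by (simp add: pd_sum differentiable_S[OF D_smooth] D_sym[OF y, of _ _ b] sum_distrib_left)
  have 2: "(\<Sum>a\<in>UNIV. yl a y / l y * D a b y) = (\<Sum>a\<in>UNIV. yl a y * D a b y) / l y"
    by (simp add: sum_divide_distrib)
  have "(n + 2) * (\<Sum>a\<in>UNIV. yl a y / l y * D a b y) - 2 * (\<Sum>a\<in>UNIV. C a y * D a b y)
    - (\<Sum>a\<in>UNIV. pd a (D a b) y + pd b (D a a) y) = 0"
    using affine_difference[OF y, of b] by (simp only: yl_def C_def g_def gi_def g_def[abs_def])
  then have "(n + 2) * ((\<Sum>a\<in>UNIV. yl a y * D a b y) / l y) - 2 * (\<Sum>a\<in>UNIV. C a y * D a b y)
    - 2 * pd b divP y = 0" by (simp only: 1 2)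
  then show ?thesis using l_pos[OF y] by (simp add: field_simps)
qed

text \<open>The contraction of \<open>affine_divP\<close> with \<open>y\<^sup>b\<close>: Euler's relation removes all derivatives, because
  \<open>D\<^sup>a\<^sub>by\<^sup>b = 2P\<^sup>a\<close> and the divergence is homogeneous of degree one.\<close>
lemma divP_eq:
  assumes y: "y \<in> S"
  shows "l y * divP y = (n + 2) * (\<Sum>a\<in>UNIV. yl a y * P a y) - 2 * l y * (\<Sum>a\<in>UNIV. C a y * P a y)"
proof -
  have P2: "(\<Sum>b\<in>UNIV. y $ b * (\<Sum>a\<in>UNIV. f a * D a b y)) = 2 * (\<Sum>a\<in>UNIV. f a * P a y)" for f
  proof -
    have "(\<Sum>b\<in>UNIV. y $ b * (\<Sum>a\<in>UNIV. f a * D a b y)) =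
        (\<Sum>a\<in>UNIV. \<Sum>b\<in>UNIV. f a * (D a b y * y $ b))"
      by (subst sum.swap) (simp add: sum_distrib_left mult_ac)
    also have "\<dots> = 2 * (\<Sum>a\<in>UNIV. f a * P a y)"
      by (simp add: P_def sum_distrib_left mult_ac)
    finally show ?thesis .
  qed
  have E: "(\<Sum>b\<in>UNIV. y $ b * pd b divP y) = divP y"
    using Euler_homogeneous[OF differentiable_S[OF smooth_divP y], of 1] D_hom[OF y]
    by (simp add: divP_def sum_distrib_left)
  have "0 = (\<Sum>b\<in>UNIV. y $ b * ((n + 2) * (\<Sum>a\<in>UNIV. yl a y * D a b y)
      - 2 * l y * (\<Sum>a\<in>UNIV. C a y * D a b y) - 2 * l y * pd b divP y))"
    by (simp add: affine_divP[OF y])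
  also have "\<dots> = (n + 2) * (\<Sum>b\<in>UNIV. y $ b * (\<Sum>a\<in>UNIV. yl a y * D a b y))
      - 2 * l y * (\<Sum>b\<in>UNIV. y $ b * (\<Sum>a\<in>UNIV. C a y * D a b y))
      - 2 * l y * (\<Sum>b\<in>UNIV. y $ b * pd b divP y)"
    by (simp add: right_diff_distrib sum_subtractf sum_distrib_left mult_ac)
  finally show ?thesis unfolding P2 E by (simp add: algebra_simps)
qed

text \<open>The factor \<open>l y\<close> avoids the exponent \<open>k - 1\<close>, which is meaningless for \<open>k = 0\<close>; the same device is
  used in the equations for \<open>B\<close> below.\<close>
lemma pd_power_l:
  assumes y: "y \<in> S"
  shows "l y * pd b (\<lambda>u. l u ^ k) y = 2 * real k * yl b y * l y ^ k"
proof (induction k)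
  case 0
  then show ?case by (simp add: pd_const)
next
  case (Suc k)
  have "smooth_on S (\<lambda>u. l u ^ k)" by (rule smooth_on_power[OF S_open l_smooth])
  then have "pd b (\<lambda>u. l u ^ Suc k) y = l y * pd b (\<lambda>u. l u ^ k) y + pd b l y * l y ^ k"
    using y by (simp add: pd_mult differentiable_S l_smooth)
  then show ?case by (simp add: Suc pd_l[OF y] algebra_simps)
qed

section \<open>Divisibility of the difference by powers of the metric\<close>

text \<open>\<open>P = l\<^sup>k B\<close>. On \<open>S\<close> this quotient is always smooth; the question is whether it extends
  smoothly to points with \<open>l = 0\<close>.\<close>
definition B :: "nat \<Rightarrow> 'n \<Rightarrow> real ^ 'n \<Rightarrow> real" where
  "B k a y = P a y / l y ^ k"

lemma smooth_power_l: "smooth_on S (\<lambda>u. l u ^ k)"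
  by (rule smooth_on_power[OF S_open l_smooth])

lemma smooth_B: "smooth_on S (B k a)"
  unfolding B_def[abs_def] divide_inverse
  by (intro smooth_on_mult smooth_on_inverse smooth_P smooth_power_l S_open)
    (use l_pos in fastforce)

lemma P_eq_B: "y \<in> S \<Longrightarrow> P a y = l y ^ k * B k a y"
  using l_pos[of y] by (simp add: B_def)

lemma D_eq_B:
  assumes y: "y \<in> S"
  shows "l y * D a b y = l y ^ k * (l y * pd b (B k a) y + 2 * real k * yl b y * B k a y)"
proof -
  have "D a b y = pd b (\<lambda>u. l u ^ k * B k a u) y"
    unfolding pd_P[OF y, symmetric] by (rule pd_cong_open[OF S_open y]) (rule P_eq_B)
  also have "\<dots> = l y ^ k * pd b (B k a) y + pd b (\<lambda>u. l u ^ k) y * B k a y"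
    by (rule pd_mult) (intro differentiable_S[OF _ y] smooth_B smooth_power_l)+
  finally have "l y * D a b y =
      l y ^ k * (l y * pd b (B k a) y) + l y * pd b (\<lambda>u. l u ^ k) y * B k a y"
    by (simp add: algebra_simps)
  then show ?thesis unfolding pd_power_l[OF y] by (simp add: algebra_simps)
qed

definition yB :: "nat \<Rightarrow> real ^ 'n \<Rightarrow> real" where
  "yB k y = (\<Sum>a\<in>UNIV. yl a y * B k a y)"

definition CB :: "nat \<Rightarrow> real ^ 'n \<Rightarrow> real" where
  "CB k y = (\<Sum>a\<in>UNIV. C a y * B k a y)"

definition divB :: "nat \<Rightarrow> real ^ 'n \<Rightarrow> real" where
  "divB k y = (\<Sum>a\<in>UNIV. pd a (B k a) y)"

lemma smooth_yB: "smooth_on S (yB k)"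
  unfolding yB_def[abs_def] by (intro smooth_on_sum smooth_on_mult smooth_yl smooth_B S_open)

lemma smooth_CB: "smooth_on S (CB k)"
  unfolding CB_def[abs_def] by (intro smooth_on_sum smooth_on_mult smooth_C smooth_B S_open)

lemma divP_eq_B:
  assumes y: "y \<in> S"
  shows "l y * divP y = l y ^ k * ((n + 2) * yB k y - 2 * l y * CB k y)"
proof -
  have fP: "(\<Sum>a\<in>UNIV. f a * P a y) = l y ^ k * (\<Sum>a\<in>UNIV. f a * B k a y)" for f
    by (simp add: P_eq_B[OF y, of _ k] sum_distrib_left mult_ac)
  show ?thesis unfolding divP_eq[OF y] fP yB_def CB_def by (simp add: algebra_simps)
qed

text \<open>The divergence of \<open>P = l\<^sup>k B\<close> is computed once by the product rule and once from \<open>divP_eq\<close>.\<close>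
lemma divergence_equation:
  assumes y: "y \<in> S"
  shows "l y * divB k y + 2 * real k * yB k y = (n + 2) * yB k y - 2 * l y * CB k y"
proof -
  have "l y * divP y = (\<Sum>a\<in>UNIV. l y * D a a y)" by (simp add: divP_def sum_distrib_left)
  also have "\<dots> = l y ^ k * (l y * divB k y + 2 * real k * yB k y)"
    unfolding D_eq_B[OF y, of _ _ k] divB_def yB_def
    by (simp add: sum_distrib_left sum.distrib distrib_left mult_ac)
  finally have "l y ^ k * (l y * divB k y + 2 * real k * yB k y) =
      l y ^ k * ((n + 2) * yB k y - 2 * l y * CB k y)"
    using divP_eq_B[OF y, of k] by (rule trans[OF sym])
  then show ?thesis using l_pos[OF y] by simp
qed

lemma pd_yB:
  assumes y: "y \<in> S"
  shows "pd b (yB k) y = (\<Sum>a\<in>UNIV. g a b y * B k a y) + (\<Sum>a\<in>UNIV. yl a y * pd b (B k a) y)"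
proof -
  have "pd b (yB k) y = (\<Sum>a\<in>UNIV. pd b (\<lambda>u. yl a u * B k a u) y)"
    unfolding yB_def[abs_def]
    by (rule pd_sum) (intro differentiable_S[OF _ y] smooth_on_mult smooth_yl smooth_B S_open)
  also have "\<dots> = (\<Sum>a\<in>UNIV. yl a y * pd b (B k a) y + g a b y * B k a y)"
    by (intro sum.cong refl, subst pd_mult)
      (auto simp: pd_yl[OF y] intro: differentiable_S[OF _ y] smooth_yl smooth_B)
  finally show ?thesis by (simp add: sum.distrib)
qed

text \<open>The remainder of \<open>gradient_equation\<close>. It occurs there with the factor \<open>l\<^sup>2\<close>, and only its
  smoothness up to the boundary matters.\<close>
definition Q :: "nat \<Rightarrow> 'n \<Rightarrow> real ^ 'n \<Rightarrow> real" where
  "Q k b y = 4 * pd b (CB k) y - 2 * (\<Sum>a\<in>UNIV. C a y * pd b (B k a) y)"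

lemma pd_divP_eq_B:
  assumes y: "y \<in> S"
  shows "(l y)\<^sup>2 * pd b divP y = l y ^ k * ((2 * real k - 2) * yl b y * ((n + 2) * yB k y - 2 * l y * CB k y)
    + l y * ((n + 2) * pd b (yB k) y - 4 * yl b y * CB k y - 2 * l y * pd b (CB k) y))"
proof -
  define E where "E u = (n + 2) * yB k u - 2 * l u * CB k u" for u
  have lCB: "smooth_on S (\<lambda>u. 2 * l u * CB k u)" "smooth_on S (\<lambda>u. 2 * l u)"
    "smooth_on S (\<lambda>u. (n + 2) * yB k u)"
    by (intro smooth_on_mult smooth_on_const l_smooth smooth_CB smooth_yB S_open)+
  have sE: "smooth_on S E"
    unfolding E_def[abs_def] by (rule smooth_on_diff[OF S_open lCB(3,1)])
  have pE: "pd b E y = (n + 2) * pd b (yB k) y - (4 * yl b y * CB k y + 2 * l y * pd b (CB k) y)"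
    using lCB[THEN differentiable_S, OF y] differentiable_S[OF smooth_yB y]
      differentiable_S[OF smooth_CB y] differentiable_S[OF l_smooth y]
    unfolding E_def[abs_def] by (simp add: pd_diff pd_cmult pd_mult pd_const pd_l[OF y])
  have "pd b (\<lambda>u. l u * divP u) y = pd b (\<lambda>u. l u ^ k * E u) y"
    unfolding E_def by (rule pd_cong_open[OF S_open y]) (rule divP_eq_B)
  moreover have "pd b (\<lambda>u. l u * divP u) y = l y * pd b divP y + 2 * yl b y * divP y"
    using y by (simp add: pd_mult differentiable_S l_smooth smooth_divP pd_l)
  moreover have "pd b (\<lambda>u. l u ^ k * E u) y = l y ^ k * pd b E y + pd b (\<lambda>u. l u ^ k) y * E y"
    by (rule pd_mult) (intro differentiable_S[OF _ y] smooth_power_l sE)+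
  ultimately have e: "l y * pd b divP y + 2 * yl b y * divP y =
      l y ^ k * pd b E y + pd b (\<lambda>u. l u ^ k) y * E y"
    by (simp only:)
  have "l y * (l y * pd b divP y) + 2 * yl b y * (l y * divP y) =
      l y * (l y * pd b divP y + 2 * yl b y * divP y)"
    by (simp add: algebra_simps)
  also have "\<dots> = l y * (l y ^ k * pd b E y) + (l y * pd b (\<lambda>u. l u ^ k) y) * E y"
    unfolding e by (simp add: algebra_simps)
  finally have "l y * (l y * pd b divP y) + 2 * yl b y * (l y * divP y) =
      l y * (l y ^ k * pd b E y) + (l y * pd b (\<lambda>u. l u ^ k) y) * E y" .
  then have "(l y)\<^sup>2 * pd b divP y = l y ^ k * ((2 * real k - 2) * yl b y * E y + l y * pd b E y)"
    unfolding divP_eq_B[OF y, of k, folded E_def] pd_power_l[OF y] by (simp add: algebra_simps power2_eq_square)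
  then show ?thesis unfolding pE E_def by (simp add: algebra_simps)
qed

text \<open>The first order equation: in \<open>affine_divP\<close> the gradient of the divergence is replaced by the
  derivative of \<open>divP_eq\<close>, and the common factor \<open>l\<^sup>k\<close> is cancelled.\<close>
lemma gradient_equation:
  assumes y: "y \<in> S"
  shows "(n + 2) * (l y * pd b (yB k) y + l y * (\<Sum>a\<in>UNIV. g a b y * B k a y)
      + (2 * real k - 4) * yl b y * yB k y) =
    4 * real k * l y * yl b y * CB k y + (l y)\<^sup>2 * Q k b y"
proof -
  let ?yD = "\<Sum>a\<in>UNIV. yl a y * pd b (B k a) y" and ?CD = "\<Sum>a\<in>UNIV. C a y * pd b (B k a) y"
  have lD: "(\<Sum>a\<in>UNIV. f a * (l y * D a b y)) = l y ^ k * (l y * (\<Sum>a\<in>UNIV. f a * pd b (B k a) y)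
      + 2 * real k * yl b y * (\<Sum>a\<in>UNIV. f a * B k a y))" for f
    unfolding D_eq_B[OF y, of _ _ k]
    by (simp add: sum_distrib_left sum.distrib distrib_left mult_ac)
  have "(n + 2) * (\<Sum>a\<in>UNIV. yl a y * (l y * D a b y)) - 2 * l y * (\<Sum>a\<in>UNIV. C a y * (l y * D a b y))
      - 2 * ((l y)\<^sup>2 * pd b divP y) =
      l y * ((n + 2) * (\<Sum>a\<in>UNIV. yl a y * D a b y) - 2 * l y * (\<Sum>a\<in>UNIV. C a y * D a b y)
        - 2 * l y * pd b divP y)"
    by (simp add: sum_distrib_left right_diff_distrib power2_eq_square mult_ac)
  also have "\<dots> = 0" unfolding affine_divP[OF y] by simp
  finally have "l y ^ k * ((n + 2) * (l y * ?yD + 2 * real k * yl b y * yB k y)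
      - 2 * l y * (l y * ?CD + 2 * real k * yl b y * CB k y)
      - 2 * ((2 * real k - 2) * yl b y * ((n + 2) * yB k y - 2 * l y * CB k y)
        + l y * ((n + 2) * pd b (yB k) y - 4 * yl b y * CB k y - 2 * l y * pd b (CB k) y))) = 0"
    unfolding lD pd_divP_eq_B[OF y, of b k] yB_def[symmetric] CB_def[symmetric]
    by (simp add: algebra_simps)
  then have "(n + 2) * (l y * ?yD + 2 * real k * yl b y * yB k y)
      - 2 * l y * (l y * ?CD + 2 * real k * yl b y * CB k y)
      - 2 * ((2 * real k - 2) * yl b y * ((n + 2) * yB k y - 2 * l y * CB k y)
        + l y * ((n + 2) * pd b (yB k) y - 4 * yl b y * CB k y - 2 * l y * pd b (CB k) y)) = 0"
    using l_pos[OF y] by simp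
  moreover have "?yD = pd b (yB k) y - (\<Sum>a\<in>UNIV. g a b y * B k a y)"
    using pd_yB[OF y] by simp
  ultimately show ?thesis unfolding Q_def by (simp add: algebra_simps power2_eq_square)
qed

text \<open>The quotient \<open>y\<^sub>aB\<^sup>a / l\<close>, the first one that is shown to extend smoothly.\<close>
definition t :: "nat \<Rightarrow> real ^ 'n \<Rightarrow> real" where
  "t k y = yB k y / l y"

lemma yB_eq_t: "y \<in> S \<Longrightarrow> yB k y = l y * t k y"
  using l_pos[of y] by (simp add: t_def)

lemma smooth_t: "smooth_on S (t k)"
  unfolding t_def[abs_def] divide_inverse
  by (intro smooth_on_mult smooth_on_inverse smooth_yB l_smooth S_open)
    (use l_pos in fastforce)

lemma pd_yB_t:
  assumes y: "y \<in> S"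
  shows "pd b (yB k) y = l y * pd b (t k) y + 2 * yl b y * t k y"
proof -
  have "pd b (yB k) y = pd b (\<lambda>u. l u * t k u) y"
    by (rule pd_cong_open[OF S_open y]) (rule yB_eq_t)
  also have "\<dots> = l y * pd b (t k) y + pd b l y * t k y"
    by (rule pd_mult) (intro differentiable_S[OF _ y] l_smooth smooth_t)+
  finally show ?thesis using pd_l[OF y] by simp
qed

text \<open>\<open>l\<^sup>k\<^sup>+\<^sup>1 t = y\<^sub>aP\<^sup>a\<close> is homogeneous of degree three, so \<open>t\<close> has degree \<open>3 - 2(k + 1)\<close>. As this may
  be negative, the relation is derived from the one for \<open>y\<^sub>aP\<^sup>a\<close>.\<close>
lemma Euler_t:
  assumes y: "y \<in> S"
  shows "(\<Sum>i\<in>UNIV. y $ i * pd i (t k) y) = (1 - 2 * real k) * t k y"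
proof -
  have T: "(\<Sum>a\<in>UNIV. yl a u * P a u) = l u ^ Suc k * t k u" if "u \<in> S" for u
  proof -
    have "(\<Sum>a\<in>UNIV. yl a u * P a u) = l u ^ k * yB k u"
      by (simp add: P_eq_B[OF that, of _ k] yB_def sum_distrib_left mult_ac)
    then show ?thesis by (simp add: yB_eq_t[OF that] mult_ac)
  qed
  define X where "X u = l u ^ Suc k * t k u" for u
  have sT: "smooth_on S X"
    unfolding X_def[abs_def] by (intro smooth_on_mult smooth_power_l smooth_t S_open)
  have "(\<Sum>i\<in>UNIV. y $ i * pd i X y) = real 3 * X y"
  proof (rule Euler_homogeneous[OF differentiable_S[OF sT y]])
    fix r :: real assume r: "r > 0"
    show "X (r *\<^sub>R y) = r ^ 3 * X y"
      unfolding X_def T[OF y, symmetric] T[OF S_cone[OF y r], symmetric]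
      by (simp add: yl_hom[OF y r] P_hom[OF y r] sum_distrib_left power2_eq_square power3_eq_cube mult_ac)
  qed
  then have 1: "l y * (\<Sum>i\<in>UNIV. y $ i * pd i X y) = 3 * (l y * l y ^ Suc k) * t k y"
    by (simp add: X_def)
  have "l y * pd i X y =
      l y * l y ^ Suc k * pd i (t k) y + 2 * real (Suc k) * yl i y * l y ^ Suc k * t k y" for i
  proof -
    have "pd i X y =
        l y ^ Suc k * pd i (t k) y + pd i (\<lambda>u. l u ^ Suc k) y * t k y"
      unfolding X_def[abs_def] by (rule pd_mult) (intro differentiable_S[OF _ y] smooth_power_l smooth_t)+
    then have "l y * pd i X y =
        l y * l y ^ Suc k * pd i (t k) y + (l y * pd i (\<lambda>u. l u ^ Suc k) y) * t k y"
      by (simp add: algebra_simps)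
    then show ?thesis unfolding pd_power_l[OF y] by (simp add: algebra_simps)
  qed
  then have "l y * (\<Sum>i\<in>UNIV. y $ i * pd i X y) =
      (\<Sum>i\<in>UNIV. y $ i * (l y * l y ^ Suc k * pd i (t k) y
        + 2 * real (Suc k) * yl i y * l y ^ Suc k * t k y))"
    by (simp add: sum_distrib_left mult.left_commute[of "l y"] del: power_Suc of_nat_Suc)
  also have "\<dots> = l y * l y ^ Suc k * (\<Sum>i\<in>UNIV. y $ i * pd i (t k) y)
      + 2 * real (Suc k) * l y ^ Suc k * t k y * (\<Sum>i\<in>UNIV. yl i y * y $ i)"
    by (simp add: sum_distrib_left sum.distrib distrib_left mult_ac del: power_Suc of_nat_Suc)
  finally have sum: "3 * (l y * l y ^ Suc k) * t k y =
      l y * l y ^ Suc k * (\<Sum>i\<in>UNIV. y $ i * pd i (t k) y)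
      + 2 * real (Suc k) * l y ^ Suc k * t k y * l y"
    unfolding 1 Euler_l[OF y] .
  have "(l y * l y ^ Suc k) * (\<Sum>i\<in>UNIV. y $ i * pd i (t k) y) =
      (l y * l y ^ Suc k) * ((1 - 2 * real k) * t k y)"
  proof -
    have "a * b * \<sigma> = a * b * ((1 - 2 * \<kappa>) * \<tau>)"
      if "3 * (a * b) * \<tau> = a * b * \<sigma> + 2 * (1 + \<kappa>) * b * \<tau> * a" for a b \<kappa> \<sigma> \<tau> :: real
      using that by algebra
    then show ?thesis using sum by (simp only: of_nat_Suc)
  qed
  then show ?thesis using l_pos[OF y] by simp
qed

text \<open>If it were zero, \<open>(2k - 1)(2k + 1 - n) = 1\<close> would hold in the integers, whence \<open>k = 0\<close> or \<open>k = 1\<close>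
  and \<open>n = 2\<close> in either case.\<close>
lemma coefficient_nonzero: "4 * (real k)\<^sup>2 - 2 - n * (2 * real k - 1) \<noteq> 0"
proof
  assume "4 * (real k)\<^sup>2 - 2 - n * (2 * real k - 1) = 0"
  then have "real_of_int (4 * (int k)\<^sup>2 - 2 - int CARD('n) * (2 * int k - 1)) = real_of_int 0"
    by (simp add: dim(1))
  then have "4 * (int k)\<^sup>2 - 2 - int CARD('n) * (2 * int k - 1) = 0"
    by (simp only: of_int_eq_iff)
  then have 1: "(2 * int k - 1) * (2 * int k + 1 - int CARD('n)) = 1"
    by (simp add: algebra_simps power2_eq_square)
  then have "2 * int k - 1 = 1 \<or> 2 * int k - 1 = -1"
    using iffD1[OF zmult_eq_1_iff 1] by blast
  then show False using 1 dim(2) by auto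
qed

text \<open>The inductive step. Write \<open>\<equiv>\<close> for equality modulo \<open>l\<close> times a function that is smooth up to \<open>z\<close>.
  One of the two equations shows \<open>y\<^sub>aB\<^sup>a \<equiv> 0\<close>, so \<open>t\<close> is smooth up to \<open>z\<close>. After division by
  \<open>l\<close> the gradient equation says that the lowered \<open>B\<close> is \<open>\<equiv> \<mu> y\<^sub>b\<close>, that is, \<open>B \<equiv> \<mu> y\<close>, and since
  \<open>C\<^sub>ay\<^sup>a = 0\<close> the factor is \<open>\<mu> \<equiv> (2 - 2k) t\<close>. Inserting this in the divergence equation divided
  by \<open>l\<close> leaves a nonzero multiple of \<open>t\<close>, so \<open>t \<equiv> 0\<close> and \<open>B \<equiv> 0\<close>.\<close>
lemma extension_divisible_by_l:
  assumes F: "extends_near smooth_on S l z F" "invertible (fiber_metric F z)" "z \<noteq> 0"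
    and B: "\<And>a. smooth_up_to S z (B k a)"
  shows "smooth_up_to S z (B (Suc k) a)"
proof -
  note up = smooth_up_to_add smooth_up_to_mult smooth_up_to_diff smooth_up_to_sum smooth_up_to_const
    smooth_up_to_component smooth_up_to_pd[OF S_open]
  have u_l: "smooth_up_to S z l" using F(1) unfolding smooth_up_to_def by blast
  have u_g: "smooth_up_to S z (g i j)" for i j
    unfolding g_def[abs_def] fiber_metric_def vec_lambda_beta by (intro up u_l)
  have u_gi: "smooth_up_to S z (gi i j)" for i j
    unfolding gi_def[abs_def] by (rule smooth_up_to_inverse_metric[OF S_open F(1,2)])
  have u_yl: "smooth_up_to S z (yl i)" for i unfolding yl_def[abs_def] by (intro up u_g)
  have u_C: "smooth_up_to S z (C i)" for i unfolding C_def[abs_def] by (intro up u_g u_gi)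
  have u_yB: "smooth_up_to S z (yB k)" unfolding yB_def[abs_def] by (intro up u_yl B)
  have u_CB: "smooth_up_to S z (CB k)" unfolding CB_def[abs_def] by (intro up u_C B)
  have u_divB: "smooth_up_to S z (divB k)" unfolding divB_def[abs_def] by (intro up B)
  have u_Q: "smooth_up_to S z (Q k b)" for b unfolding Q_def[abs_def] by (intro up u_C u_CB B)
  have solve: "x = 1 / c * r" if "c * x = r" "c \<noteq> 0" for x c r :: real
    using that by auto
  \<comment> \<open>The divergence equation determines \<open>y\<^sub>aB\<^sup>a\<close> modulo \<open>l\<close> unless \<open>2k = n + 2\<close>; in that case \<open>k \<noteq> 2\<close>,
    and the gradient equation does so in a direction \<open>b\<close> with \<open>y\<^sub>b \<noteq> 0\<close> at \<open>z\<close>.\<close>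
  have u_t: "smooth_up_to S z (t k)"
  proof (cases "n + 2 - 2 * real k = 0")
    case False
    have "smooth_up_to S z (\<lambda>y. 1 / (n + 2 - 2 * real k) * (divB k y + 2 * CB k y))"
      by (intro up u_divB u_CB)
    then show ?thesis
    proof (rule smooth_up_to_cong)
      fix y assume y: "y \<in> S"
      have "l y * ((n + 2 - 2 * real k) * t k y) = l y * (divB k y + 2 * CB k y)"
        using divergence_equation[OF y, of k] by (simp add: yB_eq_t[OF y] algebra_simps)
      then have "(n + 2 - 2 * real k) * t k y = divB k y + 2 * CB k y" using l_pos[OF y] by simp
      then show "1 / (n + 2 - 2 * real k) * (divB k y + 2 * CB k y) = t k y"
        by (rule solve[OF _ False, symmetric])
    qed
  next
    case True
    then have k2: "2 * real k - 4 \<noteq> 0" "n + 2 \<noteq> 0" using dim by auto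
    obtain W where W: "open W" "z \<in> W" "smooth_on W F" "\<And>u. u \<in> W \<Longrightarrow> u \<in> S \<Longrightarrow> F u = l u"
      using F(1) unfolding extends_near_def by auto
    have "fiber_metric F z *v z \<noteq> 0"
      using F(2,3) inj_matrix_vector_mult[OF F(2)] by (metis injD matrix_vector_mult_0_right)
    then obtain b where b: "(fiber_metric F z *v z) $ b \<noteq> 0" by (metis vec_eq_iff zero_index)
    let ?Y = "\<lambda>u. \<Sum>a\<in>UNIV. fiber_metric F u $ b $ a * u $ a"
    have "smooth_on W ?Y"
      by (intro smooth_on_sum smooth_on_mult smooth_on_component smooth_on_fiber_metric W)
    moreover have "?Y u = yl b u" if "u \<in> W" "u \<in> S" for u
    proof -
      have "fiber_metric F u = fiber_metric l u"
        by (rule fiber_metric_cong_open[of "W \<inter> S"]) (use that W S_open in auto)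
      then show ?thesis by (simp add: yl_def g_def)
    qed
    ultimately have Y: "extends_near smooth_on S (yl b) z ?Y"
      unfolding extends_near_def using W by (intro exI[of _ W]) auto
    have "?Y z \<noteq> 0" using b by (simp add: matrix_vector_mult_def)
    moreover have "smooth_up_to S z (\<lambda>y. 1 / ((n + 2) * (2 * real k - 4)) *
        (4 * real k * yl b y * CB k y + l y * Q k b y
          - (n + 2) * (pd b (yB k) y + (\<Sum>a\<in>UNIV. g a b y * B k a y))))"
      by (intro up u_yl u_CB u_l u_Q u_yB u_g B)
    ultimately show ?thesis
    proof (rule smooth_up_to_quotient[OF Y])
      fix y assume y: "y \<in> S"
      let ?R = "4 * real k * yl b y * CB k y + l y * Q k b y
          - (n + 2) * (pd b (yB k) y + (\<Sum>a\<in>UNIV. g a b y * B k a y))"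
      have "l y * (((n + 2) * (2 * real k - 4)) * (yl b y * t k y)) = l y * ?R"
        using gradient_equation[OF y, of b k]
        unfolding yB_eq_t[OF y] by (simp add: algebra_simps power2_eq_square)
      then have "((n + 2) * (2 * real k - 4)) * (yl b y * t k y) = ?R" using l_pos[OF y] by simp
      then show "yl b y * t k y = 1 / ((n + 2) * (2 * real k - 4)) * ?R"
        by (rule solve) (use k2 in simp)
    qed
  qed
  \<comment> \<open>\<open>R\<close>, \<open>Z\<close> and \<open>Z'\<close> are the successive remainders: of the lowered \<open>B\<close> modulo \<open>\<mu> y\<^sub>b\<close>, of \<open>B\<close> modulo
    \<open>\<mu> y\<^sup>a\<close>, and of \<open>B\<close> modulo \<open>(2 - 2k) t y\<^sup>a\<close>, each divided by \<open>l\<close>.\<close>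
  define R where "R b y = 1 / (n + 2) * Q k b y - pd b (t k) y" for b y
  define Z where "Z a y = (\<Sum>b\<in>UNIV. R b y * gi b a y)" for a y
  define \<zeta> where "\<zeta> y = (\<Sum>a\<in>UNIV. C a y * Z a y)" for y
  define Z' where "Z' a y = Z a y + 4 * real k / (n + 2) * \<zeta> y * y $ a" for a y
  have u_Z': "smooth_up_to S z (Z' a)" for a
    unfolding Z'_def[abs_def] \<zeta>_def Z_def R_def by (intro up u_Q u_t u_gi u_C)
  note sm = smooth_on_add smooth_on_diff smooth_on_mult smooth_on_sum smooth_on_const smooth_on_component
    smooth_on_pd S_open
  have s_Q: "smooth_on S (Q k b)" for b
    unfolding Q_def[abs_def]
    by (intro sm smooth_C smooth_CB smooth_B)
  have s_Z': "smooth_on S (Z' a)" for a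
    unfolding Z'_def[abs_def] \<zeta>_def Z_def R_def
    by (intro sm s_Q smooth_t smooth_gi smooth_C)
  define K where "K = 2 - 2 * real k"
  have n2: "n + 2 \<noteq> 0" using dim by simp
  have B_eq: "B k a y = K * t k y * y $ a + l y * Z' a y" if y: "y \<in> S" for a y
  proof -
    define \<mu> where "\<mu> = 4 * real k / (n + 2) * CB k y + K * t k y"
    have low: "(\<Sum>c\<in>UNIV. g c b y * B k c y) = \<mu> * yl b y + l y * R b y" for b
    proof -
      have "l y * ((n + 2) * (\<Sum>c\<in>UNIV. g c b y * B k c y)) =
          l y * ((n + 2) * K * t k y * yl b y + 4 * real k * CB k y * yl b y
            + l y * (Q k b y - (n + 2) * pd b (t k) y))"
        using gradient_equation[OF y, of b k] unfolding pd_yB_t[OF y] yB_eq_t[OF y] K_def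
        by (simp add: algebra_simps power2_eq_square)
      then have "(n + 2) * (\<Sum>c\<in>UNIV. g c b y * B k c y) =
          (n + 2) * K * t k y * yl b y + 4 * real k * CB k y * yl b y
            + l y * (Q k b y - (n + 2) * pd b (t k) y)" using l_pos[OF y] by simp
      also have "\<dots> = (n + 2) * (\<mu> * yl b y + l y * R b y)"
      proof -
        have "N * K * \<tau> * w + 4 * \<nu> * c * w + m * (q - N * p) =
            N * ((4 * \<nu> / N * c + K * \<tau>) * w + m * (1 / N * q - p))"
          if "N \<noteq> 0" for N \<tau> w \<nu> c m q p :: real
          using that by (simp add: field_simps)
        from this[OF n2] show ?thesis unfolding R_def \<mu>_def by simp
      qed
      finally show ?thesis using n2 by simp
    qed
    have raised: "B k a y = \<mu> * y $ a + l y * Z a y" for a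
    proof -
      have "B k a y = (\<Sum>b\<in>UNIV. (\<mu> * yl b y + l y * R b y) * gi b a y)"
        using raise_lower[OF y, of "\<lambda>c. B k c y" a] unfolding low by simp
      also have "\<dots> = \<mu> * (\<Sum>b\<in>UNIV. yl b y * gi b a y) + l y * Z a y"
        by (simp add: Z_def sum_distrib_left sum.distrib distrib_right mult.assoc)
      also have "(\<Sum>b\<in>UNIV. yl b y * gi b a y) = y $ a"
        using raise_lower[OF y, of "\<lambda>c. y $ c" a] unfolding g_y[OF y] by simp
      finally show ?thesis .
    qed
    have "CB k y = \<mu> * (\<Sum>a\<in>UNIV. C a y * y $ a) + l y * \<zeta> y"
      unfolding CB_def \<zeta>_def raised
      by (simp add: sum_distrib_left sum.distrib distrib_left mult_ac)
    then have "CB k y = l y * \<zeta> y" by (simp add: C_y[OF y])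
    then show ?thesis unfolding raised[of a] \<mu>_def Z'_def by (simp add: algebra_simps)
  qed
  have ylZ: "(\<Sum>a\<in>UNIV. yl a y * Z' a y) = (1 - K) * t k y" if y: "y \<in> S" for y
  proof -
    have "yB k y = K * t k y * (\<Sum>a\<in>UNIV. yl a y * y $ a) + l y * (\<Sum>a\<in>UNIV. yl a y * Z' a y)"
      unfolding yB_def B_eq[OF y] by (simp add: sum_distrib_left sum.distrib distrib_left mult_ac)
    then have "l y * (\<Sum>a\<in>UNIV. yl a y * Z' a y) = l y * ((1 - K) * t k y)"
      unfolding Euler_l[OF y] yB_eq_t[OF y] by (simp add: algebra_simps)
    then show ?thesis using l_pos[OF y] by simp
  qed
  have CBZ: "CB k y = l y * (\<Sum>a\<in>UNIV. C a y * Z' a y)" if y: "y \<in> S" for y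
  proof -
    have "CB k y = K * t k y * (\<Sum>a\<in>UNIV. C a y * y $ a) + l y * (\<Sum>a\<in>UNIV. C a y * Z' a y)"
      unfolding CB_def B_eq[OF y] by (simp add: sum_distrib_left sum.distrib distrib_left mult_ac)
    then show ?thesis by (simp add: C_y[OF y])
  qed
  have divBZ: "divB k y = K * (1 - 2 * real k + n) * t k y + 2 * (1 - K) * t k y
      + l y * (\<Sum>a\<in>UNIV. pd a (Z' a) y)" if y: "y \<in> S" for y
  proof -
    have "pd a (B k a) y = K * (y $ a * pd a (t k) y + t k y) +
        (2 * (yl a y * Z' a y) + l y * pd a (Z' a) y)" for a
    proof -
      have "pd a (B k a) y = pd a (\<lambda>u. K * t k u * u $ a + l u * Z' a u) y"
        by (rule pd_cong_open[OF S_open y]) (rule B_eq)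
      also have "\<dots> = pd a (\<lambda>u. K * t k u * u $ a) y + pd a (\<lambda>u. l u * Z' a u) y"
        by (rule pd_add) (intro differentiable_S[OF _ y] sm smooth_t l_smooth s_Z')+
      also have "pd a (\<lambda>u. K * t k u * u $ a) y = K * t k y * pd a (\<lambda>u. u $ a) y
          + pd a (\<lambda>u. K * t k u) y * y $ a"
        by (rule pd_mult) (intro differentiable_S[OF _ y] sm smooth_t)+
      also have "pd a (\<lambda>u. K * t k u) y = K * pd a (t k) y"
        by (rule pd_cmult) (intro differentiable_S[OF _ y] smooth_t)
      also have "pd a (\<lambda>u. l u * Z' a u) y = l y * pd a (Z' a) y + pd a l y * Z' a y"
        by (rule pd_mult) (intro differentiable_S[OF _ y] l_smooth s_Z')+
      finally show ?thesis by (simp add: pd_component pd_l[OF y] algebra_simps)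
    qed
    then have "divB k y = K * ((\<Sum>a\<in>UNIV. y $ a * pd a (t k) y) + n * t k y)
        + (2 * (\<Sum>a\<in>UNIV. yl a y * Z' a y) + l y * (\<Sum>a\<in>UNIV. pd a (Z' a) y))"
      by (simp add: divB_def sum.distrib sum_distrib_left[symmetric] dim(1))
    then show ?thesis unfolding Euler_t[OF y] ylZ[OF y] by (simp add: algebra_simps)
  qed
  define \<kappa> where "\<kappa> = 4 * (real k)\<^sup>2 - 2 - n * (2 * real k - 1)"
  have \<kappa>: "\<kappa> \<noteq> 0" unfolding \<kappa>_def by (rule coefficient_nonzero)
  have t_eq: "t k y / l y = -1 / \<kappa> * ((\<Sum>a\<in>UNIV. pd a (Z' a) y) + 2 * (\<Sum>a\<in>UNIV. C a y * Z' a y))"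
    if y: "y \<in> S" for y
  proof -
    have "l y * (divB k y + 2 * CB k y) = l y * ((n + 2 - 2 * real k) * t k y)"
      using divergence_equation[OF y, of k] unfolding yB_eq_t[OF y] by (simp add: algebra_simps)
    then have "divB k y + 2 * CB k y = (n + 2 - 2 * real k) * t k y" using l_pos[OF y] by simp
    then have "\<kappa> * t k y = - l y * ((\<Sum>a\<in>UNIV. pd a (Z' a) y) + 2 * (\<Sum>a\<in>UNIV. C a y * Z' a y))"
      unfolding divBZ[OF y] CBZ[OF y] \<kappa>_def K_def by (simp add: algebra_simps power2_eq_square)
    then show ?thesis using \<kappa> l_pos[OF y] by (simp add: field_simps)
  qed
  have "smooth_up_to S z (\<lambda>y. K * (-1 / \<kappa> * ((\<Sum>a\<in>UNIV. pd a (Z' a) y)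
      + 2 * (\<Sum>a\<in>UNIV. C a y * Z' a y))) * y $ a + Z' a y)"
    by (intro up u_Z' u_C)
  then show ?thesis
  proof (rule smooth_up_to_cong)
    fix y assume y: "y \<in> S"
    have "B (Suc k) a y = B k a y / l y" using l_pos[OF y] by (simp add: B_def)
    also have "\<dots> = K * (t k y / l y) * y $ a + Z' a y"
      unfolding B_eq[OF y] using l_pos[OF y] by (simp add: field_simps)
    finally show "K * (-1 / \<kappa> * ((\<Sum>a\<in>UNIV. pd a (Z' a) y)
      + 2 * (\<Sum>a\<in>UNIV. C a y * Z' a y))) * y $ a + Z' a y = B (Suc k) a y"
      unfolding t_eq[OF y] by simp
  qed
qed

end

section \<open>Uniqueness in one tangent space\<close>

text \<open>The analytic counterpart of \<open>smooth_up_to\<close>.\<close>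
definition analytic_up_to :: "'a::euclidean_space set \<Rightarrow> 'a \<Rightarrow> ('a \<Rightarrow> real) \<Rightarrow> bool" where
  "analytic_up_to S z f \<longleftrightarrow>
     (\<exists>W F. open W \<and> z \<in> W \<and> analytic_along_lines F z \<and> (\<forall>u\<in>W \<inter> S. F u = f u))"

lemma analytic_up_to_interior:
  assumes "open S" "z \<in> S" "analytic_up_to S z f"
  shows "analytic_along_lines f z"
proof -
  obtain W F where W: "open W" "z \<in> W" "analytic_along_lines F z" "\<forall>u\<in>W \<inter> S. F u = f u"
    using assms(3) unfolding analytic_up_to_def by blast
  obtain e where e: "e > 0" "ball z e \<subseteq> W \<inter> S"
    using open_contains_ball[of "W \<inter> S"] W assms by blast
  obtain r where r: "r > 0" and F:
    "\<And>h. norm h < r \<Longrightarrow> \<exists>c. \<forall>t. \<bar>t\<bar> \<le> 1 \<longrightarrow> (\<lambda>m. c m * t ^ m) sums F (z + t *\<^sub>R h)"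
    using W(3) unfolding analytic_along_lines_def by blast
  have "\<exists>c. \<forall>t. \<bar>t\<bar> \<le> 1 \<longrightarrow> (\<lambda>m. c m * t ^ m) sums f (z + t *\<^sub>R h)" if h: "norm h < min r e" for h
  proof -
    have "F (z + t *\<^sub>R h) = f (z + t *\<^sub>R h)" if "\<bar>t\<bar> \<le> 1" for t
    proof -
      have "\<bar>t\<bar> * norm h \<le> 1 * norm h" using that by (intro mult_right_mono) auto
      then have "z + t *\<^sub>R h \<in> ball z e" using h by (simp add: dist_norm)
      then show ?thesis using e(2) W(4) by blast
    qed
    then show ?thesis using F[of h] h by auto
  qed
  then show ?thesis unfolding analytic_along_lines_def using r e(1)
    by (intro exI[of _ "min r e"]) auto
qed

lemma second_derivative_at_minimum:
  fixes \<psi> \<psi>' :: "real \<Rightarrow> real"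
  assumes "e > 0" "\<And>s. \<bar>s\<bar> < e \<Longrightarrow> (\<psi> has_real_derivative \<psi>' s) (at s)"
    and "\<And>s. \<bar>s\<bar> < e \<Longrightarrow> \<psi> 0 \<le> \<psi> s" and "(\<psi>' has_real_derivative c) (at 0)"
  shows "c \<ge> 0"
proof (rule ccontr)
  assume "\<not> c \<ge> 0"
  then obtain d where d: "d > 0" "\<And>h. 0 < h \<Longrightarrow> h < d \<Longrightarrow> \<psi>' h < \<psi>' 0"
    using DERIV_neg_dec_right[OF assms(4)] by (auto simp: not_le)
  have "\<psi>' 0 = 0"
    by (rule DERIV_local_min[OF assms(2)[of 0] assms(1)]) (use assms in auto)
  define h where "h = min d e / 2"
  have h: "0 < h" "h < d" "h < e" unfolding h_def using d(1) assms(1) by auto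
  have "\<exists>s. 0 < s \<and> s < h \<and> \<psi> h - \<psi> 0 = (h - 0) * \<psi>' s"
    using h by (intro MVT2) (auto intro: assms(2))
  then obtain s where s: "0 < s" "s < h" "\<psi> h - \<psi> 0 = h * \<psi>' s" by auto
  have "\<psi>' s < 0" using d(2)[of s] s h \<open>\<psi>' 0 = 0\<close> by simp
  then have "h * \<psi>' s < 0" using h(1) by (simp add: mult_pos_neg)
  then show False using s(3) assms(3)[of h] h by simp
qed

context fiber_solution_difference
begin

text \<open>Otherwise \<open>S\<close> is open and closed in the punctured space, hence equal to it. Let \<open>e\<close> minimise \<open>l\<close> on
  the unit sphere. Then \<open>l - l(e)\<bar>y\<bar>\<^sup>2\<close> is nonnegative with a zero at \<open>e\<close>, and its second
  derivative at \<open>e\<close> would be negative in a direction \<open>v\<close> with \<open>g(v, v) < 0\<close>.\<close>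
lemma cone_has_boundary:
  assumes "S \<noteq> {}" "0 \<notin> S"
    and indef: "\<And>y. y \<in> S \<Longrightarrow> \<exists>u. u \<bullet> (fiber_metric l y *v u) < 0"
  obtains z where "z \<in> closure S" "z \<noteq> 0" "z \<notin> S"
proof -
  have False if "closure S - S \<subseteq> {0}"
  proof -
    have "S = (- {0}) \<inter> closure S" using that assms(2) closure_subset[of S] by blast
    then have "closedin (top_of_set (- {0})) S" unfolding closedin_closed using closed_closure by blast
    moreover have "openin (top_of_set (- {0})) S"
      unfolding openin_open using S_open assms(2) by (intro exI[of _ S]) auto
    moreover have "connected (- {0 :: real ^ 'n})"
      by (rule connected_punctured_universe) (use dim in simp)
    ultimately have S: "S = - {0}" using assms(1) unfolding connected_clopen by blast
    have "continuous_on (sphere 0 1) l"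
      by (rule continuous_on_subset[OF smooth_on_continuous[OF l_smooth]]) (auto simp: S)
    moreover have "sphere (0 :: real ^ 'n) 1 \<noteq> {}" by simp
    ultimately obtain e where e: "e \<in> sphere 0 1" "\<And>u. u \<in> sphere 0 1 \<Longrightarrow> l e \<le> l u"
      using continuous_attains_inf[of "sphere (0 :: real ^ 'n) 1" l] compact_sphere by blast
    have eS: "e \<in> S" using e(1) by (auto simp: S)
    have low: "l e * (u \<bullet> u) \<le> l u" if "u \<in> S" for u
    proof -
      have u: "norm u > 0" using that S by simp
      let ?v = "(1 / norm u) *\<^sub>R u"
      have "l u = (norm u)\<^sup>2 * l ?v"
        using l_hom[of ?v "norm u"] u by (simp add: S)
      moreover have "l e \<le> l ?v" using u by (intro e(2)) simp
      ultimately show ?thesis using u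
        by (simp add: dot_square_norm mult.commute mult_left_mono)
    qed
    obtain v where v: "v \<bullet> (fiber_metric l e *v v) < 0" using indef[OF eS] by blast
    obtain d where d: "d > 0" "\<And>s. \<bar>s\<bar> < d \<Longrightarrow> e + s *\<^sub>R v \<in> S"
    proof -
      obtain r where r: "r > 0" "ball e r \<subseteq> S" using S_open eS open_contains_ball by blast
      have "e + s *\<^sub>R v \<in> S" if "\<bar>s\<bar> < r / (norm v + 1)" for s
      proof -
        have "\<bar>s\<bar> * norm v \<le> \<bar>s\<bar> * (norm v + 1)" by (simp add: mult_left_mono)
        also have "\<dots> < r" using that by (simp add: pos_less_divide_eq add_nonneg_pos)
        finally show ?thesis using r(2) by (auto simp: dist_norm)
      qed
      moreover have "r / (norm v + 1) > 0" using r by (simp add: add_nonneg_pos)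
      ultimately show ?thesis using that by blast
    qed
    \<comment> \<open>The restriction of \<open>l - l(e)\<bar>y\<bar>\<^sup>2\<close> to the line through \<open>e\<close> in direction \<open>v\<close>, and its derivative.\<close>
    define \<psi> where "\<psi> s = l (e + s *\<^sub>R v) - l e * ((e + s *\<^sub>R v) \<bullet> (e + s *\<^sub>R v))" for s
    define \<psi>' where "\<psi>' s = (\<Sum>i\<in>UNIV. v $ i * pd i l (e + s *\<^sub>R v)) - l e * (2 * (v \<bullet> (e + s *\<^sub>R v)))" for s
    have "(\<psi> has_real_derivative \<psi>' s) (at s)" if "\<bar>s\<bar> < d" for s
    proof -
      have df: "l differentiable (at (e + s *\<^sub>R v))" by (rule differentiable_S[OF l_smooth d(2)[OF that]])
      have "((\<lambda>s. (e + s *\<^sub>R v) \<bullet> (e + s *\<^sub>R v)) has_real_derivative 2 * (v \<bullet> (e + s *\<^sub>R v))) (at s)"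
        by (simp add: inner_add_left inner_add_right inner_commute)
          (auto intro!: derivative_eq_intros simp: algebra_simps inner_commute)
      then show ?thesis unfolding \<psi>_def[abs_def] \<psi>'_def
          frechet_derivative_eq_sum_pd[OF df, symmetric]
        by (intro DERIV_diff DERIV_along_line df DERIV_cmult)
    qed
    moreover have "\<psi> 0 \<le> \<psi> s" if "\<bar>s\<bar> < d" for s
      using low[OF d(2)[OF that]] e(1) by (simp add: \<psi>_def dot_square_norm)
    moreover have "(\<psi>' has_real_derivative
        (\<Sum>i\<in>UNIV. v $ i * (\<Sum>j\<in>UNIV. v $ j * pd j (pd i l) e)) - l e * (2 * (v \<bullet> v))) (at 0)"
    proof -
      have df: "pd i l differentiable (at e)" for i
        by (rule differentiable_S[OF smooth_on_pd[OF l_smooth] eS])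
      have "((\<lambda>s. pd i l (e + s *\<^sub>R v)) has_real_derivative (\<Sum>j\<in>UNIV. v $ j * pd j (pd i l) e)) (at 0)" for i
        using DERIV_along_line[of "pd i l" e 0 v] df[of i] by (simp add: frechet_derivative_eq_sum_pd)
      then have 1: "((\<lambda>s. \<Sum>i\<in>UNIV. v $ i * pd i l (e + s *\<^sub>R v)) has_real_derivative
          (\<Sum>i\<in>UNIV. v $ i * (\<Sum>j\<in>UNIV. v $ j * pd j (pd i l) e))) (at 0)"
        by (intro DERIV_sum DERIV_cmult)
      have 2: "((\<lambda>s. l e * (2 * (v \<bullet> (e + s *\<^sub>R v)))) has_real_derivative l e * (2 * (v \<bullet> v))) (at 0)"
        by (auto intro!: derivative_eq_intros simp: inner_add_right)
      show ?thesis unfolding \<psi>'_def[abs_def] by (rule DERIV_diff[OF 1 2])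
    qed
    ultimately have "0 \<le> (\<Sum>i\<in>UNIV. v $ i * (\<Sum>j\<in>UNIV. v $ j * pd j (pd i l) e)) - l e * (2 * (v \<bullet> v))"
      by (rule second_derivative_at_minimum[OF d(1)])
    also have "(\<Sum>i\<in>UNIV. v $ i * (\<Sum>j\<in>UNIV. v $ j * pd j (pd i l) e)) = 2 * (v \<bullet> (fiber_metric l e *v v))"
      by (simp add: inner_vec_def matrix_vector_mult_def fiber_metric_def sum_distrib_left
          mult.commute mult.left_commute)
    finally have "l e * (2 * (v \<bullet> v)) < 0" using v by linarith
    moreover have "l e * (2 * (v \<bullet> v)) \<ge> 0" using l_pos[OF eS] by simp
    ultimately show False by linarith
  qed
  then show ?thesis using that by blast
qed

text \<open>As \<open>D = \<partial>P\<close>, one power of \<open>l\<close> is lost; hence \<open>P\<close> is divided by \<open>l\<^sup>k\<^sup>+\<^sup>1\<close>.\<close>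
lemma difference_flat_at_boundary:
  assumes F: "extends_near smooth_on S l z F" "invertible (fiber_metric F z)" "z \<noteq> 0"
    and D_up: "\<And>k i. smooth_up_to S z (D k i)"
  obtains G where "smooth_up_to S z G" "\<And>y. y \<in> S \<Longrightarrow> D a b y = l y ^ k * G y"
proof -
  have P_up: "smooth_up_to S z (P a)" for a
    unfolding P_def[abs_def]
    by (intro smooth_up_to_cmult smooth_up_to_sum smooth_up_to_mult smooth_up_to_component D_up)
  have B_up: "smooth_up_to S z (B k a)" for k a
  proof (induction k arbitrary: a)
    case 0
    show ?case by (rule smooth_up_to_cong[OF P_up[of a]]) (simp add: B_def)
  next
    case (Suc k)
    then show ?case by (rule extension_divisible_by_l[OF F])
  qed
  have l_up: "smooth_up_to S z l" using F(1) unfolding smooth_up_to_def by blast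
  have "smooth_up_to S z (\<lambda>y. l y * pd b (B (Suc k) a) y + real (Suc k) * pd b l y * B (Suc k) a y)"
    by (intro smooth_up_to_add smooth_up_to_mult smooth_up_to_const smooth_up_to_pd S_open l_up B_up)
  moreover have "D a b y = l y ^ k * (l y * pd b (B (Suc k) a) y + real (Suc k) * pd b l y * B (Suc k) a y)"
    if y: "y \<in> S" for y
  proof -
    have "l y * D a b y =
        l y * (l y ^ k * (l y * pd b (B (Suc k) a) y + real (Suc k) * pd b l y * B (Suc k) a y))"
      unfolding D_eq_B[OF y, of a b "Suc k"] pd_l[OF y] by (simp add: algebra_simps)
    then show ?thesis using l_pos[OF y] by (metis less_irrefl mult_cancel_left)
  qed
  ultimately show ?thesis using that by blast
qed

text \<open>Flatness is known only along segments that stay in \<open>S\<close>. Choosing \<open>z\<close> on the boundary of a ball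
  inside \<open>S\<close> provides an open set of such segments: the half-open segment from \<open>z\<close> to a point
  of an open ball lies in the ball by convexity.\<close>
lemma difference_zero_near_touching_ball:
  assumes ball: "ball c \<rho> \<subseteq> S" "\<rho> > 0" "dist c z = \<rho>"
    and F: "extends_near smooth_on S l z F" "F z = 0" "invertible (fiber_metric F z)" "z \<noteq> 0"
    and D_up: "\<And>k i. smooth_up_to S z (D k i)"
    and D_analytic: "analytic_up_to S z (D a b)"
  obtains U where "open U" "U \<noteq> {}" "U \<subseteq> S" "\<And>u. u \<in> U \<Longrightarrow> D a b u = 0"
proof -
  obtain W E where W: "open W" "z \<in> W" "analytic_along_lines E z" "\<forall>u\<in>W \<inter> S. E u = D a b u"
    using D_analytic unfolding analytic_up_to_def by blast
  obtain e where e: "e > 0" "ball z e \<subseteq> W" using open_contains_ball W by blast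
  obtain r where r: "r > 0" and E:
    "\<And>h. norm h < r \<Longrightarrow> \<exists>c. \<forall>t. \<bar>t\<bar> \<le> 1 \<longrightarrow> (\<lambda>m. c m * t ^ m) sums E (z + t *\<^sub>R h)"
    using W(3) unfolding analytic_along_lines_def by blast
  define U where "U = ball c \<rho> \<inter> ball z (min r e)"
  obtain K d where d: "d > 0" and K: "\<And>u. u \<in> S \<Longrightarrow> dist z u < d \<Longrightarrow> \<bar>l u\<bar> \<le> K * dist z u"
    using smooth_vanishing_Lipschitz[OF F(1,2)] by blast
  have "D a b u = 0" if u: "u \<in> U" for u
  proof -
    define h where "h = u - z"
    have h: "norm h < r" "norm h < e" using u by (auto simp: U_def h_def dist_norm norm_minus_commute)
    have seg: "z + t *\<^sub>R h \<in> S" "z + t *\<^sub>R h \<in> W" if t: "0 < t" "t \<le> 1" for t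
    proof -
      have "c - (z + t *\<^sub>R h) = (1 - t) *\<^sub>R (c - z) + t *\<^sub>R (c - u)"
        by (simp add: h_def algebra_simps)
      then have "dist c (z + t *\<^sub>R h) \<le> (1 - t) * dist c z + t * dist c u"
        using t norm_triangle_ineq[of "(1 - t) *\<^sub>R (c - z)" "t *\<^sub>R (c - u)"] by (simp add: dist_norm)
      also have "\<dots> < (1 - t) * \<rho> + t * \<rho>" using t u ball(3) by (simp add: U_def)
      finally have "dist c (z + t *\<^sub>R h) < \<rho>" by (simp add: algebra_simps)
      then show "z + t *\<^sub>R h \<in> S" using ball(1) by auto
      have "t * norm h \<le> 1 * norm h" using t by (intro mult_right_mono) auto
      then have "z + t *\<^sub>R h \<in> ball z e" using h(2) t by (simp add: dist_norm)
      then show "z + t *\<^sub>R h \<in> W" using e(2) by blast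
    qed
    obtain cc where sums: "\<And>t. \<bar>t\<bar> \<le> 1 \<Longrightarrow> (\<lambda>m. cc m * t ^ m) sums E (z + t *\<^sub>R h)"
      using E[OF h(1)] by blast
    have "\<exists>C. \<exists>\<delta>>0. \<forall>t. 0 < t \<and> t < \<delta> \<longrightarrow> \<bar>E (z + t *\<^sub>R h)\<bar> \<le> C * t ^ k" for k
    proof -
      obtain G where G: "smooth_up_to S z G" "\<And>y. y \<in> S \<Longrightarrow> D a b y = l y ^ k * G y"
        using difference_flat_at_boundary[OF F(1,3,4) D_up] by blast
      obtain C d' where d': "d' > 0" and C: "\<And>u. u \<in> S \<Longrightarrow> dist z u < d' \<Longrightarrow> \<bar>G u\<bar> \<le> C"
        using smooth_up_to_bounded[OF G(1)] by blast
      define \<delta> where "\<delta> = min 1 (min d d' / (norm h + 1))"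
      have "\<delta> > 0" unfolding \<delta>_def using d d' by (simp add: add_nonneg_pos)
      moreover have "\<bar>E (z + t *\<^sub>R h)\<bar> \<le> ((K * norm h) ^ k * C) * t ^ k" if t: "0 < t" "t < \<delta>" for t
      proof -
        let ?u = "z + t *\<^sub>R h"
        have t1: "t \<le> 1" using t unfolding \<delta>_def by simp
        have "t * norm h \<le> t * (norm h + 1)" using t by simp
        also have "\<dots> < min d d'"
          using t unfolding \<delta>_def by (simp add: pos_less_divide_eq add_nonneg_pos)
        finally have "dist z ?u < d" "dist z ?u < d'" using t by (simp_all add: dist_norm)
        moreover have "dist z ?u = t * norm h" using t by (simp add: dist_norm)
        ultimately have b: "\<bar>l ?u\<bar> \<le> K * norm h * t" "\<bar>G ?u\<bar> \<le> C"
          using K[OF seg(1)[OF t(1) t1]] C[OF seg(1)[OF t(1) t1]] by (simp_all add: mult_ac)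
        have "\<bar>E ?u\<bar> = \<bar>l ?u\<bar> ^ k * \<bar>G ?u\<bar>"
          using W(4) seg[OF t(1) t1] G(2) by (simp add: abs_mult power_abs)
        also have "\<dots> \<le> (K * norm h * t) ^ k * C"
          by (intro mult_mono power_mono b) (use b(1) abs_ge_zero order_trans in \<open>auto intro!: zero_le_power\<close>)
        finally show ?thesis by (simp add: power_mult_distrib mult_ac)
      qed
      ultimately show ?thesis by blast
    qed
    from powser_flat_imp_zero[of cc "\<lambda>t. E (z + t *\<^sub>R h)", OF sums this, of 1]
    have "E (z + 1 *\<^sub>R h) = 0" by simp
    then show ?thesis using W(4) seg[of 1] by (simp add: h_def)
  qed
  moreover have "U \<noteq> {}"
  proof -
    have "z \<in> closure (ball c \<rho>)" using ball(2,3) by simp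
    then obtain y where "y \<in> ball c \<rho>" "dist y z < min r e"
      using r e(1) unfolding closure_approachable by (meson min_less_iff_conj)
    then show ?thesis by (auto simp: U_def dist_commute)
  qed
  moreover have "open U" "U \<subseteq> S" unfolding U_def using ball(1) by auto
  ultimately show ?thesis using that by blast
qed

text \<open>A touching ball is obtained from a nonzero boundary point \<open>z'\<close>: take a point \<open>c\<close> of \<open>S\<close> close to \<open>z'\<close>
  and the point \<open>z\<close> of the complement of \<open>S\<close> that is nearest to \<open>c\<close>. The bound \<open>\<bar>z'\<bar>/3\<close>
  for the distance of \<open>c\<close> and \<open>z'\<close> keeps \<open>z\<close> away from the origin, where \<open>L\<close> need not extend.\<close>
theorem difference_vanishes:
  assumes "connected S" "0 \<notin> S"
    and indef: "\<And>y. y \<in> S \<Longrightarrow> \<exists>u. u \<bullet> (fiber_metric l y *v u) < 0"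
    and boundary: "\<And>z. z \<in> closure S \<Longrightarrow> z \<noteq> 0 \<Longrightarrow> z \<notin> S \<Longrightarrow>
      \<exists>F. extends_near smooth_on S l z F \<and> F z = 0 \<and> invertible (fiber_metric F z)"
    and D_up: "\<And>z k i. z \<in> closure S \<Longrightarrow> z \<noteq> 0 \<Longrightarrow> smooth_up_to S z (D k i)"
    and D_analytic: "\<And>z. z \<in> closure S \<Longrightarrow> z \<noteq> 0 \<Longrightarrow> analytic_up_to S z (D a b)"
    and y: "y \<in> S"
  shows "D a b y = 0"
proof -
  obtain z' where z': "z' \<in> closure S" "z' \<noteq> 0" "z' \<notin> S"
    using cone_has_boundary[OF _ assms(2) indef] y by blast
  obtain c where c: "c \<in> S" "dist c z' < norm z' / 3"
    using z'(1,2) unfolding closure_approachable by (meson divide_pos_pos zero_less_norm_iff zero_less_numeral)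
  have "closed (- S)" "- S \<noteq> {}" using S_open z'(3) by auto
  then obtain z where z: "z \<notin> S" "\<And>u. u \<notin> S \<Longrightarrow> dist c z \<le> dist c u"
    using distance_attains_inf[of "- S" c] by auto
  have ball: "ball c (dist c z) \<subseteq> S" using z(2) by force
  have pos: "dist c z > 0" using z(1) c(1) by auto
  have "dist c z < norm z' / 3" using z(2)[OF z'(3)] c(2) by simp
  moreover have "norm z' \<le> dist c z' + dist c z + norm z"
    using dist_triangle[of z' 0 c] dist_triangle[of c 0 z] by (simp add: dist_commute)
  moreover have "norm z' > 0" using z'(2) by simp
  ultimately have "norm z > 0" using c(2) by linarith
  then have z0: "z \<noteq> 0" by simp
  have "z \<in> closure (ball c (dist c z))" using pos by simp
  then have zc: "z \<in> closure S" using closure_mono[OF ball] by blast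
  obtain F where F: "extends_near smooth_on S l z F" "F z = 0" "invertible (fiber_metric F z)"
    using boundary[OF zc z0 z(1)] by blast
  obtain U where U: "open U" "U \<noteq> {}" "U \<subseteq> S" "\<And>u. u \<in> U \<Longrightarrow> D a b u = 0"
    using difference_zero_near_touching_ball[OF ball pos refl F z0 D_up[OF zc z0] D_analytic[OF zc z0]]
    by blast
  show ?thesis
  proof (rule smooth_identity_theorem[OF S_open assms(1) D_smooth _ U y])
    fix u assume u: "u \<in> S"
    then have "u \<in> closure S" "u \<noteq> 0" using closure_subset assms(2) by auto
    then show "analytic_along_lines (D a b) u"
      by (intro analytic_up_to_interior[OF S_open u] D_analytic)
  qed
qed

end

section \<open>Restriction to one tangent space\<close>

lemma open_vertical_slice: "open W \<Longrightarrow> open {y. (x, y) \<in> W}"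
  using open_vimage[of W "\<lambda>y. (x, y)"] by (simp add: vimage_def continuous_on_Pair)

text \<open>Functions of \<open>(x, y)\<close> are restricted to the vertical slice with fixed \<open>x\<close>. The lemmas
  below ask for openness of the slice, which is what openness of \<open>A\<close> in \<open>TM\<close> yields directly.\<close>
lemma has_derivative_slice:
  assumes "f differentiable (at (x, y))"
  shows "((\<lambda>u. f (x, u)) has_derivative (\<lambda>v. frechet_derivative f (at (x, y)) (0, v))) (at y)"
  by (rule has_derivative_compose[where f = "\<lambda>u. (x, u)" and f' = "\<lambda>v. (0, v)" and g = f])
    (use assms frechet_derivative_works in \<open>auto intro!: derivative_eq_intros\<close>)

lemma Ck_on_slice:
  assumes "open {y. (x, y) \<in> Z}" "Ck_on k Z f"
  shows "Ck_on k {y. (x, y) \<in> Z} (\<lambda>y. f (x, y))"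
  using assms(2)
proof (induction k arbitrary: f)
  case 0
  have "continuous_on {y. (x, y) \<in> Z} (\<lambda>y. (x, y))" by (intro continuous_intros)
  moreover have "(\<lambda>y. (x, y)) ` {y. (x, y) \<in> Z} \<subseteq> Z" by auto
  ultimately show ?case using 0 continuous_on_compose2[of Z f _ "\<lambda>y. (x, y)"] by simp
next
  case (Suc k)
  have D: "((\<lambda>u. f (x, u)) has_derivative (\<lambda>v. frechet_derivative f (at (x, y)) (0, v))) (at y)"
    if "(x, y) \<in> Z" for y
    using Suc.prems that by (intro has_derivative_slice) simp
  have d: "Ck_on k {y. (x, y) \<in> Z} (\<lambda>y. frechet_derivative f (at (x, y)) (0, v))" for v
    using Suc.prems by (intro Suc.IH) simp
  have "Ck_on k {y. (x, y) \<in> Z} (\<lambda>y. frechet_derivative (\<lambda>u. f (x, u)) (at y) v)" for v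
    by (rule Ck_on_cong[OF assms(1) _ d[of v]]) (simp add: frechet_derivative_at[OF D, symmetric])
  then show ?case using D by (auto simp: differentiable_def)
qed

lemma smooth_on_slice:
  "open {y. (x, y) \<in> Z} \<Longrightarrow> smooth_on Z f \<Longrightarrow> smooth_on {y. (x, y) \<in> Z} (\<lambda>y. f (x, y))"
  unfolding smooth_on_def using Ck_on_slice by blast

lemma yd_eq_pd_slice: "f differentiable (at (x, y)) \<Longrightarrow> yd i f (x, y) = pd i (\<lambda>u. f (x, u)) y"
  unfolding yd_def by (simp add: pd_eq[OF has_derivative_slice])

lemma smooth_on_yd: "smooth_on Z f \<Longrightarrow> smooth_on Z (yd i f)"
  unfolding yd_def[abs_def] by (rule smooth_on_derivative)

text \<open>Both sides involve derivatives in the fibre directions only.\<close>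
lemma gmat_eq_fiber_metric:
  assumes "open {y. (x, y) \<in> Z}" "smooth_on Z f" "(x, y) \<in> Z"
  shows "gmat f (x, y) = fiber_metric (\<lambda>u. f (x, u)) y"
proof -
  have "yd j (yd i f) (x, y) = pd j (pd i (\<lambda>u. f (x, u))) y" for i j
  proof -
    have "yd j (yd i f) (x, y) = pd j (\<lambda>u. yd i f (x, u)) y"
      by (rule yd_eq_pd_slice) (rule smooth_on_differentiable[OF smooth_on_yd[OF assms(2)] assms(3)])
    also have "\<dots> = pd j (pd i (\<lambda>u. f (x, u))) y"
      by (rule pd_cong_open[OF assms(1)])
        (use assms in \<open>auto intro!: yd_eq_pd_slice smooth_on_differentiable[OF assms(2)]\<close>)
    finally show ?thesis .
  qed
  then show ?thesis by (simp add: gmat_def fiber_metric_def)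
qed

lemma smooth_extension_slice:
  assumes "extends_near smooth_on Z f (x, y) F"
  shows "extends_near smooth_on {y. (x, y) \<in> Z} (\<lambda>u. f (x, u)) y (\<lambda>u. F (x, u))"
    "gmat F (x, y) = fiber_metric (\<lambda>u. F (x, u)) y"
proof -
  obtain W where W: "open W" "(x, y) \<in> W" "smooth_on W F" "\<forall>u\<in>W \<inter> Z. F u = f u"
    using assms unfolding extends_near_def by blast
  note o = open_vertical_slice[OF W(1), of x]
  show "extends_near smooth_on {y. (x, y) \<in> Z} (\<lambda>u. f (x, u)) y (\<lambda>u. F (x, u))"
    unfolding extends_near_def
    by (intro exI[of _ "{y. (x, y) \<in> W}"] conjI o smooth_on_slice[OF o W(3)]) (use W in auto)
  show "gmat F (x, y) = fiber_metric (\<lambda>u. F (x, u)) y"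
    by (rule gmat_eq_fiber_metric[OF o W(3,2)])
qed

lemma smooth_up_to_slice_component:
  fixes N :: "'n::finite tcoord \<Rightarrow> real ^ 'n ^ 'n"
  assumes "extends_near smooth_on Z N (x, y) F"
  shows "smooth_up_to {y. (x, y) \<in> Z} y (\<lambda>u. N (x, u) $ k $ i)"
proof -
  obtain W where W: "open W" "(x, y) \<in> W" "smooth_on W F" "\<forall>u\<in>W \<inter> Z. F u = N u"
    using assms unfolding extends_near_def by blast
  note o = open_vertical_slice[OF W(1), of x]
  have "bounded_linear (\<lambda>A :: real ^ 'n ^ 'n. A $ k $ i)"
    by (intro bounded_linear_compose[OF bounded_linear_vec_nth bounded_linear_vec_nth])
  then have "smooth_on W (\<lambda>u. F u $ k $ i)"
    by (rule smooth_on_compose_bounded_linear[OF W(1) _ W(3)])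
  note s = smooth_on_slice[OF o this]
  show ?thesis by (rule smooth_up_toI[OF o _ s]) (use W in auto)
qed

lemma analytic_up_to_slice_component:
  fixes N :: "'n::finite tcoord \<Rightarrow> real ^ 'n ^ 'n"
  assumes "extends_near real_analytic_on Z N (x, y) F"
  shows "analytic_up_to {y. (x, y) \<in> Z} y (\<lambda>u. N (x, u) $ k $ i)"
proof -
  obtain W where W: "open W" "(x, y) \<in> W" "real_analytic_on W F" "\<forall>u\<in>W \<inter> Z. F u = N u"
    using assms unfolding extends_near_def by blast
  have "bounded_linear (\<lambda>A :: real ^ 'n ^ 'n. A $ k $ i)"
    by (intro bounded_linear_compose[OF bounded_linear_vec_nth bounded_linear_vec_nth])
  then have "real_analytic_at (\<lambda>u. F u $ k $ i) (x, y)"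
    by (rule real_analytic_at_bounded_linear) (use W in \<open>simp add: real_analytic_on_def\<close>)
  then obtain r where r: "r > 0" and c:
    "\<And>h. norm h < r \<Longrightarrow> \<exists>c. \<forall>t. \<bar>t\<bar> \<le> 1 \<longrightarrow> (\<lambda>m. c m * t ^ m) sums (F ((x, y) + t *\<^sub>R h) $ k $ i)"
    by (rule real_analytic_at_line) blast
  have "\<exists>c. \<forall>t. \<bar>t\<bar> \<le> 1 \<longrightarrow> (\<lambda>m. c m * t ^ m) sums (F (x, y + t *\<^sub>R h) $ k $ i)" if "norm h < r" for h
    using c[of "(0, h)"] that by (simp add: norm_Pair)
  then have "analytic_along_lines (\<lambda>u. F (x, u) $ k $ i) y"
    unfolding analytic_along_lines_def using r by blast
  then show ?thesis unfolding analytic_up_to_def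
    by (intro exI[of _ "{y. (x, y) \<in> W}"] exI[of _ "\<lambda>u. F (x, u) $ k $ i"])
      (use W open_vertical_slice[OF W(1)] in auto)
qed

lemma analytic_up_to_minus:
  assumes "analytic_up_to S z f" "analytic_up_to S z g"
  shows "analytic_up_to S z (\<lambda>u. f u - g u)"
proof -
  obtain W F where W: "open W" "z \<in> W" "analytic_along_lines F z" "\<forall>u\<in>W \<inter> S. F u = f u"
    using assms(1) unfolding analytic_up_to_def by blast
  obtain V G where V: "open V" "z \<in> V" "analytic_along_lines G z" "\<forall>u\<in>V \<inter> S. G u = g u"
    using assms(2) unfolding analytic_up_to_def by blast
  show ?thesis unfolding analytic_up_to_def
    by (intro exI[of _ "W \<inter> V"] exI[of _ "\<lambda>u. F u - G u"] conjI analytic_along_lines_minus)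
      (use W V in auto)
qed

section \<open>Tangent vectors at a point\<close>

text \<open>The part \<open>q\<close> of degree at most one is a polynomial. With \<open>u\<close> the vector all of whose components are
  \<open>\<rho>\<close>, a monomial of degree at least two is at most \<open>(\<bar>h\<bar>/\<rho>)\<^sup>2\<close> times its absolute value at \<open>u\<close>, so
  the absolutely convergent series at \<open>u\<close> bounds the rest of the series by a multiple of \<open>\<bar>h\<bar>\<^sup>2\<close>.\<close>
lemma real_analytic_at_imp_differentiable_real:
  fixes f :: "'a::euclidean_space \<Rightarrow> real"
  assumes "real_analytic_at f x"
  shows "f differentiable (at x)"
proof -
  obtain r a where r: "r > 0" and
    a: "\<And>u. \<forall>e\<in>Basis. \<bar>u \<bullet> e\<bar> < r \<Longrightarrow>
      ((\<lambda>m. (\<Prod>e\<in>Basis. (u \<bullet> e) ^ m e) *\<^sub>R a m) has_sum f (x + u)) (Basis \<rightarrow>\<^sub>E UNIV)"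
    using assms unfolding real_analytic_at_def by metis
  let ?I = "Basis \<rightarrow>\<^sub>E UNIV :: ('a \<Rightarrow> nat) set"
  define J where "J = {m \<in> ?I. sum m Basis < 2}"
  define mono where "mono h m = (\<Prod>e\<in>Basis. (h \<bullet> e) ^ m e) * a m" for h m
  have finJ: "finite J"
  proof -
    have "J = (\<Union>j<2. {m \<in> ?I. sum m Basis = j})" by (auto simp: J_def)
    then show ?thesis by (simp add: finite_multiindices_of_degree)
  qed
  define q where "q h = (\<Sum>m\<in>J. mono h m)" for h
  have "smooth_on UNIV q"
    unfolding q_def[abs_def] mono_def
  proof (intro smooth_on_sum smooth_on_mult smooth_on_const smooth_on_prod open_UNIV)
    fix m :: "'a \<Rightarrow> nat" and e :: 'a
    have "smooth_on UNIV (\<lambda>h. h \<bullet> e)"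
      unfolding smooth_on_def by (auto intro!: Ck_on_bounded_linear bounded_linear_inner_left)
    then show "smooth_on UNIV (\<lambda>h. (h \<bullet> e) ^ m e)" by (rule smooth_on_power[OF open_UNIV])
  qed
  then have q: "q differentiable (at (x - x))" by (auto intro: smooth_on_differentiable)
  define \<rho> where "\<rho> = r / 2"
  have \<rho>: "0 < \<rho>" "\<rho> < r" using r by (auto simp: \<rho>_def)
  define u where "u = (\<Sum>e\<in>Basis. \<rho> *\<^sub>R e :: 'a)"
  have ue: "u \<bullet> e = \<rho>" if "e \<in> Basis" for e
    using that by (simp add: u_def inner_sum_left inner_Basis if_distrib cong: if_cong)
  have "(mono u has_sum f (x + u)) ?I"
    using a[of u] \<rho> by (simp add: ue mono_def[abs_def])
  then have "mono u summable_on ?I" by (rule has_sum_imp_summable)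
  then have abs: "(\<lambda>m. \<bar>mono u m\<bar>) summable_on ?I"
    using summable_on_iff_abs_summable_on_real by fastforce
  define A where "A = infsum (\<lambda>m. \<bar>mono u m\<bar>) ?I"
  have rest: "\<bar>f (x + h) - q h\<bar> \<le> A / \<rho>\<^sup>2 * (norm h)\<^sup>2" if h: "norm h < \<rho>" for h
  proof -
    have he: "\<bar>h \<bullet> e\<bar> \<le> norm h" if "e \<in> Basis" for e by (rule Basis_le_norm[OF that])
    have "(mono h has_sum f (x + h)) ?I"
      using a[of h] he h \<rho> by (force simp: mono_def[abs_def])
    moreover have "(mono h has_sum q h) J" unfolding q_def by (rule has_sum_finite[OF finJ])
    moreover have "J \<subseteq> ?I" by (auto simp: J_def)
    ultimately have tail: "(mono h has_sum (f (x + h) - q h)) (?I - J)" by (rule has_sum_Diff)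
    have bound: "\<bar>mono h m\<bar> \<le> (norm h / \<rho>)\<^sup>2 * \<bar>mono u m\<bar>" if m: "m \<in> ?I - J" for m
    proof -
      let ?s = "sum m Basis"
      have "\<bar>\<Prod>e\<in>Basis. (h \<bullet> e) ^ m e\<bar> \<le> (\<Prod>e\<in>(Basis :: 'a set). norm h ^ m e)"
        unfolding abs_prod by (intro prod_mono) (auto simp: power_abs intro: power_mono he)
      also have "\<dots> = (norm h / \<rho>) ^ ?s * \<rho> ^ ?s"
        using \<rho> by (simp add: power_sum[symmetric] power_divide)
      also have "\<dots> \<le> (norm h / \<rho>)\<^sup>2 * \<rho> ^ ?s"
        using m h \<rho> by (intro mult_right_mono power_decreasing) (auto simp: J_def)
      also have "\<rho> ^ ?s = \<bar>\<Prod>e\<in>Basis. (u \<bullet> e) ^ m e\<bar>"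
        using \<rho> by (simp add: ue power_sum[symmetric] cong: prod.cong)
      finally show ?thesis unfolding mono_def abs_mult mult.assoc[symmetric]
        by (rule mult_right_mono) simp
    qed
    have s1: "(\<lambda>m. (norm h / \<rho>)\<^sup>2 * \<bar>mono u m\<bar>) summable_on (?I - J)"
      by (intro summable_on_cmult_right summable_on_subset_banach[OF abs]) auto
    have s2: "(\<lambda>m. \<bar>mono h m\<bar>) summable_on (?I - J)"
      using has_sum_imp_summable[OF tail] summable_on_iff_abs_summable_on_real by fastforce
    have "\<bar>f (x + h) - q h\<bar> = norm (infsum (mono h) (?I - J))" using infsumI[OF tail] by simp
    also have "\<dots> \<le> infsum (\<lambda>m. norm (mono h m)) (?I - J)"
      by (rule norm_infsum_bound) (use s2 in simp)
    also have "\<dots> \<le> infsum (\<lambda>m. (norm h / \<rho>)\<^sup>2 * \<bar>mono u m\<bar>) (?I - J)"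
      by (rule infsum_mono) (use s1 s2 bound in auto)
    also have "\<dots> = (norm h / \<rho>)\<^sup>2 * infsum (\<lambda>m. \<bar>mono u m\<bar>) (?I - J)"
      by (rule infsum_cmult_right') 
    also have "\<dots> \<le> (norm h / \<rho>)\<^sup>2 * A"
      unfolding A_def by (intro mult_left_mono infsum_mono2 summable_on_subset_banach[OF abs] abs) auto
    finally show ?thesis by (simp add: power_divide field_simps)
  qed
  define R where "R y = f y - q (y - x)" for y
  have "(R has_derivative (\<lambda>_. 0)) (at x)"
    unfolding has_derivative_at_alt
  proof (intro conjI allI impI bounded_linear_zero)
    fix e :: real assume e: "e > 0"
    have A0: "A \<ge> 0" unfolding A_def by (rule infsum_nonneg) simp
    have R0: "R x = 0" using rest[of 0] \<rho> by (simp add: R_def)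
    define d where "d = min \<rho> (e * \<rho>\<^sup>2 / (A + 1))"
    have "d > 0" unfolding d_def using \<rho> e A0 by (simp add: add_nonneg_pos)
    moreover have "norm (R y - R x - 0) \<le> e * norm (y - x)" if y: "norm (y - x) < d" for y
    proof -
      have "\<bar>R y\<bar> \<le> A / \<rho>\<^sup>2 * (norm (y - x))\<^sup>2"
        using rest[of "y - x"] y by (simp add: R_def d_def)
      also have "\<dots> \<le> (A + 1) / \<rho>\<^sup>2 * norm (y - x) * norm (y - x)"
        by (simp add: power2_eq_square mult.assoc divide_right_mono mult_right_mono)
      also have "\<dots> \<le> e * norm (y - x)"
      proof (rule mult_right_mono)
        have "norm (y - x) \<le> e * \<rho>\<^sup>2 / (A + 1)" using y by (simp add: d_def)
        then show "(A + 1) / \<rho>\<^sup>2 * norm (y - x) \<le> e"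
          using A0 \<rho> by (simp add: field_simps)
      qed simp
      finally show ?thesis using R0 by simp
    qed
    ultimately show "\<exists>d>0. \<forall>y. norm (y - x) < d \<longrightarrow> norm (R y - R x - 0) \<le> e * norm (y - x)" by blast
  qed
  then have "R differentiable (at x)" by (auto simp: differentiable_def)
  moreover have "(\<lambda>y. q (y - x)) differentiable (at x)"
    using differentiable_chain_at[where f = "\<lambda>y. y - x" and g = q and x = x, OF _ q]
    by (simp add: o_def)
  ultimately have "(\<lambda>y. R y + q (y - x)) differentiable (at x)" by (rule differentiable_add)
  then show ?thesis by (simp add: R_def)
qed

lemma real_analytic_at_imp_differentiable:
  fixes f :: "'a::euclidean_space \<Rightarrow> 'b::euclidean_space"
  assumes "real_analytic_at f x"
  shows "f differentiable (at x)"
proof -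
  have "((\<lambda>u. f u \<bullet> i) has_derivative frechet_derivative (\<lambda>u. f u \<bullet> i) (at x)) (at x)" for i
    unfolding frechet_derivative_works[symmetric] by (intro real_analytic_at_imp_differentiable_real
        real_analytic_at_bounded_linear[OF bounded_linear_inner_left assms])
  note d = this
  let ?d = "\<lambda>v. \<Sum>i\<in>Basis. frechet_derivative (\<lambda>u. f u \<bullet> i) (at x) v *\<^sub>R i"
  have "(\<lambda>v. ?d v \<bullet> i) = frechet_derivative (\<lambda>u. f u \<bullet> i) (at x)" if "i \<in> Basis" for i
    using that by (simp add: inner_sum_left inner_Basis if_distrib cong: if_cong)
  then have "(f has_derivative ?d) (at x)"
    by (subst has_derivative_componentwise_within) (auto simp: d)
  then show ?thesis by (auto simp: differentiable_def)
qed

text \<open>A chart \<open>\<phi>\<close> around \<open>p\<close> identifies \<open>T\<^sub>pM\<close> with \<open>real ^ 'n\<close>. The purpose of this part is to transport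
  the hypotheses on \<open>A\<close> and \<open>L\<close>, which are stated on \<open>TM\<close>, along this identification.\<close>
locale pointed_chart =
  fixes M :: "'a topology" and \<A> :: "('a, 'n::finite) chart set"
    and \<phi> :: "('a, 'n) chart" and p :: 'a
  assumes manifold: "analytic_manifold M \<A>"
    and chart: "\<phi> \<in> \<A>" "p \<in> fst \<phi>"
begin

lemma chart_domain_subset: "\<psi> \<in> \<A> \<Longrightarrow> fst \<psi> \<subseteq> topspace M"
  using manifold openin_subset unfolding analytic_manifold_def by blast

lemma chart_homeomorphic:
  "\<psi> \<in> \<A> \<Longrightarrow> homeomorphic_map (subtopology M (fst \<psi>)) (top_of_set (snd \<psi> ` fst \<psi>)) (snd \<psi>)"
  using manifold unfolding analytic_manifold_def by blast

lemma chart_inj: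
  assumes "\<psi> \<in> \<A>" shows "inj_on (snd \<psi>) (fst \<psi>)"
proof -
  have "topspace (subtopology M (fst \<psi>)) = fst \<psi>" using chart_domain_subset[OF assms] by auto
  then show ?thesis using homeomorphic_imp_injective_map[OF chart_homeomorphic[OF assms]] by simp
qed

lemma open_chart_image:
  assumes "\<psi> \<in> \<A>" "openin M U"
  shows "open (snd \<psi> ` (fst \<psi> \<inter> U))"
proof -
  have "openin (subtopology M (fst \<psi>)) (fst \<psi> \<inter> U)"
    using assms(2) by (auto simp: openin_subtopology_alt)
  then have "openin (top_of_set (snd \<psi> ` fst \<psi>)) (snd \<psi> ` (fst \<psi> \<inter> U))"
    using homeomorphic_imp_open_map[OF chart_homeomorphic[OF assms(1)]] unfolding open_map_def by blast
  moreover have "open (snd \<psi> ` fst \<psi>)" using manifold assms(1) unfolding analytic_manifold_def by blast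
  ultimately show ?thesis by (rule openin_open_trans)
qed

lemma chart_open: "\<psi> \<in> \<A> \<Longrightarrow> openin M (fst \<psi>)"
  using manifold unfolding analytic_manifold_def by blast

lemma transition_chart: "\<psi> \<in> \<A> \<Longrightarrow> q \<in> fst \<psi> \<Longrightarrow> transition \<psi> \<psi>' (snd \<psi> q) = snd \<psi>' q"
  by (simp add: transition_def inv_into_f_f[OF chart_inj])

lemma transition_differentiable:
  assumes "\<psi> \<in> \<A>" "\<psi>' \<in> \<A>" "q \<in> fst \<psi>" "q \<in> fst \<psi>'"
  shows "transition \<psi> \<psi>' differentiable (at (snd \<psi> q))"
  using manifold assms unfolding analytic_manifold_def real_analytic_on_def
  by (intro real_analytic_at_imp_differentiable) blast

abbreviation dtrans :: "('a, 'n) chart \<Rightarrow> ('a, 'n) chart \<Rightarrow> real ^ 'n \<Rightarrow> real ^ 'n" where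
  "dtrans \<psi> \<psi>' \<equiv> frechet_derivative (transition \<psi> \<psi>') (at (snd \<psi> p))"

lemma dtrans_linear:
  "\<psi> \<in> \<A> \<Longrightarrow> \<psi>' \<in> \<A> \<Longrightarrow> p \<in> fst \<psi> \<Longrightarrow> p \<in> fst \<psi>' \<Longrightarrow> linear (dtrans \<psi> \<psi>')"
  by (rule linear_frechet_derivative[OF transition_differentiable])

text \<open>The chain rule for changes of coordinates; it is the reason why arbitrary components with respect
  to \<open>\<phi>\<close> define a tangent vector.\<close>
lemma dtrans_chain:
  assumes "\<psi> \<in> \<A>" "\<psi>' \<in> \<A>" "\<omega> \<in> \<A>" "p \<in> fst \<psi>" "p \<in> fst \<psi>'" "p \<in> fst \<omega>"
  shows "dtrans \<psi>' \<omega> (dtrans \<psi> \<psi>' v) = dtrans \<psi> \<omega> v"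
proof -
  have D1: "(transition \<psi> \<psi>' has_derivative dtrans \<psi> \<psi>') (at (snd \<psi> p))"
    using transition_differentiable[of \<psi> \<psi>' p] assms frechet_derivative_works by blast
  have D2: "(transition \<psi>' \<omega> has_derivative dtrans \<psi>' \<omega>) (at (transition \<psi> \<psi>' (snd \<psi> p)))"
    using transition_differentiable[of \<psi>' \<omega> p] assms frechet_derivative_works
    by (simp add: transition_chart) blast
  have "((\<lambda>x. transition \<psi>' \<omega> (transition \<psi> \<psi>' x)) has_derivative (\<lambda>v. dtrans \<psi>' \<omega> (dtrans \<psi> \<psi>' v)))
      (at (snd \<psi> p))"
    by (rule has_derivative_compose[OF D1 D2])
  then have "(transition \<psi> \<omega> has_derivative (\<lambda>v. dtrans \<psi>' \<omega> (dtrans \<psi> \<psi>' v))) (at (snd \<psi> p))"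
  proof (rule has_derivative_transform_within_open)
    show "open (snd \<psi> ` (fst \<psi> \<inter> fst \<psi>'))" by (rule open_chart_image[OF assms(1) chart_open[OF assms(2)]])
    show "snd \<psi> p \<in> snd \<psi> ` (fst \<psi> \<inter> fst \<psi>')" using assms by blast
    fix x assume "x \<in> snd \<psi> ` (fst \<psi> \<inter> fst \<psi>')"
    then show "transition \<psi>' \<omega> (transition \<psi> \<psi>' x) = transition \<psi> \<omega> x"
      using assms by (auto simp: transition_chart)
  qed
  from frechet_derivative_at[OF this] show ?thesis by metis
qed

lemma dtrans_id:
  assumes "\<psi> \<in> \<A>" "p \<in> fst \<psi>"
  shows "dtrans \<psi> \<psi> v = v"
proof -
  have "((\<lambda>x. x) has_derivative (\<lambda>v. v)) (at (snd \<psi> p))" by (rule has_derivative_ident)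
  then have "(transition \<psi> \<psi> has_derivative (\<lambda>v. v)) (at (snd \<psi> p))"
  proof (rule has_derivative_transform_within_open)
    show "open (snd \<psi> ` (fst \<psi> \<inter> fst \<psi>))" by (rule open_chart_image[OF assms(1) chart_open[OF assms(1)]])
    show "snd \<psi> p \<in> snd \<psi> ` (fst \<psi> \<inter> fst \<psi>)" using assms by blast
    fix x assume "x \<in> snd \<psi> ` (fst \<psi> \<inter> fst \<psi>)"
    then show "x = transition \<psi> \<psi> x" using assms by (auto simp: transition_chart)
  qed
  from frechet_derivative_at[OF this] show ?thesis by metis
qed

text \<open>The tangent vector at \<open>p\<close> with components \<open>y\<close> with respect to \<open>\<phi>\<close>.\<close>
definition tangent :: "real ^ 'n \<Rightarrow> ('a, 'n) tvec" where
  "tangent y = (p, \<lambda>\<psi>. if \<psi> \<in> \<A> \<and> p \<in> fst \<psi> then dtrans \<phi> \<psi> y else 0)"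

lemma tangent_in_TM: "tangent y \<in> TM \<A>"
  using chart by (auto simp: tangent_def TM_def dtrans_chain)

lemma fst_tangent [simp]: "fst (tangent y) = p"
  by (simp add: tangent_def)

lemma tchart_tangent: "tchart \<phi> (tangent y) = (snd \<phi> p, y)"
  using chart by (simp add: tchart_def tangent_def dtrans_id)

lemma tangent_in_tchart_dom: "\<psi> \<in> \<A> \<Longrightarrow> tangent y \<in> tchart_dom \<A> \<psi> \<longleftrightarrow> p \<in> fst \<psi>"
  by (simp add: tchart_dom_def tangent_in_TM)

lemma tangent_unique:
  assumes "v \<in> TM \<A>" "fst v = p"
  shows "v = tangent (snd v \<phi>)"
proof -
  obtain w where v: "v = (p, w)" using assms(2) by (cases v) auto
  have w: "\<forall>\<phi>. \<not> (\<phi> \<in> \<A> \<and> p \<in> fst \<phi>) \<longrightarrow> w \<phi> = 0"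
    "\<forall>\<phi>\<in>\<A>. \<forall>\<psi>\<in>\<A>. p \<in> fst \<phi> \<inter> fst \<psi> \<longrightarrow> w \<psi> = dtrans \<phi> \<psi> (w \<phi>)"
    using assms(1) unfolding v TM_def mem_Collect_eq case_prod_conv by fast+
  have "w \<psi> = (if \<psi> \<in> \<A> \<and> p \<in> fst \<psi> then dtrans \<phi> \<psi> (w \<phi>) else 0)" for \<psi>
  proof (cases "\<psi> \<in> \<A> \<and> p \<in> fst \<psi>")
    case True
    then have "w \<psi> = dtrans \<phi> \<psi> (w \<phi>)" using w(2) chart by blast
    then show ?thesis using True by simp
  next
    case False
    then have "w \<psi> = 0" using w(1) by blast
    then show ?thesis unfolding if_not_P[OF False] .
  qed
  then show ?thesis unfolding v tangent_def by (intro prod_eqI ext) simp_all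
qed

lemma tchart_eq_tangent:
  assumes "v \<in> tchart_dom \<A> \<phi>" "tchart \<phi> v = (snd \<phi> p, y)"
  shows "v = tangent y"
proof -
  have "snd \<phi> (fst v) = snd \<phi> p" "fst v \<in> fst \<phi>" "v \<in> TM \<A>" "snd v \<phi> = y"
    using assms by (auto simp: tchart_def tchart_dom_def)
  then show ?thesis using inj_onD[OF chart_inj[OF chart(1)]] chart tangent_unique by metis
qed

lemma mem_cset_iff: "(snd \<phi> p, y) \<in> cset \<A> \<phi> T \<longleftrightarrow> tangent y \<in> T"
proof
  assume "(snd \<phi> p, y) \<in> cset \<A> \<phi> T"
  then obtain v where v: "v \<in> T \<inter> tchart_dom \<A> \<phi>" "(snd \<phi> p, y) = tchart \<phi> v"
    unfolding cset_def by blast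
  then have "v = tangent y" by (intro tchart_eq_tangent) simp_all
  then show "tangent y \<in> T" using v(1) by simp
next
  assume "tangent y \<in> T"
  then have "tchart \<phi> (tangent y) \<in> cset \<A> \<phi> T"
    unfolding cset_def using tangent_in_tchart_dom chart by blast
  then show "(snd \<phi> p, y) \<in> cset \<A> \<phi> T" by (simp add: tchart_tangent)
qed

lemma cfun_tangent: "cfun \<A> \<phi> f (snd \<phi> p, y) = f (tangent y)"
proof -
  have "(snd \<phi> p, y) \<in> tchart \<phi> ` tchart_dom \<A> \<phi>"
    using tangent_in_tchart_dom[OF chart(1)] chart(2) tchart_tangent by (metis image_eqI)
  then have "inv_into (tchart_dom \<A> \<phi>) (tchart \<phi>) (snd \<phi> p, y) = tangent y"
    by (intro tchart_eq_tangent inv_into_into f_inv_into_f)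
  then show ?thesis by (simp add: cfun_def)
qed

lemma tangent_scale: "tangent (t *\<^sub>R y) = tscale t (tangent y)"
proof -
  have "dtrans \<phi> \<psi> (t *\<^sub>R y) = t *\<^sub>R dtrans \<phi> \<psi> y" if "\<psi> \<in> \<A>" "p \<in> fst \<psi>" for \<psi>
    using linear_cmul[OF dtrans_linear[OF chart(1) that(1) chart(2) that(2)]] .
  then show ?thesis by (auto simp: tangent_def tscale_def)
qed

lemma tangent_slit_iff: "tangent y \<in> slit_TM \<A> \<longleftrightarrow> y \<noteq> 0"
proof -
  have "snd (tangent y) = (\<lambda>_. 0) \<longleftrightarrow> y = 0"
  proof
    assume "snd (tangent y) = (\<lambda>_. 0)"
    then have "snd (tangent y) \<phi> = 0" by simp
    then show "y = 0" using tchart_tangent[of y] by (simp add: tchart_def)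
  next
    assume "y = 0"
    moreover have "dtrans \<phi> \<psi> 0 = 0" if "\<psi> \<in> \<A>" "p \<in> fst \<psi>" for \<psi>
      using linear_0[OF dtrans_linear[OF chart(1) that(1) chart(2) that(2)]] .
    ultimately show "snd (tangent y) = (\<lambda>_. 0)" by (auto simp: tangent_def)
  qed
  then show ?thesis by (simp add: slit_TM_def tangent_in_TM)
qed

text \<open>On \<open>T\<^sub>pM\<close> changes of coordinates are linear, so the preimages of the generating open sets are open.
  Hence the fibres of an open set of \<open>TM\<close> are open (\<open>open_tangent_preimage\<close>).\<close>
lemma continuous_tangent: "continuous_map euclidean (TM_top \<A>) tangent"
  unfolding TM_top_def
proof (rule continuous_on_generated_topo)
  fix U assume "U \<in> {{v \<in> tchart_dom \<A> \<psi>. tchart \<psi> v \<in> V} |\<psi> V. \<psi> \<in> \<A> \<and> open V}"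
  then obtain \<psi> V where U: "\<psi> \<in> \<A>" "open V" "U = {v \<in> tchart_dom \<A> \<psi>. tchart \<psi> v \<in> V}" by blast
  show "openin euclidean (tangent -` U \<inter> topspace euclidean)"
  proof (cases "p \<in> fst \<psi>")
    case True
    have "linear (dtrans \<phi> \<psi>)" using dtrans_linear chart U(1) True by blast
    then have "continuous_on UNIV (dtrans \<phi> \<psi>)" by (simp add: linear_continuous_on linear_conv_bounded_linear)
    then have "continuous_on UNIV (\<lambda>y. (snd \<psi> p, dtrans \<phi> \<psi> y))" by (intro continuous_intros)
    then have "open ((\<lambda>y. (snd \<psi> p, dtrans \<phi> \<psi> y)) -` V)" using U(2) by (rule open_vimage[rotated])
    moreover have "tchart \<psi> (tangent y) = (snd \<psi> p, dtrans \<phi> \<psi> y)" for y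
      using U(1) True by (simp add: tchart_def tangent_def)
    then have "tangent -` U = (\<lambda>y. (snd \<psi> p, dtrans \<phi> \<psi> y)) -` V"
      using U(1) True by (auto simp: U(3) tangent_in_tchart_dom)
    ultimately show ?thesis by simp
  next
    case False
    then have "tangent -` U = {}" using U(1) by (auto simp: U(3) tangent_in_tchart_dom)
    then show ?thesis by simp
  qed
next
  have "tangent y \<in> {v \<in> tchart_dom \<A> \<phi>. tchart \<phi> v \<in> UNIV}" for y
    using tangent_in_tchart_dom chart by simp
  then show "tangent ` topspace euclidean \<subseteq> \<Union> {{v \<in> tchart_dom \<A> \<psi>. tchart \<psi> v \<in> V} |\<psi> V. \<psi> \<in> \<A> \<and> open V}"
    using chart(1) open_UNIV by blast
qed

lemma open_tangent_preimage: "openin (TM_top \<A>) U \<Longrightarrow> open {y. tangent y \<in> U}"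
  using openin_continuous_map_preimage[OF continuous_tangent] by simp

lemma openin_tchart_preimage:
  "open V \<Longrightarrow> openin (TM_top \<A>) {v \<in> tchart_dom \<A> \<phi>. tchart \<phi> v \<in> V}"
  unfolding TM_top_def using chart(1) by (intro topology_generated_by_Basis) blast

lemma continuous_tchart:
  "continuous_map (subtopology (TM_top \<A>) (tchart_dom \<A> \<phi>)) euclidean (tchart \<phi>)"
proof -
  have "topspace (subtopology (TM_top \<A>) (tchart_dom \<A> \<phi>)) \<subseteq> tchart_dom \<A> \<phi>" by auto
  moreover have "openin (subtopology (TM_top \<A>) (tchart_dom \<A> \<phi>))
      {v \<in> topspace (subtopology (TM_top \<A>) (tchart_dom \<A> \<phi>)). tchart \<phi> v \<in> V}" if "open V" for V
  proof -
    have o: "openin (TM_top \<A>) {v \<in> tchart_dom \<A> \<phi>. tchart \<phi> v \<in> V}" by (rule openin_tchart_preimage[OF that])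
    have "{v \<in> topspace (subtopology (TM_top \<A>) (tchart_dom \<A> \<phi>)). tchart \<phi> v \<in> V} =
        {v \<in> tchart_dom \<A> \<phi>. tchart \<phi> v \<in> V} \<inter> tchart_dom \<A> \<phi>"
      using openin_subset[OF openin_tchart_preimage[OF open_UNIV]] by auto
    then show ?thesis using openin_subtopology_Int[OF o] by simp
  qed
  ultimately show ?thesis by (auto simp: continuous_map)
qed

lemma connected_fiber:
  assumes "A \<subseteq> TM \<A>" "connectedin (TM_top \<A>) {v \<in> A. fst v = p}"
  shows "connected {y. tangent y \<in> A}"
proof -
  have "{v \<in> A. fst v = p} \<subseteq> tchart_dom \<A> \<phi>" using assms(1) chart by (auto simp: tchart_dom_def)
  then have "connectedin (subtopology (TM_top \<A>) (tchart_dom \<A> \<phi>)) {v \<in> A. fst v = p}"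
    using assms(2) by (simp add: connectedin_subtopology)
  from connectedin_continuous_map_image[OF continuous_tchart this]
  have "connected (tchart \<phi> ` {v \<in> A. fst v = p})" by simp
  then have "connected (snd ` (tchart \<phi> ` {v \<in> A. fst v = p}))"
    by (intro connected_continuous_image continuous_on_snd continuous_on_id)
  moreover have "snd ` (tchart \<phi> ` {v \<in> A. fst v = p}) = {y. tangent y \<in> A}"
  proof (intro equalityI subsetI)
    fix y assume "y \<in> snd ` (tchart \<phi> ` {v \<in> A. fst v = p})"
    then obtain v where v: "v \<in> A" "fst v = p" "y = snd v \<phi>" by (auto simp: tchart_def)
    then show "y \<in> {y. tangent y \<in> A}" using tangent_unique[of v] assms(1) by auto
  next
    fix y assume "y \<in> {y. tangent y \<in> A}"
    then have "tangent y \<in> {v \<in> A. fst v = p}" by simp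
    then have "snd (tchart \<phi> (tangent y)) \<in> snd ` (tchart \<phi> ` {v \<in> A. fst v = p})" by blast
    then show "y \<in> snd ` (tchart \<phi> ` {v \<in> A. fst v = p})" by (simp add: tchart_tangent)
  qed
  ultimately show ?thesis by simp
qed

text \<open>A boundary point of the fibre \<open>A\<^sub>p\<close> within \<open>T\<^sub>pM\<close> is a boundary point of \<open>A\<close> in \<open>TM\<close>, so the
  extension hypotheses are available there.\<close>
lemma tangent_in_slit_closure:
  assumes "A \<subseteq> slit_TM \<A>" "y \<in> closure {y. tangent y \<in> A}" "y \<noteq> 0"
  shows "tangent y \<in> slit_closure \<A> A"
  unfolding slit_closure_def in_closure_of
proof (intro conjI allI impI)
  have "tangent y \<in> topspace (TM_top \<A>)"
    using continuous_map_image_subset_topspace[OF continuous_tangent] by auto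
  then show "tangent y \<in> topspace (subtopology (TM_top \<A>) (slit_TM \<A>))"
    using assms(3) tangent_slit_iff by simp
  fix T assume T: "tangent y \<in> T \<and> openin (subtopology (TM_top \<A>) (slit_TM \<A>)) T"
  then obtain T' where T': "openin (TM_top \<A>) T'" "T = T' \<inter> slit_TM \<A>"
    unfolding openin_subtopology by blast
  have "open {u. tangent u \<in> T'}" "y \<in> {u. tangent u \<in> T'}"
    using open_tangent_preimage[OF T'(1)] T T'(2) by auto
  then have "{u. tangent u \<in> T'} \<inter> {y. tangent y \<in> A} \<noteq> {}"
    using assms(2) open_Int_closure_eq_empty[of "{u. tangent u \<in> T'}" "{y. tangent y \<in> A}"] by blast
  then show "\<exists>v. v \<in> A \<and> v \<in> T" using T'(2) assms(1) by blast
qed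

end

section \<open>Global uniqueness\<close>

text \<open>Symmetry cancels the last term of the affine equation. What remains is
  \<open>H\<^sub>iy\<^sup>j = \<delta>\<^sup>j\<^sub>i H\<^sub>by\<^sup>b\<close> for the difference \<open>H\<close> of the brackets; for \<open>j\<close> with \<open>y\<^sup>j \<noteq> 0\<close> this
  kills \<open>H\<^sub>i\<close> for \<open>i \<noteq> j\<close>, then \<open>H\<^sub>by\<^sup>b\<close>, and then \<open>H\<^sub>j\<close>.\<close>
lemma affine_equation_difference:
  fixes l :: "'n::finite tcoord \<Rightarrow> real" and J J' :: "'n tcoord \<Rightarrow> real ^ 'n ^ 'n"
  assumes eq: "affine_equation_at l J z" "affine_equation_at l J' z"
    and D: "\<And>k i. D k i = J z $ k $ i - J' z $ k $ i"
    and dD: "\<And>k i j. dD k i j = yd j (\<lambda>u. J u $ k $ i) z - yd j (\<lambda>u. J' u $ k $ i) z"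
    and sym: "\<And>k i j. dD k i j = dD k j i"
    and z: "snd z \<noteq> 0" and dim: "CARD('n) \<ge> 2"
  shows "(real CARD('n) + 2) * (\<Sum>a\<in>UNIV. ylow l z a / l z * D a b)
    - 2 * (\<Sum>a\<in>UNIV. mean_cartan l z a * D a b) - (\<Sum>a\<in>UNIV. dD a b a + dD a a b) = 0"
proof -
  define E where "E J b = 2 * mean_landsberg l z b
      + (real CARD('n) + 2) * (\<Sum>a\<in>UNIV. ylow l z a / l z * J z $ a $ b)
      - 2 * (\<Sum>a\<in>UNIV. mean_cartan l z a * J z $ a $ b)
      - (\<Sum>a\<in>UNIV. yd a (\<lambda>u. J u $ a $ b) z + yd b (\<lambda>u. J u $ a $ a) z)"
    for J :: "'n tcoord \<Rightarrow> real ^ 'n ^ 'n" and b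
  define H where "H b = (real CARD('n) + 2) * (\<Sum>a\<in>UNIV. ylow l z a / l z * D a b)
    - 2 * (\<Sum>a\<in>UNIV. mean_cartan l z a * D a b) - (\<Sum>a\<in>UNIV. dD a b a + dD a a b)" for b
  let ?y = "\<lambda>i. snd z $ i"
  let ?w = "\<lambda>i j b. (if b = i then 1 else 0) * ?y j - ?y b * (if j = i then 1 else 0)"
  have EJ: "(\<Sum>b\<in>UNIV. E J b * ?w i j b)
      - (\<Sum>a\<in>UNIV. (yd a (\<lambda>u. J u $ j $ i) z - yd i (\<lambda>u. J u $ j $ a) z) * ?y a) = 0"
    if "affine_equation_at l J z" for J i j
    using that unfolding affine_equation_at_def Let_def E_def by blast
  have EH: "E J b - E J' b = H b" for b
    unfolding E_def H_def D dD
    by (simp add: right_diff_distrib sum_subtractf sum.distrib algebra_simps)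
  have HW: "(\<Sum>b\<in>UNIV. H b * ?w i j b) = 0" for i j
  proof -
    have "(\<Sum>b\<in>UNIV. H b * ?w i j b) = (\<Sum>b\<in>UNIV. E J b * ?w i j b) - (\<Sum>b\<in>UNIV. E J' b * ?w i j b)"
      unfolding EH[symmetric] left_diff_distrib sum_subtractf ..
    also have "\<dots> = (\<Sum>a\<in>UNIV. (yd a (\<lambda>u. J u $ j $ i) z - yd i (\<lambda>u. J u $ j $ a) z) * ?y a)
        - (\<Sum>a\<in>UNIV. (yd a (\<lambda>u. J' u $ j $ i) z - yd i (\<lambda>u. J' u $ j $ a) z) * ?y a)"
      using EJ[OF eq(1), of i j] EJ[OF eq(2), of i j] by simp
    also have "\<dots> = (\<Sum>a\<in>UNIV. (dD j i a - dD j a i) * ?y a)"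
      unfolding dD sum_subtractf[symmetric] by (simp add: algebra_simps)
    also have "\<dots> = 0" by (simp add: sym[of j i])
    finally show ?thesis .
  qed
  have Hy: "H i * ?y j = (if j = i then (\<Sum>b\<in>UNIV. H b * ?y b) else 0)" for i j
  proof -
    have "(\<Sum>b\<in>UNIV. H b * ?w i j b) = (\<Sum>b\<in>UNIV. H b * ((if b = i then 1 else 0) * ?y j))
        - (\<Sum>b\<in>UNIV. H b * (?y b * (if j = i then 1 else 0)))"
      unfolding right_diff_distrib sum_subtractf ..
    also have "(\<Sum>b\<in>UNIV. H b * ((if b = i then 1 else 0) * ?y j)) = H i * ?y j"
      by (simp add: if_distrib[of "\<lambda>x. x * _"] if_distrib[of "(*) _"] cong: if_cong)
    finally show ?thesis using HW[of i j] by (cases "j = i") simp_all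
  qed
  obtain j where j: "?y j \<noteq> 0" using z by (metis vec_eq_iff zero_index)
  obtain i where i: "i \<noteq> j"
  proof -
    have "UNIV \<noteq> {j}" using dim by (metis card.empty card.insert card_eq_0_iff finite.emptyI
          insert_absorb not_numeral_le_zero numeral_le_one_iff One_nat_def semiring_norm(69) empty_iff)
    then show ?thesis using that by blast
  qed
  have "H b = 0" for b
  proof (cases "b = j")
    case False
    then show ?thesis using Hy[of b j] j by simp
  next
    case True
    have "H i = 0" using Hy[of i j] i j by simp
    then have "(\<Sum>b\<in>UNIV. H b * ?y b) = 0" using Hy[of i i] by simp
    then show ?thesis using Hy[of j j] j True by simp
  qed
  then show ?thesis unfolding H_def by blast
qed

lemma connection_component_smooth:
  fixes N :: "'n::finite tcoord \<Rightarrow> real ^ 'n ^ 'n"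
  assumes "open {y. (x, y) \<in> Z}" "smooth_on Z N"
  shows "smooth_on {y. (x, y) \<in> Z} (\<lambda>y. N (x, y) $ k $ i)"
    and "(x, y) \<in> Z \<Longrightarrow> yd j (\<lambda>u. N u $ k $ i) (x, y) = pd j (\<lambda>u. N (x, u) $ k $ i) y"
proof -
  have b: "bounded_linear (\<lambda>A :: real ^ 'n ^ 'n. A $ k $ i)"
    by (intro bounded_linear_compose[OF bounded_linear_vec_nth bounded_linear_vec_nth])
  show "smooth_on {y. (x, y) \<in> Z} (\<lambda>y. N (x, y) $ k $ i)"
    by (rule smooth_on_compose_bounded_linear[OF assms(1) b smooth_on_slice[OF assms]])
  assume "(x, y) \<in> Z"
  then have "N differentiable (at (x, y))" by (rule smooth_on_differentiable[OF assms(2)])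
  then have "(\<lambda>u. N u $ k $ i) differentiable (at (x, y))"
    using bounded_linear.has_derivative[OF b] unfolding differentiable_def by blast
  then show "yd j (\<lambda>u. N u $ k $ i) (x, y) = pd j (\<lambda>u. N (x, u) $ k $ i) y"
    by (rule yd_eq_pd_slice)
qed

lemma mean_cartan_slice:
  assumes o: "open {y. (x, y) \<in> Z}" and l: "smooth_on Z l" and xy: "(x, y) \<in> Z"
  shows "mean_cartan l (x, y) i = (\<Sum>a\<in>UNIV. \<Sum>b\<in>UNIV.
    matrix_inv (fiber_metric (\<lambda>u. l (x, u)) y) $ a $ b *
      (1/2 * pd i (\<lambda>v. fiber_metric (\<lambda>u. l (x, u)) v $ a $ b) y))"
proof -
  have gm: "gmat l (x, v) = fiber_metric (\<lambda>u. l (x, u)) v" if "(x, v) \<in> Z" for v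
    by (rule gmat_eq_fiber_metric[OF o l that])
  have "yd i (\<lambda>u. gmat l u $ a $ b) (x, y) = pd i (\<lambda>v. fiber_metric (\<lambda>u. l (x, u)) v $ a $ b) y" for a b
  proof -
    have "yd b (yd a l) differentiable (at (x, y))"
      by (rule smooth_on_differentiable[OF smooth_on_yd[OF smooth_on_yd[OF l]] xy])
    then have "(\<lambda>u. gmat l u $ a $ b) differentiable (at (x, y))"
      unfolding gmat_def vec_lambda_beta by (intro differentiable_mult differentiable_const)
    then have "yd i (\<lambda>u. gmat l u $ a $ b) (x, y) = pd i (\<lambda>v. gmat l (x, v) $ a $ b) y"
      by (rule yd_eq_pd_slice)
    also have "\<dots> = pd i (\<lambda>v. fiber_metric (\<lambda>u. l (x, u)) v $ a $ b) y"
      by (rule pd_cong_open[OF o]) (use xy gm in auto)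
    finally show ?thesis .
  qed
  then show ?thesis by (simp add: mean_cartan_def ginv_def cartan_def gm[OF xy])
qed

theorem theoremB:
  fixes M :: "'a topology"
    and \<A> :: "('a, 'n::finite) chart set"
    and A :: "('a, 'n) tvec set"
    and L :: "('a, 'n) tvec \<Rightarrow> real"
    and N N' :: "('a, 'n) chart_field"
  assumes "CARD('n) \<ge> 3"
    and "analytic_manifold M \<A>" and "connected_space M"
    and "conic_domain \<A> A"
    and "proper_pseudo_finsler \<A> A L"
    and "indefinite_metric \<A> A L"
    and "metric_analytic_closure \<A> A L"
    and "proper_affine_solution \<A> A L N" and "symmetric_connection \<A> A N"
    and "connection_analytic_closure \<A> A N"
    and "proper_affine_solution \<A> A L N'" and "symmetric_connection \<A> A N'"
    and "connection_analytic_closure \<A> A N'"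
  shows "same_connection \<A> A N N'"
proof -
  have "N \<phi> z = N' \<phi> z" if \<phi>: "\<phi> \<in> \<A>" and z: "z \<in> cset \<A> \<phi> A" for \<phi> z
  proof -
    obtain v where v: "v \<in> A" "v \<in> tchart_dom \<A> \<phi>" "z = tchart \<phi> v"
      using z unfolding cset_def by blast
    define p where "p = fst v"
    define x where "x = snd \<phi> p"
    have zx: "z = (x, snd z)" using v(3) by (simp add: tchart_def x_def p_def)
    interpret pointed_chart M \<A> \<phi> p
      by unfold_locales (use assms(2) \<phi> v(2) in \<open>auto simp: p_def tchart_dom_def\<close>)
    have A: "A \<subseteq> slit_TM \<A>" "openin (TM_top \<A>) A" "\<And>v t. v \<in> A \<Longrightarrow> t > 0 \<Longrightarrow> tscale t v \<in> A"
      using assms(4) unfolding conic_domain_def by auto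
    have ATM: "A \<subseteq> TM \<A>" using A(1) unfolding slit_TM_def by blast
    \<comment> \<open>\<open>S\<close> is the fibre of \<open>A\<close> over \<open>p\<close> in the coordinates of \<open>\<phi>\<close>.\<close>
    define Z where "Z = cset \<A> \<phi> A"
    define S where "S = {y. (x, y) \<in> Z}"
    have S: "S = {y. tangent y \<in> A}" unfolding S_def Z_def x_def mem_cset_iff ..
    have S_open: "open S" unfolding S by (rule open_tangent_preimage[OF A(2)])
    note o = S_open[unfolded S_def]
    have ZS: "(x, y) \<in> Z \<longleftrightarrow> y \<in> S" for y by (simp add: S_def)
    define l where "l y = cfun \<A> \<phi> L (x, y)" for y
    have l_L: "l y = L (tangent y)" for y unfolding l_def x_def by (rule cfun_tangent)
    have L: "\<And>v t. v \<in> A \<Longrightarrow> t > 0 \<Longrightarrow> L (tscale t v) = t\<^sup>2 * L v" "smooth_on Z (cfun \<A> \<phi> L)"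
      "\<And>z. z \<in> Z \<Longrightarrow> invertible (gmat (cfun \<A> \<phi> L) z)" "\<And>v. v \<in> A \<Longrightarrow> L v > 0"
      "connectedin (TM_top \<A>) {v \<in> A. fst v = p}"
      using assms(5) \<phi> chart(2) unfolding proper_pseudo_finsler_def pseudo_finsler_def Z_def by blast+
    have L_ext: "\<exists>F. extends_near smooth_on Z (cfun \<A> \<phi> L) z F \<and>
        (z \<in> cset \<A> \<phi> (slit_boundary \<A> A) \<longrightarrow> F z = 0 \<and> invertible (gmat F z))"
      if "z \<in> cset \<A> \<phi> (slit_closure \<A> A)" for z
      using assms(5) \<phi> that unfolding proper_pseudo_finsler_def Z_def by blast
    have gm: "gmat (cfun \<A> \<phi> L) (x, y) = fiber_metric l y" if "y \<in> S" for y
      using gmat_eq_fiber_metric[OF o L(2)] that by (simp add: S_def l_def[abs_def])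
    have N: "smooth_on Z (N \<phi>)" "\<And>y t. y \<in> S \<Longrightarrow> t > 0 \<Longrightarrow> N \<phi> (x, t *\<^sub>R y) = t *\<^sub>R N \<phi> (x, y)"
      using assms(8) \<phi>
      unfolding proper_affine_solution_def affine_solution_def nonlinear_connection_def Z_def S_def
      by fast+
    have N': "smooth_on Z (N' \<phi>)" "\<And>y t. y \<in> S \<Longrightarrow> t > 0 \<Longrightarrow> N' \<phi> (x, t *\<^sub>R y) = t *\<^sub>R N' \<phi> (x, y)"
      using assms(11) \<phi>
      unfolding proper_affine_solution_def affine_solution_def nonlinear_connection_def Z_def S_def
      by fast+
    obtain J where J0: "anisotropic_tensor11 1 \<A> A J" and J1: "\<And>z. z \<in> Z \<Longrightarrow>
        N \<phi> z = metric_connection (cfun \<A> \<phi> L) z + J \<phi> z \<and> affine_equation_at (cfun \<A> \<phi> L) (J \<phi>) z"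
      using assms(8) \<phi> unfolding proper_affine_solution_def affine_solution_def Z_def by blast
    obtain J' where J0': "anisotropic_tensor11 1 \<A> A J'" and J1': "\<And>z. z \<in> Z \<Longrightarrow>
        N' \<phi> z = metric_connection (cfun \<A> \<phi> L) z + J' \<phi> z \<and> affine_equation_at (cfun \<A> \<phi> L) (J' \<phi>) z"
      using assms(11) \<phi> unfolding proper_affine_solution_def affine_solution_def Z_def by blast
    have J: "smooth_on Z (J \<phi>)" "smooth_on Z (J' \<phi>)"
      using J0 J0' \<phi> unfolding anisotropic_tensor11_def Z_def by blast+
    \<comment> \<open>\<open>D\<close> is the difference of the connections, which extend to the closure, as well as that of the tensors
      \<open>J\<close> and \<open>J'\<close>, which occur in the affine equation.\<close>
    define D where "D k i y = N \<phi> (x, y) $ k $ i - N' \<phi> (x, y) $ k $ i" for k i y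
    note comp = connection_component_smooth[OF o]
    have D_J: "D k i y = J \<phi> (x, y) $ k $ i - J' \<phi> (x, y) $ k $ i" if "y \<in> S" for k i y
      using J1[of "(x, y)"] J1'[of "(x, y)"] that by (simp add: D_def S_def)
    have pd_comp: "pd j (\<lambda>y. K (x, y) $ k $ i - K' (x, y) $ k $ i) y =
        yd j (\<lambda>u. K u $ k $ i) (x, y) - yd j (\<lambda>u. K' u $ k $ i) (x, y)"
      if K: "smooth_on Z K" "smooth_on Z K'" and y: "y \<in> S"
      for K K' :: "'n tcoord \<Rightarrow> real ^ 'n ^ 'n" and k i j y
    proof -
      have xy: "(x, y) \<in> Z" using y by (simp add: S_def)
      have "(\<lambda>y. K (x, y) $ k $ i) differentiable (at y)" "(\<lambda>y. K' (x, y) $ k $ i) differentiable (at y)"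
        using smooth_on_differentiable[OF comp(1)[OF K(1)]] smooth_on_differentiable[OF comp(1)[OF K(2)]] xy
        by blast+
      then show ?thesis unfolding comp(2)[OF K(1) xy] comp(2)[OF K(2) xy] by (rule pd_diff)
    qed
    have pd_D: "pd j (D k i) y = yd j (\<lambda>u. N \<phi> u $ k $ i) (x, y) - yd j (\<lambda>u. N' \<phi> u $ k $ i) (x, y)"
      if "y \<in> S" for k i j y
      unfolding D_def[abs_def] by (rule pd_comp[OF N(1) N'(1) that])
    have pd_J: "pd j (D k i) y = yd j (\<lambda>u. J \<phi> u $ k $ i) (x, y) - yd j (\<lambda>u. J' \<phi> u $ k $ i) (x, y)"
      if y: "y \<in> S" for k i j y
    proof -
      have "pd j (D k i) y = pd j (\<lambda>y. J \<phi> (x, y) $ k $ i - J' \<phi> (x, y) $ k $ i) y"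
        by (rule pd_cong_open[OF S_open y]) (rule D_J)
      also have "\<dots> = yd j (\<lambda>u. J \<phi> u $ k $ i) (x, y) - yd j (\<lambda>u. J' \<phi> u $ k $ i) (x, y)"
        by (rule pd_comp[OF J y])
      finally show ?thesis .
    qed
    have D_sym: "pd j (D k i) y = pd i (D k j) y" if "y \<in> S" for i j k y
    proof -
      have "yd j (\<lambda>u. N \<phi> u $ k $ i) (x, y) - yd i (\<lambda>u. N \<phi> u $ k $ j) (x, y) = 0"
        "yd j (\<lambda>u. N' \<phi> u $ k $ i) (x, y) - yd i (\<lambda>u. N' \<phi> u $ k $ j) (x, y) = 0"
        using assms(9,12) \<phi> that unfolding symmetric_connection_def S_def Z_def by blast+
      then show ?thesis using that by (simp add: pd_D)
    qed
    have S0: "0 \<notin> S" using A(1) tangent_slit_iff by (auto simp: S)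
    interpret fiber_solution_difference S l D "real CARD('n)"
    proof unfold_locales
      fix y and t :: real assume yt: "y \<in> S" "t > 0"
      show "t *\<^sub>R y \<in> S" using yt A(3) by (simp add: S tangent_scale)
      show "l (t *\<^sub>R y) = t\<^sup>2 * l y" using yt L(1) by (simp add: l_L tangent_scale S)
      show "D k i (t *\<^sub>R y) = t * D k i y" for k i
        using yt by (simp add: D_def N(2) N'(2) right_diff_distrib)
    next
      fix y assume y: "y \<in> S"
      show "l y > 0" using y L(4) by (simp add: l_L S)
      show "invertible (fiber_metric l y)" using L(3)[of "(x, y)"] gm[OF y] y by (simp add: S_def)
      show "pd j (D k i) y = pd i (D k j) y" for i j k by (rule D_sym[OF y])
      have xy: "(x, y) \<in> Z" using y by (simp add: S_def)
      have "snd (x, y) \<noteq> 0" using y S0 by auto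
      from affine_equation_difference[OF conjunct2[OF J1[OF xy]] conjunct2[OF J1'[OF xy]]
          D_J[OF y] pd_J[OF y] D_sym[OF y] this]
      show "(real CARD('n) + 2) * (\<Sum>a\<in>UNIV. (\<Sum>c\<in>UNIV. fiber_metric l y $ a $ c * y $ c) / l y * D a b y)
        - 2 * (\<Sum>a\<in>UNIV. (\<Sum>c\<in>UNIV. \<Sum>e\<in>UNIV. matrix_inv (fiber_metric l y) $ c $ e *
            (1/2 * pd a (\<lambda>u. fiber_metric l u $ c $ e) y)) * D a b y)
        - (\<Sum>a\<in>UNIV. pd a (D a b) y + pd b (D a a) y) = 0" for b
        using assms(1) mean_cartan_slice[OF o L(2) xy]
        by (simp add: ylow_def gm[OF y] l_def[abs_def])
    next
      show "smooth_on S l" unfolding S_def l_def[abs_def] by (rule smooth_on_slice[OF o L(2)])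
      show "smooth_on S (D k i)" for k i
        unfolding D_def[abs_def] S_def by (intro smooth_on_diff o comp(1) N(1) N'(1))
    qed (use S_open assms(1) in auto)
    have clos: "(x, y) \<in> cset \<A> \<phi> (slit_closure \<A> A)" if "y \<in> closure S" "y \<noteq> 0" for y
      using tangent_in_slit_closure[OF A(1)] that by (simp add: x_def mem_cset_iff S)
    have "D k i (snd z) = 0" for k i
    proof (rule difference_vanishes)
      show "connected S" unfolding S by (rule connected_fiber[OF ATM L(5)])
      show "0 \<notin> S" by (rule S0)
      show "\<exists>u. u \<bullet> (fiber_metric l y *v u) < 0" if "y \<in> S" for y
        using assms(6) \<phi> that gm[OF that] unfolding indefinite_metric_def S_def Z_def by fastforce
      show "\<exists>F. extends_near smooth_on S l w F \<and> F w = 0 \<and> invertible (fiber_metric F w)"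
        if w: "w \<in> closure S" "w \<noteq> 0" "w \<notin> S" for w
      proof -
        have "(x, w) \<in> cset \<A> \<phi> (slit_boundary \<A> A)"
          using clos[OF w(1,2)] w(3) by (simp add: x_def mem_cset_iff S slit_boundary_def)
        then obtain F where F: "extends_near smooth_on Z (cfun \<A> \<phi> L) (x, w) F" "F (x, w) = 0"
          "invertible (gmat F (x, w))" using L_ext[OF clos[OF w(1,2)]] by blast
        show ?thesis using smooth_extension_slice[OF F(1)] F(2,3)
          by (intro exI[of _ "\<lambda>u. F (x, u)"]) (simp add: S_def l_def[abs_def])
      qed
      show "smooth_up_to S w (D k i)" if w: "w \<in> closure S" "w \<noteq> 0" for w k i
      proof -
        obtain F F' where "extends_near smooth_on Z (N \<phi>) (x, w) F"
          "extends_near smooth_on Z (N' \<phi>) (x, w) F'"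
          using assms(8,11) \<phi> clos[OF w] unfolding proper_affine_solution_def Z_def by blast
        then show ?thesis unfolding D_def[abs_def] S_def
          by (intro smooth_up_to_diff smooth_up_to_slice_component)
      qed
      show "analytic_up_to S w (D k i)" if w: "w \<in> closure S" "w \<noteq> 0" for w
      proof -
        obtain F F' where "extends_near real_analytic_on Z (N \<phi>) (x, w) F"
          "extends_near real_analytic_on Z (N' \<phi>) (x, w) F'"
          using assms(10,13) \<phi> clos[OF w] unfolding connection_analytic_closure_def Z_def by blast
        then show ?thesis unfolding D_def[abs_def] S_def
          by (intro analytic_up_to_minus analytic_up_to_slice_component)
      qed
      show "snd z \<in> S" using z zx by (simp add: S_def Z_def)
    qed
    then show ?thesis using zx by (simp add: vec_eq_iff D_def)
  qed
  then show ?thesis unfolding same_connection_def by blast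
qed

end
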